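(* Let $\mathcal{T}$ be a triangulated category with a Serre functor $\mathbb{S}$, let $n\ge1$, put $\mathbb{S}_n=\mathbb{S}\circ[-n]$, and let $\mathcal{C}$ be an $n$-cluster tilting subcategory of $\mathcal{T}$. Then for any $X\in\mathcal{C}$ there exists an AR $(n+2)$-angle $$Y\xrightarrow{f_n}C_{n-1}\xrightarrow{f_{n-1}}C_{n-2}\to\cdots\xrightarrow{f_2}C_1\xrightarrow{f_1}C_0\xrightarrow{f_0}X$$ in $\mathcal{C}$ with $Y=\mathbb{S}_nX$. Respectively, for any $Y\in\mathcal{C}$ there exists such an AR $(n+2)$-angle with $X=\mathbb{S}_n^{-1}Y$.
   Context: Conventions: $k$ is a fixed field; all additive categories are Krull-Schmidt; triangulated categories are $k$-linear with finite-dimensional Hom-spaces and shift $[1]$. A subcategory means a full subcategory closed under isomorphisms, direct sums and direct summands (not necessarily under $[1]$). $(X,Y)$ denotes the morphism space, $fg$ means first $f$, then $g$, and $J_{\mathcal{C}}$ is the Jacobson radical of $\mathcal{C}$. For subcategories, $(\mathcal{X},\mathcal{Y})=0$ means all morphisms from objects of $\mathcal X$ to objects of $\mathcal Y$ vanish; $\mathcal{X}^\perp=\{T\mid(\mathcal{X},T)=0\}$, ${}^\perp\mathcal{X}=\{T\mid (T,\mathcal{X})=0\}$. A Serre functor of $\mathcal{T}$ is a $k$-linear autofunctor $\mathbb{S}$ with functorial isomorphisms $(X,Y)\simeq D(Y,\mathbb{S}X)$, where $D$ is the $k$-dual. A morphism $f:X\to Y$ is right minimal if it has no direct summand of the form $T\to0$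 with $T\neq0$; left minimal is dual. For a subcategory $\mathcal{C}$ of $\mathcal{T}$, a right $\mathcal{C}$-approximation of $Y$ is a morphism $f:X\to Y$ with $X\in\mathcal{C}$ such that $(-,X)\to(-,Y)\to0$ is exact on $\mathcal{C}$; left $\mathcal{C}$-approximations are dual; an approximation is called minimal if it is right (resp. left) minimal. $\mathcal{C}$ is functorially finite if every object of $\mathcal{T}$ has both a right and a left $\mathcal{C}$-approximation. A sink map of $Y\in\mathcal{C}$ in $\mathcal{C}$ is a right minimal morphism $f:X\to Y$ in $J_{\mathcal{C}}$ such that $(-,X)\to J_{\mathcal{C}}(-,Y)\to 0$ is exact on $\mathcal{C}$; source maps are dual. A functorially finite subcategory $\mathcal{C}$ is $n$-cluster tilting if $\mathcal{C}=\bigcap_{i=1}^{n-1}\mathcal{C}[-i]^\perp=\bigcap_{i=1}^{n-1}{}^\perp\mathcal{C}[i]$ (for $n=1$: $\mathcal{C}=\mathcal{T}$). An $(n+2)$-angle is a complex $X_n\xrightarrow{b_n}C_{n-1}\xrightarrow{a_{n-1}b_{n-1}}C_{n-2}\to\cdots\xrightarrow{a_1b_1}C_0\xrightarrow{a_0}X_0$ obtained by gluing triangles $X_{i+1}\xrightarrow{b_{i+1}}C_i\xrightarrow{a_i}X_i\to X_{i+1}[1]$ for $0\le i<n$. For an $n$-cluster tilting $\mathcal{C}$, such an $(n+2)$-angle, with $X=X_0$, $Y=X_n$, is called an AR $(n+2)$-angle (in $\mathcal{C}$) if: (0) $X$, $Y$ and all $C_i$ belong to $\mathcal{C}$; (i)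 $a_0$ is a sink map of $X$ in $\mathcal{C}$ and $b_n$ is a source map of $Y$ in $\mathcal{C}$; (ii) $a_i$ is a minimal right $\mathcal{C}$-approximation of $X_i$ for $0<i<n$; (iii) $b_i$ is a minimal left $\mathcal{C}$-approximation of $X_i$ for $0<i<n$. *)

theory Defs
  imports "HOL-Algebra.Module" "HOL-Library.FuncSet"
begin

section \<open>Linear categories\<close>

text \<open>
  The objects of a category are the elements of a type, and the morphisms from X to Y are the
  carrier of a module record \<open>Hom T X Y\<close>.  Only the carrier, zero, addition and scalar
  multiplication of that record matter; its ring product and unit are never used.
  Composition is written in diagrammatic order: \<open>f \<Zcomp> g\<close> is first f, then g.
  Every morphism is always used together with its source and target, so that the Hom-sets
  need not be disjoint.
\<close>

record ('o, 'm, 'k) linear_cat =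
  Hom :: "'o \<Rightarrow> 'o \<Rightarrow> ('k, 'm) module"
  Cmp :: "'m \<Rightarrow> 'm \<Rightarrow> 'm" (infixl "\<Zcomp>\<index>" 70)
  Ident :: "'o \<Rightarrow> 'm"

abbreviation mor :: "('o, 'm, 'k, 'z) linear_cat_scheme \<Rightarrow> 'o \<Rightarrow> 'o \<Rightarrow> 'm set"
  where "mor T X Y \<equiv> carrier (Hom T X Y)"

abbreviation zero_mor :: "('o, 'm, 'k, 'z) linear_cat_scheme \<Rightarrow> 'o \<Rightarrow> 'o \<Rightarrow> 'm"
  where "zero_mor T X Y \<equiv> \<zero>\<^bsub>Hom T X Y\<^esub>"

definition is_iso :: "('o, 'm, 'k, 'z) linear_cat_scheme \<Rightarrow> 'o \<Rightarrow> 'o \<Rightarrow> 'm \<Rightarrow> bool" where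
  "is_iso T X Y f \<longleftrightarrow> f \<in> mor T X Y \<and>
     (\<exists>g \<in> mor T Y X. f \<Zcomp>\<^bsub>T\<^esub> g = Ident T X \<and> g \<Zcomp>\<^bsub>T\<^esub> f = Ident T Y)"

definition isomorphic :: "('o, 'm, 'k, 'z) linear_cat_scheme \<Rightarrow> 'o \<Rightarrow> 'o \<Rightarrow> bool" where
  "isomorphic T X Y \<longleftrightarrow> (\<exists>f. is_iso T X Y f)"

definition is_zero_obj :: "('o, 'm, 'k, 'z) linear_cat_scheme \<Rightarrow> 'o \<Rightarrow> bool" where
  "is_zero_obj T Z \<longleftrightarrow>
     (\<forall>X. mor T X Z = {zero_mor T X Z} \<and> mor T Z X = {zero_mor T Z X})"

definition is_biproduct ::
  "('o, 'm, 'k, 'z) linear_cat_scheme \<Rightarrow> 'o \<Rightarrow> 'o \<Rightarrow> 'o \<Rightarrow> 'm \<Rightarrow> 'm \<Rightarrow> 'm \<Rightarrow> 'm \<Rightarrow> bool" where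
  "is_biproduct T A B X i j p q \<longleftrightarrow>
     i \<in> mor T A X \<and> j \<in> mor T B X \<and> p \<in> mor T X A \<and> q \<in> mor T X B \<and>
     i \<Zcomp>\<^bsub>T\<^esub> p = Ident T A \<and> j \<Zcomp>\<^bsub>T\<^esub> q = Ident T B \<and>
     i \<Zcomp>\<^bsub>T\<^esub> q = zero_mor T A B \<and> j \<Zcomp>\<^bsub>T\<^esub> p = zero_mor T B A \<and>
     (p \<Zcomp>\<^bsub>T\<^esub> i) \<oplus>\<^bsub>Hom T X X\<^esub> (q \<Zcomp>\<^bsub>T\<^esub> j) = Ident T X"

definition is_direct_sum2 :: "('o, 'm, 'k, 'z) linear_cat_scheme \<Rightarrow> 'o \<Rightarrow> 'o \<Rightarrow> 'o \<Rightarrow> bool" where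
  "is_direct_sum2 T A B X \<longleftrightarrow> (\<exists>i j p q. is_biproduct T A B X i j p q)"

definition is_direct_sum ::
  "('o, 'm, 'k, 'z) linear_cat_scheme \<Rightarrow> nat \<Rightarrow> (nat \<Rightarrow> 'o) \<Rightarrow> 'o \<Rightarrow> bool" where
  "is_direct_sum T m A X \<longleftrightarrow> (\<exists>i p.
     (\<forall>r<m. i r \<in> mor T (A r) X \<and> p r \<in> mor T X (A r)) \<and>
     (\<forall>r<m. \<forall>s<m. i r \<Zcomp>\<^bsub>T\<^esub> p s = (if r = s then Ident T (A r) else zero_mor T (A r) (A s))) \<and>
     (\<Oplus>\<^bsub>Hom T X X\<^esub>r\<in>{..<m}. p r \<Zcomp>\<^bsub>T\<^esub> i r) = Ident T X)"

locale linear_category = field k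
  for k :: "('k, 'r) ring_scheme" +
  fixes T :: "('o, 'm, 'k, 'z) linear_cat_scheme"
  assumes Hom_module: "module k (Hom T X Y)"
    and Cmp_closed: "\<lbrakk>f \<in> mor T X Y; g \<in> mor T Y Z\<rbrakk> \<Longrightarrow> f \<Zcomp>\<^bsub>T\<^esub> g \<in> mor T X Z"
    and Ident_closed: "Ident T X \<in> mor T X X"
    and Cmp_assoc: "\<lbrakk>f \<in> mor T X Y; g \<in> mor T Y Z; h \<in> mor T Z W\<rbrakk> \<Longrightarrow>
      (f \<Zcomp>\<^bsub>T\<^esub> g) \<Zcomp>\<^bsub>T\<^esub> h = f \<Zcomp>\<^bsub>T\<^esub> (g \<Zcomp>\<^bsub>T\<^esub> h)"
    and Ident_left: "f \<in> mor T X Y \<Longrightarrow> Ident T X \<Zcomp>\<^bsub>T\<^esub> f = f"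
    and Ident_right: "f \<in> mor T X Y \<Longrightarrow> f \<Zcomp>\<^bsub>T\<^esub> Ident T Y = f"
    and Cmp_add_left: "\<lbrakk>f \<in> mor T X Y; f' \<in> mor T X Y; g \<in> mor T Y Z\<rbrakk> \<Longrightarrow>
      (f \<oplus>\<^bsub>Hom T X Y\<^esub> f') \<Zcomp>\<^bsub>T\<^esub> g = (f \<Zcomp>\<^bsub>T\<^esub> g) \<oplus>\<^bsub>Hom T X Z\<^esub> (f' \<Zcomp>\<^bsub>T\<^esub> g)"
    and Cmp_add_right: "\<lbrakk>f \<in> mor T X Y; g \<in> mor T Y Z; g' \<in> mor T Y Z\<rbrakk> \<Longrightarrow>
      f \<Zcomp>\<^bsub>T\<^esub> (g \<oplus>\<^bsub>Hom T Y Z\<^esub> g') = (f \<Zcomp>\<^bsub>T\<^esub> g) \<oplus>\<^bsub>Hom T X Z\<^esub> (f \<Zcomp>\<^bsub>T\<^esub> g')"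
    and Cmp_smult_left: "\<lbrakk>c \<in> carrier k; f \<in> mor T X Y; g \<in> mor T Y Z\<rbrakk> \<Longrightarrow>
      (c \<odot>\<^bsub>Hom T X Y\<^esub> f) \<Zcomp>\<^bsub>T\<^esub> g = c \<odot>\<^bsub>Hom T X Z\<^esub> (f \<Zcomp>\<^bsub>T\<^esub> g)"
    and Cmp_smult_right: "\<lbrakk>c \<in> carrier k; f \<in> mor T X Y; g \<in> mor T Y Z\<rbrakk> \<Longrightarrow>
      f \<Zcomp>\<^bsub>T\<^esub> (c \<odot>\<^bsub>Hom T Y Z\<^esub> g) = c \<odot>\<^bsub>Hom T X Z\<^esub> (f \<Zcomp>\<^bsub>T\<^esub> g)"

locale additive_linear_category = linear_category k T
  for k :: "('k, 'r) ring_scheme" and T :: "('o, 'm, 'k, 'z) linear_cat_scheme" +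
  assumes zero_obj_exists: "\<exists>Z. is_zero_obj T Z"
    and biproduct_exists: "\<exists>X. is_direct_sum2 T A B X"


subsection \<open>Hom-finiteness and the Krull-Schmidt property\<close>

definition finite_dimensional :: "('k, 'r) ring_scheme \<Rightarrow> ('k, 'm) module \<Rightarrow> bool" where
  "finite_dimensional k M \<longleftrightarrow> (\<exists>B. finite B \<and> B \<subseteq> carrier M \<and>
     (\<forall>v \<in> carrier M. \<exists>c \<in> B \<rightarrow> carrier k. v = (\<Oplus>\<^bsub>M\<^esub>b\<in>B. c b \<odot>\<^bsub>M\<^esub> b)))"

definition hom_finite ::
  "('k, 'r) ring_scheme \<Rightarrow> ('o, 'm, 'k, 'z) linear_cat_scheme \<Rightarrow> bool" where
  "hom_finite k T \<longleftrightarrow> (\<forall>X Y. finite_dimensional k (Hom T X Y))"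

definition End_ring :: "('o, 'm, 'k, 'z) linear_cat_scheme \<Rightarrow> 'o \<Rightarrow> 'm ring" where
  "End_ring T X = \<lparr>carrier = mor T X X, mult = (\<lambda>f g. f \<Zcomp>\<^bsub>T\<^esub> g), one = Ident T X,
     zero = zero_mor T X X, add = add (Hom T X X)\<rparr>"

definition local_ring :: "('a, 'r) ring_scheme \<Rightarrow> bool" where
  "local_ring R \<longleftrightarrow> \<one>\<^bsub>R\<^esub> \<noteq> \<zero>\<^bsub>R\<^esub> \<and>
     (\<forall>x \<in> carrier R - Units R. \<forall>y \<in> carrier R - Units R. x \<oplus>\<^bsub>R\<^esub> y \<notin> Units R)"

definition krull_schmidt :: "('o, 'm, 'k, 'z) linear_cat_scheme \<Rightarrow> bool" where
  "krull_schmidt T \<longleftrightarrow>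
     (\<forall>X. \<exists>m A. (\<forall>r<m. local_ring (End_ring T (A r))) \<and> is_direct_sum T m A X)"


section \<open>Linear endofunctors\<close>

record ('o, 'm) endofunctor =
  obj_map :: "'o \<Rightarrow> 'o"
  mor_map :: "'m \<Rightarrow> 'm"

definition linear_functor ::
  "('k, 'r) ring_scheme \<Rightarrow> ('o, 'm, 'k, 'z) linear_cat_scheme \<Rightarrow> ('o, 'm) endofunctor \<Rightarrow> bool" where
  "linear_functor k T F \<longleftrightarrow>
     (\<forall>X. mor_map F (Ident T X) = Ident T (obj_map F X)) \<and>
     (\<forall>X Y. \<forall>f \<in> mor T X Y. mor_map F f \<in> mor T (obj_map F X) (obj_map F Y)) \<and>
     (\<forall>X Y Z. \<forall>f \<in> mor T X Y. \<forall>g \<in> mor T Y Z.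
        mor_map F (f \<Zcomp>\<^bsub>T\<^esub> g) = mor_map F f \<Zcomp>\<^bsub>T\<^esub> mor_map F g) \<and>
     (\<forall>X Y. \<forall>f \<in> mor T X Y. \<forall>g \<in> mor T X Y.
        mor_map F (f \<oplus>\<^bsub>Hom T X Y\<^esub> g) =
          mor_map F f \<oplus>\<^bsub>Hom T (obj_map F X) (obj_map F Y)\<^esub> mor_map F g) \<and>
     (\<forall>X Y. \<forall>c \<in> carrier k. \<forall>f \<in> mor T X Y.
        mor_map F (c \<odot>\<^bsub>Hom T X Y\<^esub> f) = c \<odot>\<^bsub>Hom T (obj_map F X) (obj_map F Y)\<^esub> mor_map F f)"

text \<open>A strict automorphism: a functor that is bijective on objects and on morphisms.\<close>

definition linear_automorphism ::
  "('k, 'r) ring_scheme \<Rightarrow> ('o, 'm, 'k, 'z) linear_cat_scheme \<Rightarrow> ('o, 'm) endofunctor \<Rightarrow> bool" where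
  "linear_automorphism k T F \<longleftrightarrow> linear_functor k T F \<and> bij (obj_map F) \<and>
     (\<forall>X Y. bij_betw (mor_map F) (mor T X Y) (mor T (obj_map F X) (obj_map F Y)))"

definition functor_id :: "('o, 'm) endofunctor" where
  "functor_id = \<lparr>obj_map = (\<lambda>X. X), mor_map = (\<lambda>f. f)\<rparr>"

text \<open>\<open>functor_cmp F G\<close> is first F, then G.\<close>

definition functor_cmp ::
  "('o, 'm) endofunctor \<Rightarrow> ('o, 'm) endofunctor \<Rightarrow> ('o, 'm) endofunctor" where
  "functor_cmp F G =
     \<lparr>obj_map = (\<lambda>X. obj_map G (obj_map F X)), mor_map = (\<lambda>f. mor_map G (mor_map F f))\<rparr>"

definition naturally_isomorphic ::
  "('o, 'm, 'k, 'z) linear_cat_scheme \<Rightarrow> ('o, 'm) endofunctor \<Rightarrow> ('o, 'm) endofunctor \<Rightarrow> bool" where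
  "naturally_isomorphic T F G \<longleftrightarrow> (\<exists>\<eta>.
     (\<forall>X. is_iso T (obj_map F X) (obj_map G X) (\<eta> X)) \<and>
     (\<forall>X Y. \<forall>f \<in> mor T X Y. mor_map F f \<Zcomp>\<^bsub>T\<^esub> \<eta> Y = \<eta> X \<Zcomp>\<^bsub>T\<^esub> mor_map G f))"

definition quasi_inverse ::
  "('k, 'r) ring_scheme \<Rightarrow> ('o, 'm, 'k, 'z) linear_cat_scheme \<Rightarrow>
   ('o, 'm) endofunctor \<Rightarrow> ('o, 'm) endofunctor \<Rightarrow> bool" where
  "quasi_inverse k T F G \<longleftrightarrow> linear_functor k T F \<and> linear_functor k T G \<and>
     naturally_isomorphic T (functor_cmp F G) functor_id \<and>
     naturally_isomorphic T (functor_cmp G F) functor_id"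

definition linear_autoequivalence ::
  "('k, 'r) ring_scheme \<Rightarrow> ('o, 'm, 'k, 'z) linear_cat_scheme \<Rightarrow> ('o, 'm) endofunctor \<Rightarrow> bool" where
  "linear_autoequivalence k T F \<longleftrightarrow> (\<exists>G. quasi_inverse k T F G)"


section \<open>Triangulated categories\<close>

text \<open>\<open>tri T X Y Z u v w\<close>: the sequence of u from X to Y, v from Y to Z and w from Z to X[1] is a
  distinguished triangle.\<close>

record ('o, 'm, 'k) tri_cat = "('o, 'm, 'k) linear_cat" +
  shift :: "('o, 'm) endofunctor"
  tri :: "'o \<Rightarrow> 'o \<Rightarrow> 'o \<Rightarrow> 'm \<Rightarrow> 'm \<Rightarrow> 'm \<Rightarrow> bool"

abbreviation sh_obj :: "('o, 'm, 'k, 'z) tri_cat_scheme \<Rightarrow> 'o \<Rightarrow> 'o"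
  where "sh_obj T \<equiv> obj_map (shift T)"

abbreviation sh_mor :: "('o, 'm, 'k, 'z) tri_cat_scheme \<Rightarrow> 'm \<Rightarrow> 'm"
  where "sh_mor T \<equiv> mor_map (shift T)"

locale triangulated_category = additive_linear_category k T
  for k :: "('k, 'r) ring_scheme" and T :: "('o, 'm, 'k, 'z) tri_cat_scheme" +
  assumes shift_automorphism: "linear_automorphism k T (shift T)"
    and tri_typed: "tri T X Y Z u v w \<Longrightarrow>
      u \<in> mor T X Y \<and> v \<in> mor T Y Z \<and> w \<in> mor T Z (sh_obj T X)"
    and tri_iso: "\<lbrakk>tri T X Y Z u v w;
      u' \<in> mor T X' Y'; v' \<in> mor T Y' Z'; w' \<in> mor T Z' (sh_obj T X');
      is_iso T X X' f; is_iso T Y Y' g; is_iso T Z Z' h;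
      u \<Zcomp>\<^bsub>T\<^esub> g = f \<Zcomp>\<^bsub>T\<^esub> u'; v \<Zcomp>\<^bsub>T\<^esub> h = g \<Zcomp>\<^bsub>T\<^esub> v'; w \<Zcomp>\<^bsub>T\<^esub> sh_mor T f = h \<Zcomp>\<^bsub>T\<^esub> w'\<rbrakk>
      \<Longrightarrow> tri T X' Y' Z' u' v' w'"
    and tri_ident: "is_zero_obj T Z \<Longrightarrow>
      tri T X X Z (Ident T X) (zero_mor T X Z) (zero_mor T Z (sh_obj T X))"
    and tri_complete: "u \<in> mor T X Y \<Longrightarrow> \<exists>Z v w. tri T X Y Z u v w"
    and tri_rotate: "\<lbrakk>u \<in> mor T X Y; v \<in> mor T Y Z; w \<in> mor T Z (sh_obj T X)\<rbrakk> \<Longrightarrow>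
      tri T X Y Z u v w \<longleftrightarrow>
      tri T Y Z (sh_obj T X) v w (\<ominus>\<^bsub>Hom T (sh_obj T X) (sh_obj T Y)\<^esub> sh_mor T u)"
    and tri_morphism: "\<lbrakk>tri T X Y Z u v w; tri T X' Y' Z' u' v' w';
      f \<in> mor T X X'; g \<in> mor T Y Y'; u \<Zcomp>\<^bsub>T\<^esub> g = f \<Zcomp>\<^bsub>T\<^esub> u'\<rbrakk> \<Longrightarrow>
      \<exists>h \<in> mor T Z Z'. v \<Zcomp>\<^bsub>T\<^esub> h = g \<Zcomp>\<^bsub>T\<^esub> v' \<and> w \<Zcomp>\<^bsub>T\<^esub> sh_mor T f = h \<Zcomp>\<^bsub>T\<^esub> w'"
    and octahedral: "\<lbrakk>tri T X Y Z' u i i'; tri T Y Z X' v j j'; tri T X Z Y' (u \<Zcomp>\<^bsub>T\<^esub> v) l l'\<rbrakk> \<Longrightarrow>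
      \<exists>f g. tri T Z' Y' X' f g (j' \<Zcomp>\<^bsub>T\<^esub> sh_mor T i) \<and>
        i \<Zcomp>\<^bsub>T\<^esub> f = v \<Zcomp>\<^bsub>T\<^esub> l \<and> f \<Zcomp>\<^bsub>T\<^esub> l' = i' \<and>
        l \<Zcomp>\<^bsub>T\<^esub> g = j \<and> g \<Zcomp>\<^bsub>T\<^esub> j' = l' \<Zcomp>\<^bsub>T\<^esub> sh_mor T u"

text \<open>\<open>shift_obj T i X\<close> is X[i]; the shift is bijective on objects.\<close>

definition shift_obj :: "('o, 'm, 'k, 'z) tri_cat_scheme \<Rightarrow> int \<Rightarrow> 'o \<Rightarrow> 'o" where
  "shift_obj T i X =
     (if i \<ge> 0 then (sh_obj T ^^ nat i) X else (inv_into UNIV (sh_obj T) ^^ nat (- i)) X)"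


section \<open>Serre functors\<close>

definition dual_module :: "('k, 'r) ring_scheme \<Rightarrow> ('k, 'm) module \<Rightarrow> ('k, 'm \<Rightarrow> 'k) module" where
  "dual_module k M =
     \<lparr>carrier = {\<phi> \<in> carrier M \<rightarrow>\<^sub>E carrier k.
        (\<forall>x \<in> carrier M. \<forall>y \<in> carrier M. \<phi> (x \<oplus>\<^bsub>M\<^esub> y) = \<phi> x \<oplus>\<^bsub>k\<^esub> \<phi> y) \<and>
        (\<forall>c \<in> carrier k. \<forall>x \<in> carrier M. \<phi> (c \<odot>\<^bsub>M\<^esub> x) = c \<otimes>\<^bsub>k\<^esub> \<phi> x)},
      mult = undefined, one = undefined,
      zero = (\<lambda>x \<in> carrier M. \<zero>\<^bsub>k\<^esub>),
      add = (\<lambda>\<phi> \<psi>. \<lambda>x \<in> carrier M. \<phi> x \<oplus>\<^bsub>k\<^esub> \<psi> x),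
      smult = (\<lambda>c \<phi>. \<lambda>x \<in> carrier M. c \<otimes>\<^bsub>k\<^esub> \<phi> x)\<rparr>"

definition module_isomorphism ::
  "('k, 'r) ring_scheme \<Rightarrow> ('k, 'm) module \<Rightarrow> ('k, 'n) module \<Rightarrow> ('m \<Rightarrow> 'n) \<Rightarrow> bool" where
  "module_isomorphism k M N h \<longleftrightarrow> bij_betw h (carrier M) (carrier N) \<and>
     (\<forall>x \<in> carrier M. \<forall>y \<in> carrier M. h (x \<oplus>\<^bsub>M\<^esub> y) = h x \<oplus>\<^bsub>N\<^esub> h y) \<and>
     (\<forall>c \<in> carrier k. \<forall>x \<in> carrier M. h (c \<odot>\<^bsub>M\<^esub> x) = c \<odot>\<^bsub>N\<^esub> h x)"

text \<open>The last two conditions are naturality of the isomorphism in Y and in X.\<close>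

definition serre_functor ::
  "('k, 'r) ring_scheme \<Rightarrow> ('o, 'm, 'k, 'z) linear_cat_scheme \<Rightarrow> ('o, 'm) endofunctor \<Rightarrow> bool" where
  "serre_functor k T S \<longleftrightarrow> linear_autoequivalence k T S \<and>
     (\<exists>\<phi>. (\<forall>X Y. module_isomorphism k (Hom T X Y) (dual_module k (Hom T Y (obj_map S X))) (\<phi> X Y)) \<and>
        (\<forall>X Y Y'. \<forall>f \<in> mor T X Y. \<forall>g \<in> mor T Y Y'. \<forall>h \<in> mor T Y' (obj_map S X).
           \<phi> X Y' (f \<Zcomp>\<^bsub>T\<^esub> g) h = \<phi> X Y f (g \<Zcomp>\<^bsub>T\<^esub> h)) \<and>
        (\<forall>X X' Y. \<forall>e \<in> mor T X' X. \<forall>f \<in> mor T X Y. \<forall>h \<in> mor T Y (obj_map S X').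
           \<phi> X' Y (e \<Zcomp>\<^bsub>T\<^esub> f) h = \<phi> X Y f (h \<Zcomp>\<^bsub>T\<^esub> mor_map S e)))"

definition serre_n ::
  "('o, 'm, 'k, 'z) tri_cat_scheme \<Rightarrow> ('o, 'm) endofunctor \<Rightarrow> nat \<Rightarrow> 'o \<Rightarrow> 'o" where
  "serre_n T S n X = obj_map S (shift_obj T (- int n) X)"

text \<open>Here \<open>S'\<close> is meant to be a quasi-inverse of the Serre functor.\<close>

definition serre_n_inv ::
  "('o, 'm, 'k, 'z) tri_cat_scheme \<Rightarrow> ('o, 'm) endofunctor \<Rightarrow> nat \<Rightarrow> 'o \<Rightarrow> 'o" where
  "serre_n_inv T S' n Y = shift_obj T (int n) (obj_map S' Y)"


section \<open>Approximations, sink maps and source maps\<close>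

text \<open>Full subcategories are represented by their sets of objects.\<close>

definition subcategory :: "('o, 'm, 'k, 'z) linear_cat_scheme \<Rightarrow> 'o set \<Rightarrow> bool" where
  "subcategory T C \<longleftrightarrow>
     (\<forall>X Y. X \<in> C \<longrightarrow> isomorphic T X Y \<longrightarrow> Y \<in> C) \<and>
     (\<forall>Z. is_zero_obj T Z \<longrightarrow> Z \<in> C) \<and>
     (\<forall>A B X. is_direct_sum2 T A B X \<longrightarrow> (X \<in> C \<longleftrightarrow> A \<in> C \<and> B \<in> C))"

text \<open>The Jacobson radical.  For a full subcategory containing X and Y it is given by the same
  morphisms, as only endomorphisms of X are involved.\<close>

definition jacobson_radical :: "('o, 'm, 'k, 'z) linear_cat_scheme \<Rightarrow> 'o \<Rightarrow> 'o \<Rightarrow> 'm set" where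
  "jacobson_radical T X Y =
     {f \<in> mor T X Y. \<forall>g \<in> mor T Y X. is_iso T X X (Ident T X \<ominus>\<^bsub>Hom T X X\<^esub> (f \<Zcomp>\<^bsub>T\<^esub> g))}"

text \<open>The morphism g from A to B is a direct summand of the morphism f from X to Y:
  f is the direct sum of g and some \<open>g'\<close>.\<close>

definition mor_summand ::
  "('o, 'm, 'k, 'z) linear_cat_scheme \<Rightarrow> 'o \<Rightarrow> 'o \<Rightarrow> 'm \<Rightarrow> 'o \<Rightarrow> 'o \<Rightarrow> 'm \<Rightarrow> bool" where
  "mor_summand T A B g X Y f \<longleftrightarrow> g \<in> mor T A B \<and> f \<in> mor T X Y \<and>
     (\<exists>A' B' g' i i' p p' j j' q q'.
        is_biproduct T A A' X i i' p p' \<and> is_biproduct T B B' Y j j' q q' \<and> g' \<in> mor T A' B' \<and>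
        f = (p \<Zcomp>\<^bsub>T\<^esub> g \<Zcomp>\<^bsub>T\<^esub> j) \<oplus>\<^bsub>Hom T X Y\<^esub> (p' \<Zcomp>\<^bsub>T\<^esub> g' \<Zcomp>\<^bsub>T\<^esub> j'))"

definition right_minimal :: "('o, 'm, 'k, 'z) linear_cat_scheme \<Rightarrow> 'o \<Rightarrow> 'o \<Rightarrow> 'm \<Rightarrow> bool" where
  "right_minimal T X Y f \<longleftrightarrow> f \<in> mor T X Y \<and>
     \<not> (\<exists>A Z g. \<not> is_zero_obj T A \<and> is_zero_obj T Z \<and> mor_summand T A Z g X Y f)"

definition left_minimal :: "('o, 'm, 'k, 'z) linear_cat_scheme \<Rightarrow> 'o \<Rightarrow> 'o \<Rightarrow> 'm \<Rightarrow> bool" where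
  "left_minimal T X Y f \<longleftrightarrow> f \<in> mor T X Y \<and>
     \<not> (\<exists>A Z g. \<not> is_zero_obj T A \<and> is_zero_obj T Z \<and> mor_summand T Z A g X Y f)"

definition right_approximation ::
  "('o, 'm, 'k, 'z) linear_cat_scheme \<Rightarrow> 'o set \<Rightarrow> 'o \<Rightarrow> 'o \<Rightarrow> 'm \<Rightarrow> bool" where
  "right_approximation T C X Y f \<longleftrightarrow> X \<in> C \<and> f \<in> mor T X Y \<and>
     (\<forall>W \<in> C. (\<lambda>h. h \<Zcomp>\<^bsub>T\<^esub> f) ` mor T W X = mor T W Y)"

definition left_approximation ::
  "('o, 'm, 'k, 'z) linear_cat_scheme \<Rightarrow> 'o set \<Rightarrow> 'o \<Rightarrow> 'o \<Rightarrow> 'm \<Rightarrow> bool" where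
  "left_approximation T C X Y f \<longleftrightarrow> Y \<in> C \<and> f \<in> mor T X Y \<and>
     (\<forall>W \<in> C. (\<lambda>h. f \<Zcomp>\<^bsub>T\<^esub> h) ` mor T Y W = mor T X W)"

definition functorially_finite :: "('o, 'm, 'k, 'z) linear_cat_scheme \<Rightarrow> 'o set \<Rightarrow> bool" where
  "functorially_finite T C \<longleftrightarrow>
     (\<forall>Y. (\<exists>X f. right_approximation T C X Y f) \<and> (\<exists>Z g. left_approximation T C Y Z g))"

definition sink_map ::
  "('o, 'm, 'k, 'z) linear_cat_scheme \<Rightarrow> 'o set \<Rightarrow> 'o \<Rightarrow> 'o \<Rightarrow> 'm \<Rightarrow> bool" where
  "sink_map T C X Y f \<longleftrightarrow> X \<in> C \<and> Y \<in> C \<and> f \<in> jacobson_radical T X Y \<and> right_minimal T X Y f \<and>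
     (\<forall>W \<in> C. (\<lambda>h. h \<Zcomp>\<^bsub>T\<^esub> f) ` mor T W X = jacobson_radical T W Y)"

definition source_map ::
  "('o, 'm, 'k, 'z) linear_cat_scheme \<Rightarrow> 'o set \<Rightarrow> 'o \<Rightarrow> 'o \<Rightarrow> 'm \<Rightarrow> bool" where
  "source_map T C X Y f \<longleftrightarrow> X \<in> C \<and> Y \<in> C \<and> f \<in> jacobson_radical T X Y \<and> left_minimal T X Y f \<and>
     (\<forall>W \<in> C. (\<lambda>h. f \<Zcomp>\<^bsub>T\<^esub> h) ` mor T Y W = jacobson_radical T X W)"


section \<open>Cluster tilting and Auslander-Reiten angles\<close>

definition right_perp :: "('o, 'm, 'k, 'z) linear_cat_scheme \<Rightarrow> 'o set \<Rightarrow> 'o set" where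
  "right_perp T C = {W. \<forall>X \<in> C. mor T X W = {zero_mor T X W}}"

definition left_perp :: "('o, 'm, 'k, 'z) linear_cat_scheme \<Rightarrow> 'o set \<Rightarrow> 'o set" where
  "left_perp T C = {W. \<forall>X \<in> C. mor T W X = {zero_mor T W X}}"

text \<open>For \<open>n = 1\<close> both intersections are empty, hence equal to the set of all objects.\<close>

definition n_cluster_tilting :: "('o, 'm, 'k, 'z) tri_cat_scheme \<Rightarrow> nat \<Rightarrow> 'o set \<Rightarrow> bool" where
  "n_cluster_tilting T n C \<longleftrightarrow> subcategory T C \<and> functorially_finite T C \<and>
     C = (\<Inter>i\<in>{1..<n}. right_perp T (shift_obj T (- int i) ` C)) \<and>
     C = (\<Inter>i\<in>{1..<n}. left_perp T (shift_obj T (int i) ` C))"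

text \<open>
  \<open>glued_angle T n Xs Cs a b f\<close>: the complex
  \<open>Xs n \<rightarrow> Cs (n - 1) \<rightarrow> \<dots> \<rightarrow> Cs 0 \<rightarrow> Xs 0\<close> with maps \<open>f n, \<dots>, f 0\<close>, where \<open>f i\<close> starts at \<open>Cs i\<close>
  for \<open>i < n\<close>, is obtained by gluing triangles
  \<open>Xs (i + 1) \<rightarrow> Cs i \<rightarrow> Xs i \<rightarrow> Xs (i + 1)[1]\<close> with first map \<open>b (i + 1)\<close> and second map \<open>a i\<close>.
\<close>

definition glued_angle ::
  "('o, 'm, 'k, 'z) tri_cat_scheme \<Rightarrow> nat \<Rightarrow> (nat \<Rightarrow> 'o) \<Rightarrow> (nat \<Rightarrow> 'o) \<Rightarrow>
   (nat \<Rightarrow> 'm) \<Rightarrow> (nat \<Rightarrow> 'm) \<Rightarrow> (nat \<Rightarrow> 'm) \<Rightarrow> bool" where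
  "glued_angle T n Xs Cs a b f \<longleftrightarrow>
     (\<forall>i<n. \<exists>w. tri T (Xs (Suc i)) (Cs i) (Xs i) (b (Suc i)) (a i) w) \<and>
     f 0 = a 0 \<and> (\<forall>i. 0 < i \<and> i < n \<longrightarrow> f i = a i \<Zcomp>\<^bsub>T\<^esub> b i) \<and> f n = b n"

definition AR_angle ::
  "('o, 'm, 'k, 'z) tri_cat_scheme \<Rightarrow> nat \<Rightarrow> 'o set \<Rightarrow>
   'o \<Rightarrow> (nat \<Rightarrow> 'o) \<Rightarrow> 'o \<Rightarrow> (nat \<Rightarrow> 'm) \<Rightarrow> bool" where
  "AR_angle T n C Y Cs X f \<longleftrightarrow> (\<exists>Xs a b.
     Xs 0 = X \<and> Xs n = Y \<and> glued_angle T n Xs Cs a b f \<and>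
     X \<in> C \<and> Y \<in> C \<and> (\<forall>i<n. Cs i \<in> C) \<and>
     sink_map T C (Cs 0) X (a 0) \<and> source_map T C Y (Cs (n - 1)) (b n) \<and>
     (\<forall>i. 0 < i \<and> i < n \<longrightarrow>
        right_approximation T C (Cs i) (Xs i) (a i) \<and> right_minimal T (Cs i) (Xs i) (a i) \<and>
        left_approximation T C (Xs i) (Cs (i - 1)) (b i) \<and> left_minimal T (Xs i) (Cs (i - 1)) (b i)))"

end

theory Submission
  imports Defs
begin

text \<open>
  On the endomorphism ring of an object there is a linear form whose associated bilinear form has the
  radical as its kernel on both sides.  By Serre duality it is represented by a morphism w from X to
  \<open>(S_n X)[n]\<close> that is annihilated exactly by the radical morphisms into X and, up to the shift, by the
  radical morphisms out of \<open>S_n X\<close>.  Its cocone, approximated by C, yields the sink map of X.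
  Minimal right C-approximations then produce triangles \<open>X_(i+1) \<rightarrow> C_i \<rightarrow> X_i\<close>, and dimension
  shifting gives that \<open>X_n\<close> belongs to C.  Let \<open>\<delta>\<close> be the composite of the connecting morphisms
  from X to \<open>X_n[n]\<close>.  As w kills the sink map, it factors through \<open>\<delta>\<close>; as \<open>\<delta>\<close> is killed by all radical
  morphisms into X, it factors through w.  Both composites of the two factors are the identity up to
  radical morphisms, so \<open>X_n\<close> is isomorphic to \<open>S_n X\<close>, and the annihilator of \<open>\<delta>\<close> shows that \<open>b_n\<close> is
  a source map.  The second half is the first one applied to \<open>S_n\<^sup>-\<^sup>1 Y\<close>.

  Minimality is handled through the radical: in a triangle \<open>K \<rightarrow> X \<rightarrow> Y\<close>, the morphism from X to Y is
  right minimal if the one from K to X is radical, and dually.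
\<close>

section \<open>Morphism calculus and the radical\<close>

text \<open>X need not be indecomposable, so no Auslander-Reiten triangle ending in X is at hand.
  The linear form takes its place: it is assembled from all local summands at once, and so a single
  morphism w detects the radical at X.

  The main obstacle is that the cocone E of w need not lie in C, whereas the construction of
  \<open>\<delta>\<close> controls only morphisms that start in C. To see that
  \<open>\<delta>\<close> kills the radical morphism from E to X, Serre duality enters a second
  time: the object \<open>S_n^-1 X_n\<close> lies in C and tests all morphisms into
  \<open>X_n[n]\<close>.

  One radicality condition carries both kinds of minimality. If \<open>b_(i+1)\<close> is radical,
  \<open>a_i\<close> is right minimal. If \<open>b_i\<close> is radical and a left approximation,
  \<open>a_i\<close> is radical, and this makes \<open>b_(i+1)\<close> left minimal.

  The Serre functor is only an equivalence, and \<open>X_n\<close> is only isomorphic to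
  \<open>S_n X\<close>. Hence the angle is built for every Y isomorphic to \<open>S_n X\<close>;
  this freedom is also what the second half relies on.\<close>

context linear_category
begin

sublocale Hom: module k "Hom T X Y" for X Y
  by (rule Hom_module)

abbreviation comp (infixl "\<cdot>" 70)
  where "f \<cdot> g \<equiv> f \<Zcomp>\<^bsub>T\<^esub> g"

abbreviation "rad \<equiv> jacobson_radical T"

declare Ident_closed [simp, intro] Cmp_closed [intro] Ident_left [simp] Ident_right [simp]

lemma Ident_Ident [simp]: "Ident T X \<cdot> Ident T X = Ident T X"
  by (rule Ident_left) (rule Ident_closed)

lemma zero_Cmp [simp]:
  assumes "f \<in> mor T Y Z"
  shows "zero_mor T X Y \<cdot> f = zero_mor T X Z"
proof -
  have "zero_mor T X Y \<cdot> f = zero_mor T X Y \<cdot> f \<oplus>\<^bsub>Hom T X Z\<^esub> zero_mor T X Y \<cdot> f"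
    using Cmp_add_left[of "zero_mor T X Y" X Y "zero_mor T X Y" f Z] assms by simp
  then show ?thesis
    using assms Hom.add.l_cancel_one' by (metis Cmp_closed Hom.zero_closed)
qed

lemma Cmp_zero [simp]:
  assumes "f \<in> mor T X Y"
  shows "f \<cdot> zero_mor T Y Z = zero_mor T X Z"
proof -
  have "f \<cdot> zero_mor T Y Z = f \<cdot> zero_mor T Y Z \<oplus>\<^bsub>Hom T X Z\<^esub> f \<cdot> zero_mor T Y Z"
    using Cmp_add_right[of f X Y "zero_mor T Y Z" Z "zero_mor T Y Z"] assms by simp
  then show ?thesis
    using assms Hom.add.l_cancel_one' by (metis Cmp_closed Hom.zero_closed)
qed

lemma zero_Cmp_zero [simp]: "zero_mor T X Y \<cdot> zero_mor T Y Z = zero_mor T X Z"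
  by (rule Cmp_zero) simp

lemma neg_Cmp:
  assumes "f \<in> mor T X Y" "g \<in> mor T Y Z"
  shows "(\<ominus>\<^bsub>Hom T X Y\<^esub> f) \<cdot> g = \<ominus>\<^bsub>Hom T X Z\<^esub> (f \<cdot> g)"
proof -
  have "(\<ominus>\<^bsub>Hom T X Y\<^esub> f) \<cdot> g \<oplus>\<^bsub>Hom T X Z\<^esub> f \<cdot> g = zero_mor T X Z"
    using Cmp_add_left[of "\<ominus>\<^bsub>Hom T X Y\<^esub> f" X Y f g Z] assms by (simp add: Hom.l_neg)
  then show ?thesis
    using assms by (metis Cmp_closed Hom.a_inv_closed Hom.minus_equality)
qed

lemma Cmp_neg:
  assumes "f \<in> mor T X Y" "g \<in> mor T Y Z"
  shows "f \<cdot> (\<ominus>\<^bsub>Hom T Y Z\<^esub> g) = \<ominus>\<^bsub>Hom T X Z\<^esub> (f \<cdot> g)"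
proof -
  have "f \<cdot> (\<ominus>\<^bsub>Hom T Y Z\<^esub> g) \<oplus>\<^bsub>Hom T X Z\<^esub> f \<cdot> g = zero_mor T X Z"
    using Cmp_add_right[of f X Y "\<ominus>\<^bsub>Hom T Y Z\<^esub> g" Z g] assms by (simp add: Hom.l_neg)
  then show ?thesis
    using assms by (metis Cmp_closed Hom.a_inv_closed Hom.minus_equality)
qed

lemma minus_Cmp:
  assumes "f \<in> mor T X Y" "f' \<in> mor T X Y" "g \<in> mor T Y Z"
  shows "(f \<ominus>\<^bsub>Hom T X Y\<^esub> f') \<cdot> g = f \<cdot> g \<ominus>\<^bsub>Hom T X Z\<^esub> f' \<cdot> g"
  using assms by (simp add: a_minus_def Cmp_add_left neg_Cmp)

lemma Cmp_minus:
  assumes "f \<in> mor T X Y" "g \<in> mor T Y Z" "g' \<in> mor T Y Z"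
  shows "f \<cdot> (g \<ominus>\<^bsub>Hom T Y Z\<^esub> g') = f \<cdot> g \<ominus>\<^bsub>Hom T X Z\<^esub> f \<cdot> g'"
  using assms by (simp add: a_minus_def Cmp_add_right Cmp_neg)

lemma minus_zero [simp]: "f \<in> mor T X Y \<Longrightarrow> f \<ominus>\<^bsub>Hom T X Y\<^esub> zero_mor T X Y = f"
  by (simp add: a_minus_def)

lemma neg_zero [simp]: "\<ominus>\<^bsub>Hom T X Y\<^esub> zero_mor T X Y = zero_mor T X Y"
  by (rule Hom.minus_equality) auto

lemma minus_self [simp]: "f \<in> mor T X Y \<Longrightarrow> f \<ominus>\<^bsub>Hom T X Y\<^esub> f = zero_mor T X Y"
  by (simp add: a_minus_def Hom.r_neg)

lemma minus_minus_cancel: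
  assumes "f \<in> mor T X Y" "g \<in> mor T X Y"
  shows "f \<ominus>\<^bsub>Hom T X Y\<^esub> (f \<ominus>\<^bsub>Hom T X Y\<^esub> g) = g"
  using assms
  by (simp add: a_minus_def Hom.minus_add Hom.a_assoc[symmetric] Hom.r_neg)

lemma minus_add_cancel:
  assumes "f \<in> mor T X Y" "g \<in> mor T X Y"
  shows "(f \<ominus>\<^bsub>Hom T X Y\<^esub> g) \<oplus>\<^bsub>Hom T X Y\<^esub> g = f"
  using assms by (simp add: a_minus_def Hom.a_assoc Hom.l_neg)

lemma add_minus_cancel:
  assumes "f \<in> mor T X Y" "g \<in> mor T X Y"
  shows "(f \<oplus>\<^bsub>Hom T X Y\<^esub> g) \<ominus>\<^bsub>Hom T X Y\<^esub> g = f"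
  using assms by (simp add: a_minus_def Hom.a_assoc Hom.r_neg)

lemma Cmp_finsum:
  assumes "finite I" "f \<in> mor T X Y" "\<And>r. r \<in> I \<Longrightarrow> g r \<in> mor T Y Z"
  shows "f \<cdot> (\<Oplus>\<^bsub>Hom T Y Z\<^esub>r\<in>I. g r) = (\<Oplus>\<^bsub>Hom T X Z\<^esub>r\<in>I. f \<cdot> g r)"
  using assms(1,3)
proof (induction I rule: finite_induct)
  case (insert s I)
  have "f \<cdot> (\<Oplus>\<^bsub>Hom T Y Z\<^esub>r\<in>insert s I. g r) = f \<cdot> (g s \<oplus>\<^bsub>Hom T Y Z\<^esub> (\<Oplus>\<^bsub>Hom T Y Z\<^esub>r\<in>I. g r))"
    using insert.prems insert.hyps by (subst Hom.finsum_insert) (auto simp: Pi_def)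
  also have "\<dots> = f \<cdot> g s \<oplus>\<^bsub>Hom T X Z\<^esub> f \<cdot> (\<Oplus>\<^bsub>Hom T Y Z\<^esub>r\<in>I. g r)"
    using insert.prems assms(2) by (intro Cmp_add_right) (auto simp: Pi_def)
  also have "\<dots> = (\<Oplus>\<^bsub>Hom T X Z\<^esub>r\<in>insert s I. f \<cdot> g r)"
    using insert assms(2) Cmp_closed by (subst Hom.finsum_insert) (auto simp: Pi_def)
  finally show ?case .
qed (use assms(2) in simp)

lemma finsum_Cmp:
  assumes "finite I" "f \<in> mor T Y Z" "\<And>r. r \<in> I \<Longrightarrow> g r \<in> mor T X Y"
  shows "(\<Oplus>\<^bsub>Hom T X Y\<^esub>r\<in>I. g r) \<cdot> f = (\<Oplus>\<^bsub>Hom T X Z\<^esub>r\<in>I. g r \<cdot> f)"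
  using assms(1,3)
proof (induction I rule: finite_induct)
  case (insert s I)
  have "(\<Oplus>\<^bsub>Hom T X Y\<^esub>r\<in>insert s I. g r) \<cdot> f = (g s \<oplus>\<^bsub>Hom T X Y\<^esub> (\<Oplus>\<^bsub>Hom T X Y\<^esub>r\<in>I. g r)) \<cdot> f"
    using insert.prems insert.hyps by (subst Hom.finsum_insert) (auto simp: Pi_def)
  also have "\<dots> = g s \<cdot> f \<oplus>\<^bsub>Hom T X Z\<^esub> (\<Oplus>\<^bsub>Hom T X Y\<^esub>r\<in>I. g r) \<cdot> f"
    using insert.prems assms(2) by (intro Cmp_add_left) (auto simp: Pi_def)
  also have "\<dots> = (\<Oplus>\<^bsub>Hom T X Z\<^esub>r\<in>insert s I. g r \<cdot> f)"
    using insert assms(2) Cmp_closed by (subst Hom.finsum_insert) (auto simp: Pi_def)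
  finally show ?case .
qed (use assms(2) in simp)

section \<open>Isomorphisms\<close>

lemma is_isoI:
  assumes "f \<in> mor T X Y" "g \<in> mor T Y X" "f \<cdot> g = Ident T X" "g \<cdot> f = Ident T Y"
  shows "is_iso T X Y f"
  using assms unfolding is_iso_def by blast

lemma is_isoE:
  assumes "is_iso T X Y f"
  obtains g where "f \<in> mor T X Y" "g \<in> mor T Y X" "f \<cdot> g = Ident T X" "g \<cdot> f = Ident T Y"
    "is_iso T Y X g"
  using assms unfolding is_iso_def by blast

lemma is_iso_Ident [simp]: "is_iso T X X (Ident T X)"
  by (rule is_isoI[of _ _ _ "Ident T X"]) auto

lemma is_iso_Cmp:
  assumes "is_iso T X Y f" "is_iso T Y Z g"
  shows "is_iso T X Z (f \<cdot> g)"
proof -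
  obtain f' where f: "f \<in> mor T X Y" "f' \<in> mor T Y X" "f \<cdot> f' = Ident T X" "f' \<cdot> f = Ident T Y"
    using assms(1) by (rule is_isoE)
  obtain g' where g: "g \<in> mor T Y Z" "g' \<in> mor T Z Y" "g \<cdot> g' = Ident T Y" "g' \<cdot> g = Ident T Z"
    using assms(2) by (rule is_isoE)
  have "f \<cdot> g \<cdot> (g' \<cdot> f') = f \<cdot> (g \<cdot> g') \<cdot> f'" "g' \<cdot> f' \<cdot> (f \<cdot> g) = g' \<cdot> (f' \<cdot> f) \<cdot> g"
    using f(1,2) g(1,2) Cmp_closed[OF f(1) g(1)] Cmp_closed[OF g(2) f(2)]
      Cmp_closed[OF f(2) f(1)] Cmp_closed[OF g(1) g(2)]
    by (simp_all only: Cmp_assoc[OF f(1) g(1)] Cmp_assoc[OF g(2) f(2)] Cmp_assoc[OF g(1) g(2), symmetric]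
      Cmp_assoc[OF f(2) f(1), symmetric] Cmp_assoc[OF f(1) _ f(2)] Cmp_assoc[OF g(2) _ g(1)] )
  with f g show ?thesis
    by (intro is_isoI[of _ _ _ "g' \<cdot> f'"]) auto
qed

text \<open>If c is inverse to 1 - ab, then 1 + bca is inverse to 1 - ba.\<close>

lemma is_iso_minus_swap:
  assumes a: "a \<in> mor T X Y" and b: "b \<in> mor T Y X"
    and iso: "is_iso T X X (Ident T X \<ominus>\<^bsub>Hom T X X\<^esub> a \<cdot> b)"
  shows "is_iso T Y Y (Ident T Y \<ominus>\<^bsub>Hom T Y Y\<^esub> b \<cdot> a)"
proof -
  obtain c where c: "c \<in> mor T X X"
    and c1: "(Ident T X \<ominus>\<^bsub>Hom T X X\<^esub> a \<cdot> b) \<cdot> c = Ident T X"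
    and c2: "c \<cdot> (Ident T X \<ominus>\<^bsub>Hom T X X\<^esub> a \<cdot> b) = Ident T X"
    using iso by (rule is_isoE)
  have ab: "a \<cdot> b \<in> mor T X X" and ba: "b \<cdot> a \<in> mor T Y Y"
    and bc: "b \<cdot> c \<in> mor T Y X" and ca: "c \<cdot> a \<in> mor T X Y"
    using a b c by auto
  have z: "b \<cdot> c \<cdot> a \<in> mor T Y Y"
    using a bc by auto
  let ?d = "Ident T Y \<oplus>\<^bsub>Hom T Y Y\<^esub> b \<cdot> c \<cdot> a"
  have e1: "a \<cdot> b \<cdot> c = c \<ominus>\<^bsub>Hom T X X\<^esub> Ident T X"
    using c1 ab c Cmp_closed[OF ab c] minus_minus_cancel[of c X X "a \<cdot> b \<cdot> c"] by (auto simp: minus_Cmp)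
  have e2: "c \<cdot> (a \<cdot> b) = c \<ominus>\<^bsub>Hom T X X\<^esub> Ident T X"
    using c2 ab c Cmp_closed[OF c ab] minus_minus_cancel[of c X X "c \<cdot> (a \<cdot> b)"] by (auto simp: Cmp_minus)
  have cI: "c \<ominus>\<^bsub>Hom T X X\<^esub> Ident T X \<in> mor T X X"
    using c by auto
  have f1: "b \<cdot> a \<cdot> (b \<cdot> c \<cdot> a) = b \<cdot> c \<cdot> a \<ominus>\<^bsub>Hom T Y Y\<^esub> b \<cdot> a"
  proof -
    have "b \<cdot> a \<cdot> (b \<cdot> c \<cdot> a) = b \<cdot> (a \<cdot> b \<cdot> c) \<cdot> a"
      using a b c ab ba bc ca z Cmp_closed[OF ab c] Cmp_closed[OF c ab] by (simp add: Cmp_assoc)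
    also have "\<dots> = b \<cdot> c \<cdot> a \<ominus>\<^bsub>Hom T Y Y\<^esub> b \<cdot> a"
      using a b c bc by (simp add: e1 Cmp_minus[OF b] minus_Cmp[of "b \<cdot> c" Y X b a])
    finally show ?thesis .
  qed
  have f2: "b \<cdot> c \<cdot> a \<cdot> (b \<cdot> a) = b \<cdot> c \<cdot> a \<ominus>\<^bsub>Hom T Y Y\<^esub> b \<cdot> a"
  proof -
    have "b \<cdot> c \<cdot> a \<cdot> (b \<cdot> a) = b \<cdot> (c \<cdot> (a \<cdot> b)) \<cdot> a"
      using a b c ab ba bc ca z Cmp_closed[OF ab c] Cmp_closed[OF c ab] by (simp add: Cmp_assoc)
    also have "\<dots> = b \<cdot> c \<cdot> a \<ominus>\<^bsub>Hom T Y Y\<^esub> b \<cdot> a"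
      using a b c bc by (simp add: e2 Cmp_minus[OF b] minus_Cmp[of "b \<cdot> c" Y X b a])
    finally show ?thesis .
  qed
  have g1: "(Ident T Y \<ominus>\<^bsub>Hom T Y Y\<^esub> b \<cdot> a) \<cdot> ?d =
      ?d \<ominus>\<^bsub>Hom T Y Y\<^esub> (b \<cdot> a \<oplus>\<^bsub>Hom T Y Y\<^esub> (b \<cdot> c \<cdot> a \<ominus>\<^bsub>Hom T Y Y\<^esub> b \<cdot> a))"
    using ba z by (subst minus_Cmp[of _ Y Y]) (auto simp: Cmp_add_right[of _ Y Y] f1)
  have g2: "?d \<cdot> (Ident T Y \<ominus>\<^bsub>Hom T Y Y\<^esub> b \<cdot> a) =
      ?d \<ominus>\<^bsub>Hom T Y Y\<^esub> (b \<cdot> a \<oplus>\<^bsub>Hom T Y Y\<^esub> (b \<cdot> c \<cdot> a \<ominus>\<^bsub>Hom T Y Y\<^esub> b \<cdot> a))"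
    using ba z Ident_right[OF Hom.a_closed[OF Ident_closed z]]
    by (subst Cmp_minus[of _ Y Y]) (auto simp: Cmp_add_left[of _ Y Y] f2)
  have h: "b \<cdot> a \<oplus>\<^bsub>Hom T Y Y\<^esub> (b \<cdot> c \<cdot> a \<ominus>\<^bsub>Hom T Y Y\<^esub> b \<cdot> a) = b \<cdot> c \<cdot> a"
    using ba z by (subst Hom.a_comm) (auto simp: minus_add_cancel)
  show ?thesis
    using ba z g1 g2 h by (intro is_isoI[of _ _ _ ?d]) (auto simp: add_minus_cancel)
qed

section \<open>The Jacobson radical as a two-sided ideal\<close>

lemma rad_mor: "f \<in> rad X Y \<Longrightarrow> f \<in> mor T X Y"
  by (simp add: jacobson_radical_def)

lemma rad_iso:
  "f \<in> rad X Y \<Longrightarrow> g \<in> mor T Y X \<Longrightarrow> is_iso T X X (Ident T X \<ominus>\<^bsub>Hom T X X\<^esub> f \<cdot> g)"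
  by (simp add: jacobson_radical_def)

text \<open>Since 1 - fg and 1 - gf are invertible together, radicality may be tested at the target
  as well as at the source; this yields the ideal property on both sides.\<close>

lemma rad_iff:
  "f \<in> rad X Y \<longleftrightarrow> f \<in> mor T X Y \<and>
     (\<forall>g \<in> mor T Y X. is_iso T Y Y (Ident T Y \<ominus>\<^bsub>Hom T Y Y\<^esub> g \<cdot> f))"
  unfolding jacobson_radical_def using is_iso_minus_swap by blast

lemma rad_iso_swap:
  "f \<in> rad X Y \<Longrightarrow> g \<in> mor T Y X \<Longrightarrow> is_iso T Y Y (Ident T Y \<ominus>\<^bsub>Hom T Y Y\<^esub> g \<cdot> f)"
  by (simp add: rad_iff)

lemma rad_Cmp:
  assumes "f \<in> rad X Y" "g \<in> mor T Y Z"
  shows "f \<cdot> g \<in> rad X Z"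
  unfolding jacobson_radical_def
proof (intro CollectI conjI ballI)
  fix h assume h: "h \<in> mor T Z X"
  have f: "f \<in> mor T X Y"
    using assms(1) by (rule rad_mor)
  show "is_iso T X X (Ident T X \<ominus>\<^bsub>Hom T X X\<^esub> f \<cdot> g \<cdot> h)"
    using rad_iso[OF assms(1), of "g \<cdot> h"] Cmp_assoc[OF f assms(2) h] assms(2) h by auto
qed (use assms rad_mor in blast)

lemma Cmp_rad:
  assumes "f \<in> mor T X Y" "g \<in> rad Y Z"
  shows "f \<cdot> g \<in> rad X Z"
  unfolding rad_iff
proof (intro conjI ballI)
  fix h assume h: "h \<in> mor T Z X"
  have g: "g \<in> mor T Y Z"
    using assms(2) by (rule rad_mor)
  show "is_iso T Z Z (Ident T Z \<ominus>\<^bsub>Hom T Z Z\<^esub> h \<cdot> (f \<cdot> g))"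
    using rad_iso_swap[OF assms(2), of "h \<cdot> f"] Cmp_assoc[OF h assms(1) g] assms(1) h by auto
qed (use assms rad_mor in blast)

lemma zero_in_rad [simp]: "zero_mor T X Y \<in> rad X Y"
  unfolding jacobson_radical_def by auto

text \<open>With c inverse to 1 - fg, the morphism 1 - (f + f')g factors as (1 - fg)(1 - c f' g),
  and c f' is again radical.\<close>

lemma rad_add:
  assumes f: "f \<in> rad X Y" and f': "f' \<in> rad X Y"
  shows "f \<oplus>\<^bsub>Hom T X Y\<^esub> f' \<in> rad X Y"
  unfolding jacobson_radical_def
proof (intro CollectI conjI ballI)
  note fm = rad_mor[OF f] rad_mor[OF f']
  fix g assume g: "g \<in> mor T Y X"
  obtain c where c: "Ident T X \<ominus>\<^bsub>Hom T X X\<^esub> f \<cdot> g \<in> mor T X X" "c \<in> mor T X X"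
    "(Ident T X \<ominus>\<^bsub>Hom T X X\<^esub> f \<cdot> g) \<cdot> c = Ident T X"
    using rad_iso[OF f g] by (rule is_isoE)
  have fg: "f \<cdot> g \<in> mor T X X" "f' \<cdot> g \<in> mor T X X" "c \<cdot> f' \<in> mor T X Y"
    using fm g c(2) by auto
  then have cfg: "c \<cdot> f' \<cdot> g \<in> mor T X X"
    using g by auto
  have "is_iso T X X ((Ident T X \<ominus>\<^bsub>Hom T X X\<^esub> f \<cdot> g) \<cdot> (Ident T X \<ominus>\<^bsub>Hom T X X\<^esub> c \<cdot> f' \<cdot> g))"
    using rad_iso[OF f g] rad_iso[OF Cmp_rad[OF c(2) f'] g] by (rule is_iso_Cmp)
  moreover have "(Ident T X \<ominus>\<^bsub>Hom T X X\<^esub> f \<cdot> g) \<cdot> (c \<cdot> f' \<cdot> g) = f' \<cdot> g"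
    using c fm g fg Cmp_assoc[OF c(1,2), of f' Y] Cmp_assoc[OF c(1) fg(3) g] by simp
  then have "(Ident T X \<ominus>\<^bsub>Hom T X X\<^esub> f \<cdot> g) \<cdot> (Ident T X \<ominus>\<^bsub>Hom T X X\<^esub> c \<cdot> f' \<cdot> g) =
      (Ident T X \<ominus>\<^bsub>Hom T X X\<^esub> f \<cdot> g) \<ominus>\<^bsub>Hom T X X\<^esub> f' \<cdot> g"
    using c(1) cfg by (simp add: Cmp_minus[of _ X X])
  also have "\<dots> = Ident T X \<ominus>\<^bsub>Hom T X X\<^esub> (f \<oplus>\<^bsub>Hom T X Y\<^esub> f') \<cdot> g"
    using fm g fg by (simp add: Cmp_add_left[of _ X Y] a_minus_def Hom.minus_add Hom.a_assoc)
  ultimately show "is_iso T X X (Ident T X \<ominus>\<^bsub>Hom T X X\<^esub> (f \<oplus>\<^bsub>Hom T X Y\<^esub> f') \<cdot> g)"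
    by simp
qed (use assms rad_mor in blast)

lemma rad_finsum:
  assumes "finite I" "\<And>r. r \<in> I \<Longrightarrow> f r \<in> rad X Y"
  shows "(\<Oplus>\<^bsub>Hom T X Y\<^esub>r\<in>I. f r) \<in> rad X Y"
  using assms
proof (induction I rule: finite_induct)
  case (insert s I)
  then show ?case
    by (subst Hom.finsum_insert) (auto simp: Pi_def rad_mor intro: rad_add)
qed simp

lemma iso_if_minus_rad:
  assumes "f \<in> mor T X X" "Ident T X \<ominus>\<^bsub>Hom T X X\<^esub> f \<in> rad X X"
  shows "is_iso T X X f"
  using rad_iso[OF assms(2) Ident_closed] assms(1)
    Ident_right[OF Hom.minus_closed[OF Ident_closed assms(1)]] by (simp add: minus_minus_cancel)

end

section \<open>Linear forms and decompositions into local objects\<close>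

text \<open>Elements of \<open>dual_module\<close> are extensional functions. Here values outside
  the carrier stay free, so that a form can be given by a formula and restricted only when Serre
  duality is applied.\<close>

definition linear_form ::
  "('k, 'r) ring_scheme \<Rightarrow> ('k, 'm, 'x) module_scheme \<Rightarrow> ('m \<Rightarrow> 'k) \<Rightarrow> bool" where
  "linear_form R M \<psi> \<longleftrightarrow> \<psi> \<in> carrier M \<rightarrow> carrier R \<and>
     (\<forall>x \<in> carrier M. \<forall>y \<in> carrier M. \<psi> (x \<oplus>\<^bsub>M\<^esub> y) = \<psi> x \<oplus>\<^bsub>R\<^esub> \<psi> y) \<and>
     (\<forall>c \<in> carrier R. \<forall>x \<in> carrier M. \<psi> (c \<odot>\<^bsub>M\<^esub> x) = c \<otimes>\<^bsub>R\<^esub> \<psi> x)"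

lemma linear_form_dual:
  assumes "linear_form R M \<psi>" "module R M"
  shows "restrict \<psi> (carrier M) \<in> carrier (dual_module R M)"
proof -
  interpret module R M by fact
  show ?thesis
    using assms(1) unfolding linear_form_def dual_module_def
    by (auto simp: restrict_def Pi_def)
qed

section \<open>Separating a vector from a submodule by a linear form\<close>

lemma (in module) submodule_insert:
  assumes N: "submodule N R M" and x: "x \<in> carrier M"
  shows "submodule {h \<oplus>\<^bsub>M\<^esub> c \<odot>\<^bsub>M\<^esub> x |h c. h \<in> N \<and> c \<in> carrier R} R M"
proof (rule submoduleI)
  note E = submoduleE[OF N]
  show "{h \<oplus>\<^bsub>M\<^esub> c \<odot>\<^bsub>M\<^esub> x |h c. h \<in> N \<and> c \<in> carrier R} \<subseteq> carrier M"
    using E(1) x by auto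
  obtain h0 where "h0 \<in> N" using E(2) by auto
  then have z: "\<zero>\<^bsub>M\<^esub> \<in> N"
    using E(1,3,5) by (metis M.r_neg subsetD)
  then show "\<zero>\<^bsub>M\<^esub> \<in> {h \<oplus>\<^bsub>M\<^esub> c \<odot>\<^bsub>M\<^esub> x |h c. h \<in> N \<and> c \<in> carrier R}"
    using x by (intro CollectI exI[of _ "\<zero>\<^bsub>M\<^esub>"] exI[of _ \<zero>]) auto
next
  note E = submoduleE[OF N]
  fix a assume "a \<in> {h \<oplus>\<^bsub>M\<^esub> c \<odot>\<^bsub>M\<^esub> x |h c. h \<in> N \<and> c \<in> carrier R}"
  then obtain h c where a: "a = h \<oplus>\<^bsub>M\<^esub> c \<odot>\<^bsub>M\<^esub> x" "h \<in> N" "c \<in> carrier R" by auto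
  have "h \<in> carrier M" using a(2) E(1) by auto
  then have "\<ominus>\<^bsub>M\<^esub> a = \<ominus>\<^bsub>M\<^esub> h \<oplus>\<^bsub>M\<^esub> (\<ominus> c) \<odot>\<^bsub>M\<^esub> x"
    using a x by (simp add: M.minus_add smult_l_minus)
  then show "\<ominus>\<^bsub>M\<^esub> a \<in> {h \<oplus>\<^bsub>M\<^esub> c \<odot>\<^bsub>M\<^esub> x |h c. h \<in> N \<and> c \<in> carrier R}"
    using E(3)[OF a(2)] a(3) by auto
next
  note E = submoduleE[OF N]
  fix a b assume "a \<in> {h \<oplus>\<^bsub>M\<^esub> c \<odot>\<^bsub>M\<^esub> x |h c. h \<in> N \<and> c \<in> carrier R}"
    "b \<in> {h \<oplus>\<^bsub>M\<^esub> c \<odot>\<^bsub>M\<^esub> x |h c. h \<in> N \<and> c \<in> carrier R}"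
  then obtain h c h' c' where a: "a = h \<oplus>\<^bsub>M\<^esub> c \<odot>\<^bsub>M\<^esub> x" "h \<in> N" "c \<in> carrier R"
    and b: "b = h' \<oplus>\<^bsub>M\<^esub> c' \<odot>\<^bsub>M\<^esub> x" "h' \<in> N" "c' \<in> carrier R" by auto
  have "h \<in> carrier M" "h' \<in> carrier M" using a(2) b(2) E(1) by auto
  then have "a \<oplus>\<^bsub>M\<^esub> b = (h \<oplus>\<^bsub>M\<^esub> h') \<oplus>\<^bsub>M\<^esub> (c \<oplus> c') \<odot>\<^bsub>M\<^esub> x"
    using a b x by (simp add: smult_l_distr M.a_ac)
  then show "a \<oplus>\<^bsub>M\<^esub> b \<in> {h \<oplus>\<^bsub>M\<^esub> c \<odot>\<^bsub>M\<^esub> x |h c. h \<in> N \<and> c \<in> carrier R}"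
    using E(5)[OF a(2) b(2)] a(3) b(3) by auto
next
  note E = submoduleE[OF N]
  fix d a assume "a \<in> {h \<oplus>\<^bsub>M\<^esub> c \<odot>\<^bsub>M\<^esub> x |h c. h \<in> N \<and> c \<in> carrier R}" and d: "d \<in> carrier R"
  then obtain h c where a: "a = h \<oplus>\<^bsub>M\<^esub> c \<odot>\<^bsub>M\<^esub> x" "h \<in> N" "c \<in> carrier R" by auto
  have "h \<in> carrier M" using a(2) E(1) by auto
  then have "d \<odot>\<^bsub>M\<^esub> a = d \<odot>\<^bsub>M\<^esub> h \<oplus>\<^bsub>M\<^esub> (d \<otimes> c) \<odot>\<^bsub>M\<^esub> x"
    using a x d by (simp add: smult_r_distr smult_assoc1)
  then show "d \<odot>\<^bsub>M\<^esub> a \<in> {h \<oplus>\<^bsub>M\<^esub> c \<odot>\<^bsub>M\<^esub> x |h c. h \<in> N \<and> c \<in> carrier R}"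
    using E(4)[OF d a(2)] a(3) d by auto
qed

lemma (in module) maximal_submodule_avoiding:
  assumes N: "submodule N R M" and v: "v \<notin> N"
  obtains H where "submodule H R M" "N \<subseteq> H" "v \<notin> H"
    "\<And>H'. submodule H' R M \<Longrightarrow> H \<subseteq> H' \<Longrightarrow> v \<notin> H' \<Longrightarrow> H' = H"
proof -
  let ?A = "{H. submodule H R M \<and> N \<subseteq> H \<and> v \<notin> H}"
  have "\<exists>H\<in>?A. \<forall>X\<in>?A. H \<subseteq> X \<longrightarrow> X = H"
  proof (rule subset_Zorn_nonempty)
    show "?A \<noteq> {}" using assms by auto
    fix F assume F: "F \<noteq> {}" "subset.chain ?A F"
    have sub: "submodule H R M" "N \<subseteq> H" "v \<notin> H" if "H \<in> F" for H
      using F(2) that unfolding subset.chain_def by auto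
    have "submodule (\<Union>F) R M"
    proof (rule submoduleI)
      show "\<Union>F \<subseteq> carrier M" using submoduleE(1)[OF sub(1)] by auto
      obtain H h where "H \<in> F" "h \<in> H" using F(1) submoduleE(2)[OF sub(1)] by blast
      then show "\<zero>\<^bsub>M\<^esub> \<in> \<Union>F"
        using submoduleE(1,3,5)[OF sub(1)] by (metis M.r_neg UnionI subsetD)
    next
      fix a b assume "a \<in> \<Union>F" "b \<in> \<Union>F"
      then obtain H1 H2 where H: "H1 \<in> F" "H2 \<in> F" "a \<in> H1" "b \<in> H2" by auto
      then have "H1 \<subseteq> H2 \<or> H2 \<subseteq> H1"
        using F(2) unfolding subset.chain_def by blast
      then obtain H where "H \<in> F" "a \<in> H" "b \<in> H" using H by blast
      then show "a \<oplus>\<^bsub>M\<^esub> b \<in> \<Union>F" using submoduleE(5)[OF sub(1)] by blast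
    qed (use submoduleE(3,4)[OF sub(1)] in blast)+
    then show "\<Union>F \<in> ?A" using sub F(1) by blast
  qed
  then obtain H where "submodule H R M" "N \<subseteq> H" "v \<notin> H"
    "\<forall>X\<in>?A. H \<subseteq> X \<longrightarrow> X = H" by blast
  then show thesis by (intro that) auto
qed

text \<open>A submodule H that contains N and is maximal among those avoiding v is a complement of
  the line kv: for x outside H, maximality puts v into H + kx, and solving for x puts x into H + kv.
  The form is the coordinate along v.\<close>

lemma (in module) separating_linear_form:
  assumes "field R" and N: "submodule N R M" and v: "v \<in> carrier M" "v \<notin> N"
  obtains \<psi> where "linear_form R M \<psi>" "\<psi> v = \<one>" "\<And>x. x \<in> N \<Longrightarrow> \<psi> x = \<zero>"
proof -
  interpret field R by fact
  have neg0: "\<ominus>\<^bsub>M\<^esub> \<zero>\<^bsub>M\<^esub> = \<zero>\<^bsub>M\<^esub>"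
    by (rule M.minus_equality) auto
  obtain H where H: "submodule H R M" "N \<subseteq> H" "v \<notin> H"
    and max: "\<And>H'. submodule H' R M \<Longrightarrow> H \<subseteq> H' \<Longrightarrow> v \<notin> H' \<Longrightarrow> H' = H"
    using maximal_submodule_avoiding[OF N v(2)] by blast
  note E = submoduleE[OF H(1)]
  have unit: "\<exists>d \<in> carrier R. d \<otimes> c = \<one>" if "c \<in> carrier R" "c \<noteq> \<zero>" for c
    using that field_Units Units_l_inv_ex by blast
  \<comment> \<open>H meets the line kv only in zero, which makes the coordinate unique.\<close>
  have nov: "c = \<zero>" if c: "c \<in> carrier R" "c \<odot>\<^bsub>M\<^esub> v \<in> H" for c
  proof (rule ccontr)
    assume "c \<noteq> \<zero>"
    then obtain d where d: "d \<in> carrier R" "d \<otimes> c = \<one>" using unit[OF c(1)] by blast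
    then have "d \<odot>\<^bsub>M\<^esub> (c \<odot>\<^bsub>M\<^esub> v) = v"
      using that(1) v(1) by (simp add: smult_assoc1[symmetric])
    then show False using E(4)[OF d(1) that(2)] H(3) by simp
  qed
  have z: "\<zero>\<^bsub>M\<^esub> \<in> H"
  proof -
    obtain h0 where "h0 \<in> H" using E(2) by auto
    then show ?thesis using E(1,3,5) by (metis M.r_neg subsetD)
  qed
  have ex: "\<exists>c \<in> carrier R. x \<ominus>\<^bsub>M\<^esub> c \<odot>\<^bsub>M\<^esub> v \<in> H" if x: "x \<in> carrier M" for x
  proof (cases "x \<in> H")
    case True
    then show ?thesis using x v by (intro bexI[of _ \<zero>]) (auto simp: a_minus_def neg0)
  next
    case False
    let ?H = "{h \<oplus>\<^bsub>M\<^esub> c \<odot>\<^bsub>M\<^esub> x |h c. h \<in> H \<and> c \<in> carrier R}"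
    have "H \<subseteq> ?H"
    proof
      fix h assume "h \<in> H"
      then show "h \<in> ?H" using x E(1)
        by (intro CollectI exI[of _ h] exI[of _ \<zero>]) auto
    qed
    moreover have "x \<in> ?H"
      using x z by (intro CollectI exI[of _ "\<zero>\<^bsub>M\<^esub>"] exI[of _ \<one>]) auto
    ultimately have "v \<in> ?H"
      using max[OF submodule_insert[OF H(1) x]] False by blast
    then obtain h c where hc: "v = h \<oplus>\<^bsub>M\<^esub> c \<odot>\<^bsub>M\<^esub> x" "h \<in> H" "c \<in> carrier R" by auto
    have h: "h \<in> carrier M" using hc(2) E(1) by auto
    have "c \<noteq> \<zero>" using hc H(3) h x by auto
    then obtain d where d: "d \<in> carrier R" "d \<otimes> c = \<one>" using unit[OF hc(3)] by blast
    have "d \<odot>\<^bsub>M\<^esub> v = d \<odot>\<^bsub>M\<^esub> h \<oplus>\<^bsub>M\<^esub> x"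
      using hc d h x by (simp add: smult_r_distr smult_assoc1[symmetric])
    then have "x \<ominus>\<^bsub>M\<^esub> d \<odot>\<^bsub>M\<^esub> v = \<ominus>\<^bsub>M\<^esub> (d \<odot>\<^bsub>M\<^esub> h)"
      using h x d by (simp add: a_minus_def M.minus_add M.a_ac M.r_neg)
        (simp add: M.a_assoc[symmetric] M.r_neg)
    then show ?thesis using E(3)[OF E(4)[OF d(1) hc(2)]] d(1) by (intro bexI[of _ d]) simp_all
  qed
  have uniq: "c = d" if "c \<in> carrier R" "d \<in> carrier R" "x \<in> carrier M"
    "x \<ominus>\<^bsub>M\<^esub> c \<odot>\<^bsub>M\<^esub> v \<in> H" "x \<ominus>\<^bsub>M\<^esub> d \<odot>\<^bsub>M\<^esub> v \<in> H" for c d x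
  proof -
    have "(d \<ominus> c) \<odot>\<^bsub>M\<^esub> v = (x \<ominus>\<^bsub>M\<^esub> c \<odot>\<^bsub>M\<^esub> v) \<oplus>\<^bsub>M\<^esub> \<ominus>\<^bsub>M\<^esub> (x \<ominus>\<^bsub>M\<^esub> d \<odot>\<^bsub>M\<^esub> v)"
    proof -
      have "(x \<oplus>\<^bsub>M\<^esub> p) \<oplus>\<^bsub>M\<^esub> (\<ominus>\<^bsub>M\<^esub> x \<oplus>\<^bsub>M\<^esub> q) = q \<oplus>\<^bsub>M\<^esub> p" if "p \<in> carrier M" "q \<in> carrier M" for p q
      proof -
        have "(x \<oplus>\<^bsub>M\<^esub> p) \<oplus>\<^bsub>M\<^esub> (\<ominus>\<^bsub>M\<^esub> x \<oplus>\<^bsub>M\<^esub> q) = (x \<oplus>\<^bsub>M\<^esub> \<ominus>\<^bsub>M\<^esub> x) \<oplus>\<^bsub>M\<^esub> (q \<oplus>\<^bsub>M\<^esub> p)"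
          using that \<open>x \<in> carrier M\<close> by (simp add: M.a_ac)
        then show ?thesis using that \<open>x \<in> carrier M\<close> by (simp add: M.r_neg)
      qed
      from this[of "\<ominus>\<^bsub>M\<^esub> (c \<odot>\<^bsub>M\<^esub> v)" "d \<odot>\<^bsub>M\<^esub> v"] show ?thesis
        using that v(1) by (simp add: a_minus_def M.minus_add smult_l_distr smult_l_minus)
    qed
    then have "d \<ominus> c = \<zero>"
      using nov[of "d \<ominus> c"] E(5)[OF that(4) E(3)[OF that(5)]] that(1,2) by simp
    then have "\<zero> \<oplus> c = (d \<ominus> c) \<oplus> c" by simp
    then show ?thesis using that(1,2) by (simp add: a_minus_def R.a_assoc R.l_neg)
  qed
  define \<psi> where "\<psi> x = (THE c. c \<in> carrier R \<and> x \<ominus>\<^bsub>M\<^esub> c \<odot>\<^bsub>M\<^esub> v \<in> H)" for x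
  have eq: "\<psi> x = c" if "x \<in> carrier M" "c \<in> carrier R" "x \<ominus>\<^bsub>M\<^esub> c \<odot>\<^bsub>M\<^esub> v \<in> H" for x c
    unfolding \<psi>_def using that uniq by (intro the_equality) auto
  have \<psi>: "\<psi> x \<in> carrier R" "x \<ominus>\<^bsub>M\<^esub> \<psi> x \<odot>\<^bsub>M\<^esub> v \<in> H" if "x \<in> carrier M" for x
    using ex[OF that] eq[OF that] by auto
  have "linear_form R M \<psi>"
    unfolding linear_form_def
  proof (intro conjI ballI)
    fix x y assume x: "x \<in> carrier M" and y: "y \<in> carrier M"
    have "x \<oplus>\<^bsub>M\<^esub> y \<ominus>\<^bsub>M\<^esub> (\<psi> x \<oplus> \<psi> y) \<odot>\<^bsub>M\<^esub> v = (x \<ominus>\<^bsub>M\<^esub> \<psi> x \<odot>\<^bsub>M\<^esub> v) \<oplus>\<^bsub>M\<^esub> (y \<ominus>\<^bsub>M\<^esub> \<psi> y \<odot>\<^bsub>M\<^esub> v)"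
      using x y \<psi>(1) v(1) by (simp add: a_minus_def M.minus_add smult_l_distr M.a_ac)
    then show "\<psi> (x \<oplus>\<^bsub>M\<^esub> y) = \<psi> x \<oplus> \<psi> y"
      using x y \<psi> E(5) by (intro eq) auto
  next
    fix c x assume c: "c \<in> carrier R" and x: "x \<in> carrier M"
    have "c \<odot>\<^bsub>M\<^esub> x \<ominus>\<^bsub>M\<^esub> (c \<otimes> \<psi> x) \<odot>\<^bsub>M\<^esub> v = c \<odot>\<^bsub>M\<^esub> (x \<ominus>\<^bsub>M\<^esub> \<psi> x \<odot>\<^bsub>M\<^esub> v)"
      using x c \<psi>(1) v(1) by (simp add: a_minus_def smult_r_distr smult_r_minus smult_assoc1)
    then show "\<psi> (c \<odot>\<^bsub>M\<^esub> x) = c \<otimes> \<psi> x"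
      using x c \<psi> E(4) by (intro eq) auto
  qed (use \<psi> in auto)
  moreover have "\<psi> v = \<one>"
    using v(1) z by (intro eq) (auto simp: a_minus_def M.r_neg)
  moreover have "\<psi> x = \<zero>" if "x \<in> N" for x
    using that H(2) subsetD[OF E(1), of x] v(1) by (intro eq) (auto simp: a_minus_def neg0)
  ultimately show thesis by (rule that)
qed

section \<open>Objects with local endomorphism ring and sums of them\<close>

context linear_category
begin

lemma zero_obj_mor:
  "is_zero_obj T Z \<Longrightarrow> f \<in> mor T X Z \<Longrightarrow> f = zero_mor T X Z"
  "is_zero_obj T Z \<Longrightarrow> f \<in> mor T Z X \<Longrightarrow> f = zero_mor T Z X"
  unfolding is_zero_obj_def by blast+

lemma zero_obj_if_Ident_zero:
  assumes "Ident T X = zero_mor T X X"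
  shows "is_zero_obj T X"
  unfolding is_zero_obj_def
proof (intro allI conjI equalityI subsetI)
  fix W f assume "f \<in> mor T W X"
  then show "f \<in> {zero_mor T W X}"
    using Ident_right[of f W X] by (simp add: assms)
next
  fix W f assume "f \<in> mor T X W"
  then show "f \<in> {zero_mor T X W}"
    using Ident_left[of f X W] by (simp add: assms)
qed auto

lemma End_ring_simps [simp]:
  "carrier (End_ring T X) = mor T X X" "mult (End_ring T X) = (\<lambda>f g. f \<cdot> g)"
  "one (End_ring T X) = Ident T X" "zero (End_ring T X) = zero_mor T X X"
  "add (End_ring T X) = add (Hom T X X)"
  by (simp_all add: End_ring_def)

lemma Units_End_ring: "f \<in> Units (End_ring T X) \<longleftrightarrow> is_iso T X X f"
  unfolding Units_def is_iso_def by auto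

lemma local_iso_or_iso:
  assumes "local_ring (End_ring T X)" "f \<in> mor T X X"
  shows "is_iso T X X f \<or> is_iso T X X (Ident T X \<ominus>\<^bsub>Hom T X X\<^esub> f)"
  using assms minus_add_cancel[of "Ident T X" X X f] is_iso_Ident[of X]
  unfolding local_ring_def by (metis (no_types, lifting) DiffI End_ring_simps(1) End_ring_simps(5)
      Hom.minus_closed Ident_closed Units_End_ring)

text \<open>Some 1 - fg is not invertible; locality then makes fg invertible, and correcting g by
  the inverse of fg gives a retraction.\<close>

lemma local_split_mono:
  assumes "local_ring (End_ring T X)" "f \<in> mor T X Y" "f \<notin> rad X Y"
  obtains g where "g \<in> mor T Y X" "f \<cdot> g = Ident T X"
proof -
  obtain g where g: "g \<in> mor T Y X" "\<not> is_iso T X X (Ident T X \<ominus>\<^bsub>Hom T X X\<^esub> f \<cdot> g)"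
    using assms(2,3) unfolding jacobson_radical_def by auto
  then have "is_iso T X X (f \<cdot> g)"
    using local_iso_or_iso[OF assms(1) Cmp_closed[OF assms(2) g(1)]] by blast
  then obtain c where c: "c \<in> mor T X X" "f \<cdot> g \<cdot> c = Ident T X"
    by (rule is_isoE)
  then show thesis
    using that[of "g \<cdot> c"] g(1) assms(2) Cmp_assoc[OF assms(2) g(1) c(1)] by auto
qed

lemma local_split_epi:
  assumes "local_ring (End_ring T Y)" "f \<in> mor T X Y" "f \<notin> rad X Y"
  obtains g where "g \<in> mor T Y X" "g \<cdot> f = Ident T Y"
proof -
  obtain g where g: "g \<in> mor T Y X" "\<not> is_iso T Y Y (Ident T Y \<ominus>\<^bsub>Hom T Y Y\<^esub> g \<cdot> f)"
    using assms(2,3) unfolding rad_iff by auto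
  then have "is_iso T Y Y (g \<cdot> f)"
    using local_iso_or_iso[OF assms(1) Cmp_closed[OF g(1) assms(2)]] by blast
  then obtain c where c: "c \<in> mor T Y Y" "c \<cdot> (g \<cdot> f) = Ident T Y"
    by (rule is_isoE)
  then show thesis
    using that[of "c \<cdot> g"] g(1) assms(2) Cmp_assoc[OF c(1) g(1) assms(2)] by auto
qed

lemma Ident_rad_zero_obj:
  assumes "Ident T X \<in> rad X X"
  shows "Ident T X = zero_mor T X X"
proof -
  have "is_iso T X X (zero_mor T X X)"
    using rad_iso[OF assms Ident_closed] by simp
  then show ?thesis
    by (rule is_isoE) simp
qed

lemma rad_smult:
  assumes "c \<in> carrier k" "f \<in> rad X Y"
  shows "c \<odot>\<^bsub>Hom T X Y\<^esub> f \<in> rad X Y"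
proof -
  have "c \<odot>\<^bsub>Hom T X Y\<^esub> f = (c \<odot>\<^bsub>Hom T X X\<^esub> Ident T X) \<cdot> f"
    using assms rad_mor[OF assms(2)] Cmp_smult_left[of c "Ident T X" X X f Y] by simp
  then show ?thesis
    using assms Cmp_rad[of "c \<odot>\<^bsub>Hom T X X\<^esub> Ident T X" X X f Y] by simp
qed

lemma rad_submodule: "submodule (rad X Y) k (Hom T X Y)"
proof (rule Hom.submoduleI)
  fix f assume f: "f \<in> rad X Y"
  have "\<ominus>\<^bsub>Hom T X Y\<^esub> f = (\<ominus>\<^bsub>Hom T X X\<^esub> Ident T X) \<cdot> f"
    using neg_Cmp[of "Ident T X" X X f Y] rad_mor[OF f] by simp
  then show "\<ominus>\<^bsub>Hom T X Y\<^esub> f \<in> rad X Y"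
    using f Cmp_rad[of "\<ominus>\<^bsub>Hom T X X\<^esub> Ident T X" X X f Y] by simp
qed (auto intro: rad_add rad_smult rad_mor)

text \<open>The index set is an arbitrary finite set, so that one local summand can be taken away
  without renumbering the others.\<close>

definition local_sum :: "nat set \<Rightarrow> (nat \<Rightarrow> 'o) \<Rightarrow> 'o \<Rightarrow> (nat \<Rightarrow> 'm) \<Rightarrow> (nat \<Rightarrow> 'm) \<Rightarrow> bool" where
  "local_sum I A X i p \<longleftrightarrow> finite I \<and>
     (\<forall>r\<in>I. local_ring (End_ring T (A r)) \<and> i r \<in> mor T (A r) X \<and> p r \<in> mor T X (A r)) \<and>
     (\<forall>r\<in>I. \<forall>s\<in>I. i r \<cdot> p s = (if r = s then Ident T (A r) else zero_mor T (A r) (A s))) \<and>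
     (\<Oplus>\<^bsub>Hom T X X\<^esub>r\<in>I. p r \<cdot> i r) = Ident T X"

lemma local_sum_exists:
  assumes "krull_schmidt T"
  obtains I A i p where "local_sum I A X i p"
proof -
  obtain m A where "\<forall>r<m. local_ring (End_ring T (A r))" "is_direct_sum T m A X"
    using assms unfolding krull_schmidt_def by meson
  then have "\<exists>i p. local_sum {..<m} A X i p"
    unfolding is_direct_sum_def local_sum_def Ball_def lessThan_iff by simp
  then show thesis using that by blast
qed

lemma local_sumD:
  assumes "local_sum I A X i p" "r \<in> I"
  shows "i r \<in> mor T (A r) X" "p r \<in> mor T X (A r)" "local_ring (End_ring T (A r))"
    "i r \<cdot> p r = Ident T (A r)"
  using assms unfolding local_sum_def by auto

text \<open>Were all components radical, f would be a sum of radical morphisms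
  \<open>p r \<cdot> (i r \<cdot> f)\<close>.\<close>

lemma local_sum_not_rad_left:
  assumes ls: "local_sum I A X i p" and f: "f \<in> mor T X Y" "f \<notin> rad X Y"
  shows "\<exists>r\<in>I. i r \<cdot> f \<notin> rad (A r) Y"
proof (rule ccontr)
  note D = local_sumD[OF ls]
  assume "\<not> (\<exists>r\<in>I. i r \<cdot> f \<notin> rad (A r) Y)"
  then have *: "i r \<cdot> f \<in> rad (A r) Y" if "r \<in> I" for r using that by blast
  have fin: "finite I" using ls unfolding local_sum_def by simp
  have pi: "p r \<cdot> i r \<in> mor T X X" if "r \<in> I" for r
    using D[OF that] by auto
  have "f = (\<Oplus>\<^bsub>Hom T X X\<^esub>r\<in>I. p r \<cdot> i r) \<cdot> f"
    using ls f(1) unfolding local_sum_def by simp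
  also have "\<dots> = (\<Oplus>\<^bsub>Hom T X Y\<^esub>r\<in>I. p r \<cdot> i r \<cdot> f)"
    using fin f(1) pi by (rule finsum_Cmp)
  also have "\<dots> \<in> rad X Y"
  proof (rule rad_finsum[OF fin])
    fix r assume r: "r \<in> I"
    show "p r \<cdot> i r \<cdot> f \<in> rad X Y"
      using Cmp_rad[OF D(2)[OF r] *[OF r]] Cmp_assoc[OF D(2,1)[OF r] f(1)] by simp
  qed
  finally show False using f(2) by simp
qed

lemma local_sum_not_rad_right:
  assumes ls: "local_sum I A X i p" and f: "f \<in> mor T Y X" "f \<notin> rad Y X"
  shows "\<exists>r\<in>I. f \<cdot> p r \<notin> rad Y (A r)"
proof (rule ccontr)
  note D = local_sumD[OF ls]
  assume "\<not> (\<exists>r\<in>I. f \<cdot> p r \<notin> rad Y (A r))"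
  then have *: "f \<cdot> p r \<in> rad Y (A r)" if "r \<in> I" for r using that by blast
  have fin: "finite I" using ls unfolding local_sum_def by simp
  have pi: "p r \<cdot> i r \<in> mor T X X" if "r \<in> I" for r
    using D[OF that] by auto
  have "f = f \<cdot> (\<Oplus>\<^bsub>Hom T X X\<^esub>r\<in>I. p r \<cdot> i r)"
    using ls f(1) unfolding local_sum_def by simp
  also have "\<dots> = (\<Oplus>\<^bsub>Hom T Y X\<^esub>r\<in>I. f \<cdot> (p r \<cdot> i r))"
    using fin f(1) pi by (rule Cmp_finsum)
  also have "\<dots> \<in> rad Y X"
  proof (rule rad_finsum[OF fin])
    fix r assume r: "r \<in> I"
    show "f \<cdot> (p r \<cdot> i r) \<in> rad Y X"
      using rad_Cmp[OF *[OF r] D(1)[OF r]] Cmp_assoc[OF f(1) D(2,1)[OF r]] by simp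
  qed
  finally show False using f(2) by simp
qed

text \<open>On the semisimple quotient of the endomorphism ring of X this form is non-degenerate, which
  identifies the radical on both sides.\<close>

lemma radical_form_exists:
  assumes "krull_schmidt T"
  obtains \<psi> where "linear_form k (Hom T X X) \<psi>"
    "\<And>Y f. f \<in> mor T X Y \<Longrightarrow> f \<in> rad X Y \<longleftrightarrow> (\<forall>g \<in> mor T Y X. \<psi> (f \<cdot> g) = \<zero>\<^bsub>k\<^esub>)"
    "\<And>Y f. f \<in> mor T Y X \<Longrightarrow> f \<in> rad Y X \<longleftrightarrow> (\<forall>g \<in> mor T X Y. \<psi> (g \<cdot> f) = \<zero>\<^bsub>k\<^esub>)"
proof -
  obtain I A i p where ls: "local_sum I A X i p"
    using assms by (rule local_sum_exists)
  note D = local_sumD[OF ls]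
  have fin: "finite I" and orth: "\<And>r s. r \<in> I \<Longrightarrow> s \<in> I \<Longrightarrow> r \<noteq> s \<Longrightarrow> i r \<cdot> p s = zero_mor T (A r) (A s)"
    using ls unfolding local_sum_def by auto
  \<comment> \<open>A local object is non-zero, so its identity is not radical and can be separated
    from the radical.\<close>
  have "\<exists>\<psi>. linear_form k (Hom T (A r) (A r)) \<psi> \<and> \<psi> (Ident T (A r)) = \<one>\<^bsub>k\<^esub> \<and>
      (\<forall>x \<in> rad (A r) (A r). \<psi> x = \<zero>\<^bsub>k\<^esub>)" if r: "r \<in> I" for r
  proof -
    have "Ident T (A r) \<notin> rad (A r) (A r)"
      using Ident_rad_zero_obj[of "A r"] D(3)[OF r] unfolding local_ring_def by auto
    then show ?thesis
      using Hom.separating_linear_form[OF field_axioms rad_submodule Ident_closed] by metis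
  qed
  then obtain \<phi> where \<phi>: "\<And>r. r \<in> I \<Longrightarrow> linear_form k (Hom T (A r) (A r)) (\<phi> r)"
    "\<And>r. r \<in> I \<Longrightarrow> \<phi> r (Ident T (A r)) = \<one>\<^bsub>k\<^esub>"
    "\<And>r x. r \<in> I \<Longrightarrow> x \<in> rad (A r) (A r) \<Longrightarrow> \<phi> r x = \<zero>\<^bsub>k\<^esub>"
    by metis
  \<comment> \<open>A trace: the diagonal entries of the matrix of f are measured modulo the radical
    and added up.\<close>
  define \<psi> where "\<psi> f = (\<Oplus>\<^bsub>k\<^esub>r\<in>I. \<phi> r (i r \<cdot> f \<cdot> p r))" for f
  have ifp: "i r \<cdot> f \<cdot> p r \<in> mor T (A r) (A r)" if "r \<in> I" "f \<in> mor T X X" for r f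
    using D(1,2)[OF that(1)] that(2) by auto
  have cl: "(\<lambda>r. \<phi> r (i r \<cdot> f \<cdot> p r)) \<in> I \<rightarrow> carrier k" if "f \<in> mor T X X" for f
    using \<phi>(1) ifp[OF _ that] unfolding linear_form_def by blast
  have lin: "linear_form k (Hom T X X) \<psi>"
    unfolding linear_form_def
  proof (intro conjI ballI)
    show "\<psi> \<in> mor T X X \<rightarrow> carrier k"
      unfolding \<psi>_def using cl by (auto intro: finsum_closed)
    fix f g assume f: "f \<in> mor T X X" and g: "g \<in> mor T X X"
    have "\<phi> r (i r \<cdot> (f \<oplus>\<^bsub>Hom T X X\<^esub> g) \<cdot> p r) =
        \<phi> r (i r \<cdot> f \<cdot> p r) \<oplus>\<^bsub>k\<^esub> \<phi> r (i r \<cdot> g \<cdot> p r)" if r: "r \<in> I" for r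
    proof -
      have "i r \<cdot> (f \<oplus>\<^bsub>Hom T X X\<^esub> g) \<cdot> p r = i r \<cdot> f \<cdot> p r \<oplus>\<^bsub>Hom T (A r) (A r)\<^esub> i r \<cdot> g \<cdot> p r"
        using Cmp_add_right[OF D(1)[OF r] f g]
          Cmp_add_left[OF Cmp_closed[OF D(1)[OF r] f] Cmp_closed[OF D(1)[OF r] g] D(2)[OF r]] by simp
      then show ?thesis
        using \<phi>(1)[OF r] ifp[OF r f] ifp[OF r g] unfolding linear_form_def by simp
    qed
    then have "\<psi> (f \<oplus>\<^bsub>Hom T X X\<^esub> g) =
        (\<Oplus>\<^bsub>k\<^esub>r\<in>I. \<phi> r (i r \<cdot> f \<cdot> p r) \<oplus>\<^bsub>k\<^esub> \<phi> r (i r \<cdot> g \<cdot> p r))"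
      unfolding \<psi>_def using cl[OF f] cl[OF g] by (intro finsum_cong') (auto simp: Pi_def)
    also have "\<dots> = \<psi> f \<oplus>\<^bsub>k\<^esub> \<psi> g"
      unfolding \<psi>_def using cl[OF f] cl[OF g] by (rule finsum_addf)
    finally show "\<psi> (f \<oplus>\<^bsub>Hom T X X\<^esub> g) = \<psi> f \<oplus>\<^bsub>k\<^esub> \<psi> g" .
  next
    fix c f assume c: "c \<in> carrier k" and f: "f \<in> mor T X X"
    have "\<phi> r (i r \<cdot> (c \<odot>\<^bsub>Hom T X X\<^esub> f) \<cdot> p r) = c \<otimes>\<^bsub>k\<^esub> \<phi> r (i r \<cdot> f \<cdot> p r)" if r: "r \<in> I" for r
    proof -
      have "i r \<cdot> (c \<odot>\<^bsub>Hom T X X\<^esub> f) \<cdot> p r = c \<odot>\<^bsub>Hom T (A r) (A r)\<^esub> (i r \<cdot> f \<cdot> p r)"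
        using Cmp_smult_right[OF c D(1)[OF r] f]
          Cmp_smult_left[OF c Cmp_closed[OF D(1)[OF r] f] D(2)[OF r]] by simp
      then show ?thesis
        using \<phi>(1)[OF r] ifp[OF r f] c unfolding linear_form_def by simp
    qed
    then have "\<psi> (c \<odot>\<^bsub>Hom T X X\<^esub> f) = (\<Oplus>\<^bsub>k\<^esub>r\<in>I. c \<otimes>\<^bsub>k\<^esub> \<phi> r (i r \<cdot> f \<cdot> p r))"
      unfolding \<psi>_def using cl[OF f] c by (intro finsum_cong') (auto simp: Pi_def)
    also have "\<dots> = c \<otimes>\<^bsub>k\<^esub> \<psi> f"
      unfolding \<psi>_def using finsum_rdistr[OF fin c cl[OF f]] by simp
    finally show "\<psi> (c \<odot>\<^bsub>Hom T X X\<^esub> f) = c \<otimes>\<^bsub>k\<^esub> \<psi> f" .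
  qed
  have sum0: "\<psi> f = \<zero>\<^bsub>k\<^esub>" if "f \<in> rad X X" for f
  proof -
    have "\<phi> r (i r \<cdot> f \<cdot> p r) = \<zero>\<^bsub>k\<^esub>" if r: "r \<in> I" for r
      using \<phi>(3)[OF r rad_Cmp[OF Cmp_rad[OF D(1)[OF r] \<open>f \<in> rad X X\<close>] D(2)[OF r]]] .
    then have "\<psi> f = (\<Oplus>\<^bsub>k\<^esub>r\<in>I. \<zero>\<^bsub>k\<^esub>)"
      unfolding \<psi>_def by (intro finsum_cong') auto
    then show ?thesis by simp
  qed
  have delta: "(\<Oplus>\<^bsub>k\<^esub>s\<in>I. if r = s then \<one>\<^bsub>k\<^esub> else \<zero>\<^bsub>k\<^esub>) = \<one>\<^bsub>k\<^esub>" if r: "r \<in> I" for r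
    using finsum_singleton[OF r fin, of "\<lambda>_. \<one>\<^bsub>k\<^esub>"] by simp
  \<comment> \<open>The diagonal entry at s contains the factor \<open>i r \<cdot> p s\<close>,
    hence vanishes unless s is r; the entry at r is the identity.\<close>
  have left: "\<psi> (x \<cdot> i r) = \<one>\<^bsub>k\<^esub>"
    if r: "r \<in> I" and x: "x \<in> mor T X (A r)" "i r \<cdot> x = Ident T (A r)" for r x
  proof -
    have "\<phi> s (i s \<cdot> (x \<cdot> i r) \<cdot> p s) = (if r = s then \<one>\<^bsub>k\<^esub> else \<zero>\<^bsub>k\<^esub>)" if s: "s \<in> I" for s
    proof -
      have ix: "i s \<cdot> x \<in> mor T (A s) (A r)" using D(1)[OF s] x by auto
      then have "i s \<cdot> (x \<cdot> i r) \<cdot> p s = i s \<cdot> x \<cdot> (i r \<cdot> p s)"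
        using Cmp_assoc[OF D(1)[OF s] x(1) D(1)[OF r]] Cmp_assoc[OF ix D(1)[OF r] D(2)[OF s]] by simp
      then show ?thesis
        using orth[OF r s] ix x(2) D(4)[OF r] \<phi>(2)[OF r] \<phi>(3)[OF s zero_in_rad] by auto
    qed
    then have "\<psi> (x \<cdot> i r) = (\<Oplus>\<^bsub>k\<^esub>s\<in>I. if r = s then \<one>\<^bsub>k\<^esub> else \<zero>\<^bsub>k\<^esub>)"
      unfolding \<psi>_def by (intro finsum_cong') auto
    then show ?thesis using delta[OF r] by simp
  qed
  have right: "\<psi> (p r \<cdot> y) = \<one>\<^bsub>k\<^esub>"
    if r: "r \<in> I" and y: "y \<in> mor T (A r) X" "y \<cdot> p r = Ident T (A r)" for r y
  proof -
    have "\<phi> s (i s \<cdot> (p r \<cdot> y) \<cdot> p s) = (if r = s then \<one>\<^bsub>k\<^esub> else \<zero>\<^bsub>k\<^esub>)" if s: "s \<in> I" for s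
    proof -
      have yp: "y \<cdot> p s \<in> mor T (A r) (A s)" and ip: "i s \<cdot> p r \<in> mor T (A s) (A r)"
        using D(1,2)[OF s] D(2)[OF r] y by auto
      then have "i s \<cdot> (p r \<cdot> y) \<cdot> p s = i s \<cdot> p r \<cdot> (y \<cdot> p s)"
        using Cmp_assoc[OF D(1)[OF s] D(2)[OF r] y(1)] Cmp_assoc[OF ip y(1) D(2)[OF s]] by simp
      then show ?thesis
        using orth[OF s r] yp y(2) D(4)[OF r] \<phi>(2)[OF r] \<phi>(3)[OF s zero_in_rad] by auto
    qed
    then have "\<psi> (p r \<cdot> y) = (\<Oplus>\<^bsub>k\<^esub>s\<in>I. if r = s then \<one>\<^bsub>k\<^esub> else \<zero>\<^bsub>k\<^esub>)"
      unfolding \<psi>_def by (intro finsum_cong') auto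
    then show ?thesis using delta[OF r] by simp
  qed
  show thesis
  proof (rule that[OF lin])
    fix Y f assume f: "f \<in> mor T X Y"
    \<comment> \<open>A non-radical f has a component \<open>i r \<cdot> f\<close> with a retraction
      g, and \<open>g \<cdot> i r\<close> is a morphism on which the pairing with f takes the value
      1.\<close>
    have "\<exists>g \<in> mor T Y X. \<psi> (f \<cdot> g) = \<one>\<^bsub>k\<^esub>" if nr: "f \<notin> rad X Y"
    proof -
      obtain r where r: "r \<in> I" "i r \<cdot> f \<notin> rad (A r) Y"
        using local_sum_not_rad_left[OF ls f nr] by blast
      have irf: "i r \<cdot> f \<in> mor T (A r) Y" using D(1)[OF r(1)] f by auto
      obtain g where g: "g \<in> mor T Y (A r)" "i r \<cdot> f \<cdot> g = Ident T (A r)"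
        using local_split_mono[OF D(3)[OF r(1)] irf r(2)] by blast
      have "\<psi> (f \<cdot> g \<cdot> i r) = \<one>\<^bsub>k\<^esub>"
        using g f Cmp_assoc[OF D(1)[OF r(1)] f g(1)] by (intro left[OF r(1)]) auto
      then show ?thesis
        using Cmp_assoc[OF f g(1) D(1)[OF r(1)]] g(1) D(1)[OF r(1)] by auto
    qed
    then show "f \<in> rad X Y \<longleftrightarrow> (\<forall>g \<in> mor T Y X. \<psi> (f \<cdot> g) = \<zero>\<^bsub>k\<^esub>)"
      using rad_Cmp sum0 by force
  next
    fix Y f assume f: "f \<in> mor T Y X"
    have "\<exists>g \<in> mor T X Y. \<psi> (g \<cdot> f) = \<one>\<^bsub>k\<^esub>" if nr: "f \<notin> rad Y X"
    proof -
      obtain r where r: "r \<in> I" "f \<cdot> p r \<notin> rad Y (A r)"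
        using local_sum_not_rad_right[OF ls f nr] by blast
      have fpr: "f \<cdot> p r \<in> mor T Y (A r)" using D(2)[OF r(1)] f by auto
      obtain g where g: "g \<in> mor T (A r) Y" "g \<cdot> (f \<cdot> p r) = Ident T (A r)"
        using local_split_epi[OF D(3)[OF r(1)] fpr r(2)] by blast
      have "\<psi> (p r \<cdot> (g \<cdot> f)) = \<one>\<^bsub>k\<^esub>"
        using g f Cmp_assoc[OF g(1) f D(2)[OF r(1)]] by (intro right[OF r(1)]) auto
      then show ?thesis
        using Cmp_assoc[OF D(2)[OF r(1)] g(1) f] Cmp_closed[OF D(2)[OF r(1)] g(1)]
        by (intro bexI[of _ "p r \<cdot> g"]) auto
    qed
    then show "f \<in> rad Y X \<longleftrightarrow> (\<forall>g \<in> mor T X Y. \<psi> (g \<cdot> f) = \<zero>\<^bsub>k\<^esub>)"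
      using Cmp_rad sum0 by force
  qed
qed

end

section \<open>Fully faithful functors and triangles\<close>

text \<open>Common ground of the powers of the shift, which are bijective on objects, and of the
  Serre functor, which is only an equivalence.\<close>

locale fully_faithful_functor = linear_category k T
  for k :: "('k, 'r) ring_scheme" and T :: "('o, 'm, 'k, 'z) linear_cat_scheme" +
  fixes F :: "('o, 'm) endofunctor"
  assumes lin: "linear_functor k T F"
    and bij_map: "bij_betw (mor_map F) (mor T X Y) (mor T (obj_map F X) (obj_map F Y))"
begin

abbreviation "FO \<equiv> obj_map F"
abbreviation "FM \<equiv> mor_map F"

lemma map_Ident [simp]: "FM (Ident T X) = Ident T (FO X)"
  and map_mor [intro]: "f \<in> mor T X Y \<Longrightarrow> FM f \<in> mor T (FO X) (FO Y)"
  and map_Cmp: "f \<in> mor T X Y \<Longrightarrow> g \<in> mor T Y Z \<Longrightarrow> FM (f \<cdot> g) = FM f \<cdot> FM g"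
  and map_add: "f \<in> mor T X Y \<Longrightarrow> h \<in> mor T X Y \<Longrightarrow>
    FM (f \<oplus>\<^bsub>Hom T X Y\<^esub> h) = FM f \<oplus>\<^bsub>Hom T (FO X) (FO Y)\<^esub> FM h"
  using lin unfolding linear_functor_def by blast+

lemma map_eq_iff: "f \<in> mor T X Y \<Longrightarrow> g \<in> mor T X Y \<Longrightarrow> FM f = FM g \<longleftrightarrow> f = g"
  using bij_map[of X Y] unfolding bij_betw_def inj_on_def by blast

lemma map_surjE:
  assumes "h \<in> mor T (FO X) (FO Y)"
  obtains f where "f \<in> mor T X Y" "FM f = h"
proof -
  have "h \<in> FM ` mor T X Y"
    using assms bij_betw_imp_surj_on[OF bij_map] by simp
  then show thesis using that by (elim imageE) simp
qed

lemma map_zero [simp]: "FM (zero_mor T X Y) = zero_mor T (FO X) (FO Y)"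
proof -
  have z: "FM (zero_mor T X Y) \<in> mor T (FO X) (FO Y)"
    by auto
  have "FM (zero_mor T X Y) = FM (zero_mor T X Y) \<oplus>\<^bsub>Hom T (FO X) (FO Y)\<^esub> FM (zero_mor T X Y)"
    using map_add[of "zero_mor T X Y" X Y "zero_mor T X Y"] by simp
  then show ?thesis
    using z Hom.add.l_cancel_one' by metis
qed

lemma map_eq_zero_iff: "f \<in> mor T X Y \<Longrightarrow> FM f = zero_mor T (FO X) (FO Y) \<longleftrightarrow> f = zero_mor T X Y"
  using map_eq_iff[of f X Y "zero_mor T X Y"] by simp

lemma map_neg:
  assumes "f \<in> mor T X Y"
  shows "FM (\<ominus>\<^bsub>Hom T X Y\<^esub> f) = \<ominus>\<^bsub>Hom T (FO X) (FO Y)\<^esub> FM f"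
proof -
  have "FM (\<ominus>\<^bsub>Hom T X Y\<^esub> f) \<oplus>\<^bsub>Hom T (FO X) (FO Y)\<^esub> FM f = zero_mor T (FO X) (FO Y)"
    using assms map_add[of "\<ominus>\<^bsub>Hom T X Y\<^esub> f" X Y f] by (simp add: Hom.l_neg)
  then show ?thesis
    using assms map_mor by (metis Hom.a_inv_closed Hom.minus_equality)
qed

lemma map_minus:
  assumes "f \<in> mor T X Y" "h \<in> mor T X Y"
  shows "FM (f \<ominus>\<^bsub>Hom T X Y\<^esub> h) = FM f \<ominus>\<^bsub>Hom T (FO X) (FO Y)\<^esub> FM h"
  using assms by (simp add: a_minus_def map_add map_neg)

lemma map_iso_iff:
  assumes f: "f \<in> mor T X Y"
  shows "is_iso T (FO X) (FO Y) (FM f) \<longleftrightarrow> is_iso T X Y f"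
proof
  assume "is_iso T X Y f"
  then obtain g where "g \<in> mor T Y X" "f \<cdot> g = Ident T X" "g \<cdot> f = Ident T Y"
    by (rule is_isoE)
  with f show "is_iso T (FO X) (FO Y) (FM f)"
    by (intro is_isoI[of _ _ _ "FM g"]) (auto simp: map_Cmp[symmetric])
next
  assume "is_iso T (FO X) (FO Y) (FM f)"
  then obtain h where h: "h \<in> mor T (FO Y) (FO X)" "FM f \<cdot> h = Ident T (FO X)"
    "h \<cdot> FM f = Ident T (FO Y)"
    by (rule is_isoE)
  obtain g where g: "g \<in> mor T Y X" "FM g = h"
    using h(1) by (rule map_surjE)
  have "FM (f \<cdot> g) = FM (Ident T X)" "FM (g \<cdot> f) = FM (Ident T Y)"
    using f g h map_Cmp[OF f g(1)] map_Cmp[OF g(1) f] by simp_all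
  then have "f \<cdot> g = Ident T X" "g \<cdot> f = Ident T Y"
    using f g(1) map_eq_iff by (blast intro: Cmp_closed Ident_closed)+
  then show "is_iso T X Y f"
    using f g(1) by (intro is_isoI)
qed

text \<open>Every morphism back from F Y to F X is an image under F, so both radicals are tested on
  corresponding endomorphisms, and F preserves and reflects isomorphisms.\<close>

lemma map_rad_iff:
  assumes f: "f \<in> mor T X Y"
  shows "FM f \<in> rad (FO X) (FO Y) \<longleftrightarrow> f \<in> rad X Y"
proof -
  have *: "is_iso T (FO X) (FO X) (Ident T (FO X) \<ominus>\<^bsub>Hom T (FO X) (FO X)\<^esub> FM f \<cdot> FM g) \<longleftrightarrow>
      is_iso T X X (Ident T X \<ominus>\<^bsub>Hom T X X\<^esub> f \<cdot> g)" if "g \<in> mor T Y X" for g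
    using map_iso_iff[of "Ident T X \<ominus>\<^bsub>Hom T X X\<^esub> f \<cdot> g" X X] f that Cmp_closed[OF f that]
    by (simp add: map_minus map_Cmp[OF f that])
  show ?thesis
    unfolding jacobson_radical_def mem_Collect_eq
    using f map_mor[OF f] * map_surjE map_mor by (metis (no_types, lifting))
qed

end

lemma (in linear_category) fully_faithful_functor_cmp:
  assumes "fully_faithful_functor k T F" "fully_faithful_functor k T G"
  shows "fully_faithful_functor k T (functor_cmp F G)"
proof -
  interpret F: fully_faithful_functor k T F by fact
  interpret G: fully_faithful_functor k T G by fact
  have "bij_betw (\<lambda>f. mor_map G (mor_map F f)) (mor T X Y)
      (mor T (obj_map G (obj_map F X)) (obj_map G (obj_map F Y)))" for X Y
    using bij_betw_trans[OF F.bij_map G.bij_map] by (simp add: comp_def)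
  moreover have "linear_functor k T (functor_cmp F G)"
    unfolding linear_functor_def functor_cmp_def endofunctor.simps
  proof (intro conjI allI ballI)
    fix X Y c f assume c: "c \<in> carrier k" and f: "f \<in> mor T X Y"
    have "mor_map F (c \<odot>\<^bsub>Hom T X Y\<^esub> f) = c \<odot>\<^bsub>Hom T (obj_map F X) (obj_map F Y)\<^esub> mor_map F f"
      using F.lin c f unfolding linear_functor_def by blast
    moreover have "mor_map G (c \<odot>\<^bsub>Hom T (obj_map F X) (obj_map F Y)\<^esub> mor_map F f) =
        c \<odot>\<^bsub>Hom T (obj_map G (obj_map F X)) (obj_map G (obj_map F Y))\<^esub> mor_map G (mor_map F f)"
      using G.lin c F.map_mor[OF f] unfolding linear_functor_def by blast
    ultimately show "mor_map G (mor_map F (c \<odot>\<^bsub>Hom T X Y\<^esub> f)) =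
        c \<odot>\<^bsub>Hom T (obj_map G (obj_map F X)) (obj_map G (obj_map F Y))\<^esub> mor_map G (mor_map F f)"
      by simp
  next
    fix X Y f g assume f: "f \<in> mor T X Y" and g: "g \<in> mor T X Y"
    show "mor_map G (mor_map F (f \<oplus>\<^bsub>Hom T X Y\<^esub> g)) = mor_map G (mor_map F f)
        \<oplus>\<^bsub>Hom T (obj_map G (obj_map F X)) (obj_map G (obj_map F Y))\<^esub> mor_map G (mor_map F g)"
      by (simp only: F.map_add[OF f g] G.map_add[OF F.map_mor[OF f] F.map_mor[OF g]])
  next
    fix X Y Z f g assume f: "f \<in> mor T X Y" and g: "g \<in> mor T Y Z"
    show "mor_map G (mor_map F (f \<cdot> g)) = mor_map G (mor_map F f) \<cdot> mor_map G (mor_map F g)"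
      by (simp only: F.map_Cmp[OF f g] G.map_Cmp[OF F.map_mor[OF f] F.map_mor[OF g]])
  qed (simp, rule G.map_mor[OF F.map_mor])
  ultimately show ?thesis
    unfolding functor_cmp_def by unfold_locales simp_all
qed

section \<open>Quasi-inverse functors\<close>

lemma (in linear_category) quasi_inverse_unit:
  assumes "quasi_inverse k T F G"
  shows "\<exists>\<eta>. (\<forall>X. is_iso T (obj_map G (obj_map F X)) X (\<eta> X)) \<and>
    (\<forall>X Y. \<forall>f \<in> mor T X Y. mor_map G (mor_map F f) \<cdot> \<eta> Y = \<eta> X \<cdot> f)"
  using assms unfolding quasi_inverse_def naturally_isomorphic_def functor_cmp_def functor_id_def
  by simp

lemma (in linear_category) quasi_inverse_faithful:
  assumes qi: "quasi_inverse k T F G" and f: "f \<in> mor T X Y" "f' \<in> mor T X Y"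
    and eq: "mor_map F f = mor_map F f'"
  shows "f = f'"
proof -
  obtain \<eta> where \<eta>: "\<And>X. is_iso T (obj_map G (obj_map F X)) X (\<eta> X)"
    "\<And>X Y f. f \<in> mor T X Y \<Longrightarrow> mor_map G (mor_map F f) \<cdot> \<eta> Y = \<eta> X \<cdot> f"
    using quasi_inverse_unit[OF qi] by blast
  obtain g where g: "\<eta> X \<in> mor T (obj_map G (obj_map F X)) X" "g \<in> mor T X (obj_map G (obj_map F X))"
    "g \<cdot> \<eta> X = Ident T X"
    using \<eta>(1)[of X] by (rule is_isoE)
  have "\<eta> X \<cdot> f = \<eta> X \<cdot> f'"
    using \<eta>(2)[OF f(1)] \<eta>(2)[OF f(2)] eq by simp
  then have "g \<cdot> \<eta> X \<cdot> f = g \<cdot> \<eta> X \<cdot> f'"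
    using Cmp_assoc[OF g(2,1) f(1)] Cmp_assoc[OF g(2,1) f(2)] by simp
  then show ?thesis using g f by simp
qed

lemma (in linear_category) quasi_inverse_sym: "quasi_inverse k T F G \<Longrightarrow> quasi_inverse k T G F"
  unfolding quasi_inverse_def by simp

lemma (in linear_category) quasi_inverse_iso:
  assumes "quasi_inverse k T F G"
  obtains \<eta> where "is_iso T (obj_map G (obj_map F X)) X \<eta>"
  using quasi_inverse_unit[OF assms] by blast

text \<open>A preimage of h is found by conjugating G h with the natural isomorphism. Its image
  under F agrees with h after applying G, and G is faithful by symmetry.\<close>

lemma (in linear_category) quasi_inverse_fully_faithful:
  assumes qi: "quasi_inverse k T F G"
  shows "fully_faithful_functor k T F"
proof
  show F: "linear_functor k T F" using qi unfolding quasi_inverse_def by simp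
  have G: "linear_functor k T G" using qi unfolding quasi_inverse_def by simp
  obtain \<eta> where \<eta>: "\<And>X. is_iso T (obj_map G (obj_map F X)) X (\<eta> X)"
    "\<And>X Y f. f \<in> mor T X Y \<Longrightarrow> mor_map G (mor_map F f) \<cdot> \<eta> Y = \<eta> X \<cdot> f"
    using quasi_inverse_unit[OF qi] by blast
  fix X Y
  have Fm: "mor_map F f \<in> mor T (obj_map F X) (obj_map F Y)" if "f \<in> mor T X Y" for f
    using F that unfolding linear_functor_def by blast
  obtain g where g: "\<eta> X \<in> mor T (obj_map G (obj_map F X)) X" "g \<in> mor T X (obj_map G (obj_map F X))"
    "\<eta> X \<cdot> g = Ident T (obj_map G (obj_map F X))"
    using \<eta>(1)[of X] by (rule is_isoE)
  obtain g' where g': "\<eta> Y \<in> mor T (obj_map G (obj_map F Y)) Y" "g' \<in> mor T Y (obj_map G (obj_map F Y))"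
    "\<eta> Y \<cdot> g' = Ident T (obj_map G (obj_map F Y))"
    using \<eta>(1)[of Y] by (rule is_isoE)
  show "bij_betw (mor_map F) (mor T X Y) (mor T (obj_map F X) (obj_map F Y))"
    unfolding bij_betw_def
  proof (intro conjI inj_onI equalityI subsetI)
    fix f f' assume "f \<in> mor T X Y" "f' \<in> mor T X Y" "mor_map F f = mor_map F f'"
    then show "f = f'" by (rule quasi_inverse_faithful[OF qi])
  next
    fix h assume h: "h \<in> mor T (obj_map F X) (obj_map F Y)"
    have Gh: "mor_map G h \<in> mor T (obj_map G (obj_map F X)) (obj_map G (obj_map F Y))"
      using G h unfolding linear_functor_def by blast
    let ?f = "g \<cdot> (mor_map G h \<cdot> \<eta> Y)"
    have Gh\<eta>: "mor_map G h \<cdot> \<eta> Y \<in> mor T (obj_map G (obj_map F X)) Y"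
      using Gh g' by auto
    have f: "?f \<in> mor T X Y" using g Gh\<eta> by auto
    have GF: "mor_map G (mor_map F ?f) \<in> mor T (obj_map G (obj_map F X)) (obj_map G (obj_map F Y))"
      using G Fm[OF f] unfolding linear_functor_def by blast
    have "mor_map G (mor_map F ?f) \<cdot> \<eta> Y = mor_map G h \<cdot> \<eta> Y"
      using \<eta>(2)[OF f] Cmp_assoc[OF g(1,2) Gh\<eta>] g(3) Gh\<eta> by simp
    then have "mor_map G (mor_map F ?f) \<cdot> (\<eta> Y \<cdot> g') = mor_map G h \<cdot> (\<eta> Y \<cdot> g')"
      using Cmp_assoc[OF GF g'(1,2)] Cmp_assoc[OF Gh g'(1,2)] by simp
    then have "mor_map G (mor_map F ?f) = mor_map G h"
      using g'(3) GF Gh by simp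
    then have "mor_map F ?f = h"
      using quasi_inverse_faithful[OF quasi_inverse_sym[OF qi] Fm[OF f] h] by simp
    then show "h \<in> mor_map F ` mor T X Y" using imageI[OF f, of "mor_map F"] by simp
  qed (use Fm in blast)
qed

text \<open>Proofs avoid negative powers by writing an object as the shift of another one, which
  bijectivity on objects allows. Packed as endofunctors, the powers inherit all facts on fully
  faithful functors.\<close>

definition shift_pow :: "('o, 'm, 'k, 'z) tri_cat_scheme \<Rightarrow> nat \<Rightarrow> ('o, 'm) endofunctor" where
  "shift_pow T j = \<lparr>obj_map = sh_obj T ^^ j, mor_map = sh_mor T ^^ j\<rparr>"

lemma shift_pow_simps [simp]:
  "obj_map (shift_pow T j) = sh_obj T ^^ j" "mor_map (shift_pow T j) = sh_mor T ^^ j"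
  by (simp_all add: shift_pow_def)

section \<open>Weak kernels and cokernels in triangles, and splitting of idempotents\<close>

context triangulated_category
begin

sublocale sh: fully_faithful_functor k T "shift T"
  using shift_automorphism unfolding linear_automorphism_def by unfold_locales auto

lemma fully_faithful_shift_pow: "fully_faithful_functor k T (shift_pow T j)"
proof (induction j)
  case 0
  show ?case
    by unfold_locales (auto simp: linear_functor_def)
next
  case (Suc j)
  have "shift_pow T (Suc j) = functor_cmp (shift_pow T j) (shift T)"
    unfolding functor_cmp_def shift_pow_def by (simp add: comp_def)
  then show ?case
    using fully_faithful_functor_cmp[OF Suc sh.fully_faithful_functor_axioms] by simp
qed

sublocale shp: fully_faithful_functor k T "shift_pow T j"
  rewrites "obj_map (shift_pow T j) = sh_obj T ^^ j" and "mor_map (shift_pow T j) = sh_mor T ^^ j"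
  for j
  by (rule fully_faithful_shift_pow) simp_all

lemma bij_sh_obj: "bij (sh_obj T)"
  using shift_automorphism unfolding linear_automorphism_def by blast

lemma sh_obj_surjE: obtains Y where "X = sh_obj T Y"
  using bij_sh_obj by (metis bij_pointE)

text \<open>Mapping the triangle X = X -> 0 to the given one makes the composite factor through a
  zero object.\<close>

lemma tri_comp_uv:
  assumes t: "tri T X Y Z u v w"
  shows "u \<cdot> v = zero_mor T X Z"
proof -
  obtain O' where O: "is_zero_obj T O'" using zero_obj_exists by blast
  have um: "u \<in> mor T X Y" "v \<in> mor T Y Z" using tri_typed[OF t] by auto
  obtain h where h: "h \<in> mor T O' Z" "zero_mor T X O' \<cdot> h = u \<cdot> v"
    using tri_morphism[OF tri_ident[OF O, of X] t, of "Ident T X" u] um by auto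
  then show ?thesis using zero_obj_mor(2)[OF O h(1)] by simp
qed

lemma tri_rotate_right:
  "tri T X Y Z u v w \<Longrightarrow> tri T Y Z (sh_obj T X) v w (\<ominus>\<^bsub>Hom T (sh_obj T X) (sh_obj T Y)\<^esub> sh_mor T u)"
  using tri_typed tri_rotate by blast

text \<open>The trivial triangle X = X -> 0 rotated backwards; for this the zero object has to be
  written as a shift.\<close>

lemma tri_zero_Ident:
  "\<exists>Z. tri T Z X X (zero_mor T Z X) (Ident T X) (zero_mor T X (sh_obj T Z))"
proof -
  obtain Z where Z: "is_zero_obj T (sh_obj T Z)"
    using zero_obj_exists sh_obj_surjE by metis
  have "tri T X X (sh_obj T Z) (Ident T X) (zero_mor T X (sh_obj T Z))
      (\<ominus>\<^bsub>Hom T (sh_obj T Z) (sh_obj T X)\<^esub> sh_mor T (zero_mor T Z X))"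
    using tri_ident[OF Z, of X] by simp
  then show ?thesis
    using tri_rotate[of "zero_mor T Z X" Z X "Ident T X" X "zero_mor T X (sh_obj T Z)"] by auto
qed

text \<open>Comparison with the triangle 0 -> W = W.\<close>

lemma tri_weak_cokernel_u:
  assumes t: "tri T X Y Z u v w" and f: "f \<in> mor T Y W" "u \<cdot> f = zero_mor T X W"
  obtains g where "g \<in> mor T Z W" "f = v \<cdot> g"
proof -
  obtain O' where O: "tri T O' W W (zero_mor T O' W) (Ident T W) (zero_mor T W (sh_obj T O'))"
    using tri_zero_Ident by blast
  have um: "u \<in> mor T X Y" "v \<in> mor T Y Z" using tri_typed[OF t] by auto
  obtain h where "h \<in> mor T Z W" "v \<cdot> h = f \<cdot> Ident T W"
    using tri_morphism[OF t O, of "zero_mor T X O'" f] f um by auto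
  then show thesis using that f by simp
qed

text \<open>The axiom on morphisms of triangles supplies only a third component. So the comparison
  is made with the rotated triangle W -> 0 -> W[1], which produces the lift after one shift; the
  signs of the two rotations cancel.\<close>

lemma tri_weak_kernel_v:
  assumes t: "tri T X Y Z u v w" and f: "f \<in> mor T W Y" "f \<cdot> v = zero_mor T W Z"
  obtains g where "g \<in> mor T W X" "f = g \<cdot> u"
proof -
  obtain O' where O: "is_zero_obj T O'" using zero_obj_exists by blast
  have um: "u \<in> mor T X Y" "v \<in> mor T Y Z" "w \<in> mor T Z (sh_obj T X)" using tri_typed[OF t] by auto
  have t': "tri T W O' (sh_obj T W) (zero_mor T W O') (zero_mor T O' (sh_obj T W))
      (\<ominus>\<^bsub>Hom T (sh_obj T W) (sh_obj T W)\<^esub> Ident T (sh_obj T W))"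
    using tri_rotate_right[OF tri_ident[OF O, of W]] by simp
  obtain h where h: "h \<in> mor T (sh_obj T W) (sh_obj T X)"
    "(\<ominus>\<^bsub>Hom T (sh_obj T W) (sh_obj T W)\<^esub> Ident T (sh_obj T W)) \<cdot> sh_mor T f =
      h \<cdot> (\<ominus>\<^bsub>Hom T (sh_obj T X) (sh_obj T Y)\<^esub> sh_mor T u)"
    using tri_morphism[OF t' tri_rotate_right[OF t], of f "zero_mor T O' Z"] f um by auto
  obtain g where g: "g \<in> mor T W X" "sh_mor T g = h"
    using h(1) by (rule sh.map_surjE)
  have sf: "sh_mor T f \<in> mor T (sh_obj T W) (sh_obj T Y)"
    and su: "sh_mor T u \<in> mor T (sh_obj T X) (sh_obj T Y)" using f um by auto
  have "sh_mor T f = sh_mor T (g \<cdot> u)"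
    using h(2) sf su h(1) g um(1) Cmp_closed[OF h(1) su]
    by (simp add: neg_Cmp[OF Ident_closed sf] Cmp_neg[OF h(1) su] sh.map_Cmp[OF g(1) um(1)])
      (metis Hom.minus_minus)
  then have "f = g \<cdot> u" using sh.map_eq_iff f(1) g(1) um(1) by (metis Cmp_closed)
  then show thesis using that g(1) by blast
qed

lemma tri_weak_cokernel_v:
  assumes t: "tri T X Y Z u v w" and f: "f \<in> mor T Z W" "v \<cdot> f = zero_mor T Y W"
  obtains g where "g \<in> mor T (sh_obj T X) W" "f = w \<cdot> g"
  using tri_weak_cokernel_u[OF tri_rotate_right[OF t] f] by blast

lemma tri_weak_cokernel_w:
  assumes t: "tri T X Y Z u v w" and f: "f \<in> mor T (sh_obj T X) W" "w \<cdot> f = zero_mor T Z W"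
  obtains g where "g \<in> mor T (sh_obj T Y) W" "f = sh_mor T u \<cdot> g"
proof -
  have su: "sh_mor T u \<in> mor T (sh_obj T X) (sh_obj T Y)" using tri_typed[OF t] by auto
  obtain g where g: "g \<in> mor T (sh_obj T Y) W"
    "f = (\<ominus>\<^bsub>Hom T (sh_obj T X) (sh_obj T Y)\<^esub> sh_mor T u) \<cdot> g"
    using tri_weak_cokernel_u[OF tri_rotate_right[OF tri_rotate_right[OF t]] f] by blast
  then have "f = sh_mor T u \<cdot> (\<ominus>\<^bsub>Hom T (sh_obj T Y) W\<^esub> g)"
    using neg_Cmp[OF su g(1)] Cmp_neg[OF su g(1)] by simp
  then show thesis using that g(1) by blast
qed

lemma tri_weak_kernel_u:
  assumes t: "tri T X Y Z u v w" and f: "f \<in> mor T W (sh_obj T X)"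
    "f \<cdot> sh_mor T u = zero_mor T W (sh_obj T Y)"
  obtains g where "g \<in> mor T W Z" "f = g \<cdot> w"
proof -
  have "sh_mor T u \<in> mor T (sh_obj T X) (sh_obj T Y)" using tri_typed[OF t] by auto
  then show thesis
    using tri_weak_kernel_v[OF tri_rotate_right[OF tri_rotate_right[OF t]] f(1)] that f
    by (metis Cmp_neg neg_zero)
qed

lemma tri_comp_vw:
  assumes "tri T X Y Z u v w"
  shows "v \<cdot> w = zero_mor T Y (sh_obj T X)"
  using tri_comp_uv[OF tri_rotate_right[OF assms]] .

lemma tri_comp_wu:
  assumes "tri T X Y Z u v w"
  shows "w \<cdot> sh_mor T u = zero_mor T Z (sh_obj T Y)"
proof -
  have m: "w \<in> mor T Z (sh_obj T X)" "sh_mor T u \<in> mor T (sh_obj T X) (sh_obj T Y)"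
    using tri_typed[OF assms] by auto
  then have "\<ominus>\<^bsub>Hom T Z (sh_obj T Y)\<^esub> (w \<cdot> sh_mor T u) = zero_mor T Z (sh_obj T Y)"
    using tri_comp_uv[OF tri_rotate_right[OF tri_rotate_right[OF assms]]] Cmp_neg[OF m] by simp
  then show ?thesis
    using Hom.minus_minus[OF Cmp_closed[OF m]] by simp
qed

lemma cocone_exists:
  assumes f: "f \<in> mor T Y Z"
  obtains X u w where "tri T X Y Z u f w"
proof -
  obtain W v w where t: "tri T Y Z W f v w" using tri_complete[OF f] by blast
  obtain X where X: "W = sh_obj T X" by (rule sh_obj_surjE)
  \<comment> \<open>Rotation puts the negative of u[1] in third place, hence u is chosen with u[1]
    equal to -w.\<close>
  have w: "\<ominus>\<^bsub>Hom T W (sh_obj T Y)\<^esub> w \<in> mor T (sh_obj T X) (sh_obj T Y)"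
    using tri_typed[OF t] X by auto
  then obtain u where u: "u \<in> mor T X Y" "sh_mor T u = \<ominus>\<^bsub>Hom T W (sh_obj T Y)\<^esub> w"
    by (rule sh.map_surjE)
  have "tri T X Y Z u f v"
    using t u X f tri_typed[OF t] Hom.minus_minus[of w W "sh_obj T Y"] by (subst tri_rotate) auto
  then show thesis by (rule that)
qed

text \<open>The cone of a split monomorphism is a complement. The given i and p are kept as part of
  the biproduct, since they are members of a fixed local decomposition when a summand is
  removed.\<close>

lemma retract_complement:
  assumes i: "i \<in> mor T A X" and p: "p \<in> mor T X A" and ip: "i \<cdot> p = Ident T A"
  obtains B j q where "is_biproduct T A B X i j p q"
proof -
  obtain B q w where t: "tri T A X B i q w" using tri_complete[OF i] by blast
  have q: "q \<in> mor T X B" and w: "w \<in> mor T B (sh_obj T A)"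
    using tri_typed[OF t] by auto
  \<comment> \<open>In the triangle w is killed by i[1], which has the retraction p[1]. Consequently
    q is an epimorphism, and equations can be cancelled by q.\<close>
  have w0: "w = zero_mor T B (sh_obj T A)"
  proof -
    have "w \<cdot> sh_mor T (i \<cdot> p) = w \<cdot> sh_mor T i \<cdot> sh_mor T p"
      using Cmp_assoc[OF w sh.map_mor[OF i] sh.map_mor[OF p]] sh.map_Cmp[OF i p] by simp
    then show ?thesis
      using ip w tri_comp_wu[OF t] sh.map_mor[OF p] by simp
  qed
  have inj: "f = zero_mor T B W" if "f \<in> mor T B W" "q \<cdot> f = zero_mor T X W" for f W
  proof -
    obtain g where "g \<in> mor T (sh_obj T A) W" "f = w \<cdot> g"
      using tri_weak_cokernel_v[OF t \<open>f \<in> mor T B W\<close> \<open>q \<cdot> f = zero_mor T X W\<close>] by blast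
    then show ?thesis using w0 by simp
  qed
  have pi: "p \<cdot> i \<in> mor T X X" using i p by auto
  have c: "Ident T X \<ominus>\<^bsub>Hom T X X\<^esub> p \<cdot> i \<in> mor T X X" using pi by auto
  have ipi: "i \<cdot> (p \<cdot> i) = i" using Cmp_assoc[OF i p i] ip i by simp
  have pip: "p \<cdot> i \<cdot> p = p" using Cmp_assoc[OF p i p] ip p by simp
  have "i \<cdot> (Ident T X \<ominus>\<^bsub>Hom T X X\<^esub> p \<cdot> i) = zero_mor T A X"
    using Cmp_minus[OF i Ident_closed pi] ipi i by simp
  then obtain j where j: "j \<in> mor T B X" "Ident T X \<ominus>\<^bsub>Hom T X X\<^esub> p \<cdot> i = q \<cdot> j"
    using tri_weak_cokernel_u[OF t c] by blast
  have qj: "q \<cdot> j \<in> mor T X X" using q j by auto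
  have iq: "i \<cdot> q = zero_mor T A B" using tri_comp_uv[OF t] .
  have "q \<cdot> j \<cdot> p = zero_mor T X A"
    using minus_Cmp[OF Ident_closed pi p] p pip by (simp add: j(2)[symmetric])
  then have jp: "j \<cdot> p = zero_mor T B A"
    using inj[of "j \<cdot> p" A] j(1) p Cmp_assoc[OF q j(1) p] by auto
  have "q \<cdot> j \<cdot> q = q"
    using minus_Cmp[OF Ident_closed pi q] q Cmp_assoc[OF p i q] iq p
    by (simp add: j(2)[symmetric])
  then have "q \<cdot> (j \<cdot> q \<ominus>\<^bsub>Hom T B B\<^esub> Ident T B) = zero_mor T X B"
    using Cmp_minus[OF q Cmp_closed[OF j(1) q] Ident_closed] q Cmp_assoc[OF q j(1) q] by simp
  then have "j \<cdot> q \<ominus>\<^bsub>Hom T B B\<^esub> Ident T B = zero_mor T B B"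
    using inj[of "j \<cdot> q \<ominus>\<^bsub>Hom T B B\<^esub> Ident T B" B] Cmp_closed[OF j(1) q] by auto
  then have "j \<cdot> q = Ident T B"
    using minus_add_cancel[OF Cmp_closed[OF j(1) q] Ident_closed] by simp
  moreover have "(p \<cdot> i) \<oplus>\<^bsub>Hom T X X\<^esub> (q \<cdot> j) = Ident T X"
    using minus_add_cancel[OF Ident_closed pi] Hom.a_comm[OF pi qj] j(2) by simp
  ultimately have "is_biproduct T A B X i j p q"
    unfolding is_biproduct_def using i j(1) p q ip iq jp by simp
  then show thesis by (rule that)
qed

end

section \<open>Minimal parts of morphisms and the Serre trace\<close>

context linear_category
begin

lemma is_biproductD:
  assumes "is_biproduct T A B X i j p q"
  shows "i \<in> mor T A X" "j \<in> mor T B X" "p \<in> mor T X A" "q \<in> mor T X B"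
    "i \<cdot> p = Ident T A" "j \<cdot> q = Ident T B" "i \<cdot> q = zero_mor T A B" "j \<cdot> p = zero_mor T B A"
    "p \<cdot> i \<oplus>\<^bsub>Hom T X X\<^esub> q \<cdot> j = Ident T X"
  using assms unfolding is_biproduct_def by auto

text \<open>The idempotent e projecting to A kills f, and 1 - e is not invertible because it
  vanishes on the non-zero A. This turns failing minimality into an endomorphism that a radical
  kernel morphism rules out.\<close>

lemma mor_summand_right_zero:
  assumes "mor_summand T A Z g X Y f" "is_zero_obj T Z" "\<not> is_zero_obj T A"
  obtains e where "e \<in> mor T X X" "e \<cdot> f = zero_mor T X Y"
    "\<not> is_iso T X X (Ident T X \<ominus>\<^bsub>Hom T X X\<^esub> e)"
proof -
  obtain A' B' g' i i' p p' j j' q q' where X: "is_biproduct T A A' X i i' p p'"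
    and Y: "is_biproduct T Z B' Y j j' q q'" and g: "g \<in> mor T A Z" and g': "g' \<in> mor T A' B'"
    and f: "f = (p \<cdot> g \<cdot> j) \<oplus>\<^bsub>Hom T X Y\<^esub> (p' \<cdot> g' \<cdot> j')"
    using assms(1) unfolding mor_summand_def by blast
  note X = is_biproductD[OF X] and Y = is_biproductD[OF Y]
  have pi: "p \<cdot> i \<in> mor T X X" using X by auto
  have pgj': "p' \<cdot> g' \<in> mor T X B'" "p' \<cdot> g' \<cdot> j' \<in> mor T X Y" using X Y g' by auto
  have "p \<cdot> g = zero_mor T X Z"
    using zero_obj_mor(1)[OF assms(2)] X(3) g by blast
  then have f': "f = p' \<cdot> g' \<cdot> j'"
    using f Y(1) pgj' by simp
  have pip: "p \<cdot> i \<cdot> p' = zero_mor T X A'"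
    using Cmp_assoc[OF X(3,1,4)] X(3,7) by simp
  then have "p \<cdot> i \<cdot> (p' \<cdot> g') = zero_mor T X B'"
    using Cmp_assoc[OF pi X(4) g', symmetric] g' by simp
  then have "p \<cdot> i \<cdot> f = zero_mor T X Y"
    unfolding f' using Cmp_assoc[OF pi pgj'(1) Y(2), symmetric] Y(2) by simp
  moreover have "\<not> is_iso T X X (Ident T X \<ominus>\<^bsub>Hom T X X\<^esub> p \<cdot> i)"
  proof
    assume "is_iso T X X (Ident T X \<ominus>\<^bsub>Hom T X X\<^esub> p \<cdot> i)"
    then obtain c where c: "Ident T X \<ominus>\<^bsub>Hom T X X\<^esub> p \<cdot> i \<in> mor T X X" "c \<in> mor T X X"
      "(Ident T X \<ominus>\<^bsub>Hom T X X\<^esub> p \<cdot> i) \<cdot> c = Ident T X"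
      by (rule is_isoE)
    have "i \<cdot> (p \<cdot> i) = i" using Cmp_assoc[OF X(1,3,1)] X(1,5) by simp
    then have "i \<cdot> (Ident T X \<ominus>\<^bsub>Hom T X X\<^esub> p \<cdot> i) = zero_mor T A X"
      using Cmp_minus[OF X(1) Ident_closed pi] X(1) by simp
    then have "i = zero_mor T A X"
      using Cmp_assoc[OF X(1) c(1,2)] c(2,3) X(1) by simp
    then have "Ident T A = zero_mor T A A"
      using X(3,5) by simp
    then show False using assms(3) zero_obj_if_Ident_zero by blast
  qed
  ultimately show thesis using that pi by blast
qed

lemma mor_summand_left_zero:
  assumes "mor_summand T Z A g X Y f" "is_zero_obj T Z" "\<not> is_zero_obj T A"
  obtains e where "e \<in> mor T Y Y" "f \<cdot> e = zero_mor T X Y"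
    "\<not> is_iso T Y Y (Ident T Y \<ominus>\<^bsub>Hom T Y Y\<^esub> e)"
proof -
  obtain A' B' g' i i' p p' j j' q q' where X: "is_biproduct T Z A' X i i' p p'"
    and Y: "is_biproduct T A B' Y j j' q q'" and g: "g \<in> mor T Z A" and g': "g' \<in> mor T A' B'"
    and f: "f = (p \<cdot> g \<cdot> j) \<oplus>\<^bsub>Hom T X Y\<^esub> (p' \<cdot> g' \<cdot> j')"
    using assms(1) unfolding mor_summand_def by blast
  note X = is_biproductD[OF X] and Y = is_biproductD[OF Y]
  have qj: "q \<cdot> j \<in> mor T Y Y" using Y by auto
  have pgj': "p' \<cdot> g' \<in> mor T X B'" "p' \<cdot> g' \<cdot> j' \<in> mor T X Y" using X Y g' by auto
  have "p \<cdot> g = zero_mor T X A"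
    using zero_obj_mor(2)[OF assms(2) g] X(3) by simp
  then have f': "f = p' \<cdot> g' \<cdot> j'"
    using f Y(1) pgj' by simp
  have "j' \<cdot> (q \<cdot> j) = zero_mor T B' Y"
    using Cmp_assoc[OF Y(2,3,1)] Y(1,8) by simp
  then have "f \<cdot> (q \<cdot> j) = zero_mor T X Y"
    unfolding f' using Cmp_assoc[OF pgj'(1) Y(2) qj] pgj'(1) by simp
  moreover have "\<not> is_iso T Y Y (Ident T Y \<ominus>\<^bsub>Hom T Y Y\<^esub> q \<cdot> j)"
  proof
    assume "is_iso T Y Y (Ident T Y \<ominus>\<^bsub>Hom T Y Y\<^esub> q \<cdot> j)"
    then obtain c where c: "Ident T Y \<ominus>\<^bsub>Hom T Y Y\<^esub> q \<cdot> j \<in> mor T Y Y" "c \<in> mor T Y Y"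
      "(Ident T Y \<ominus>\<^bsub>Hom T Y Y\<^esub> q \<cdot> j) \<cdot> c = Ident T Y"
      by (rule is_isoE)
    have "j \<cdot> (q \<cdot> j) = j" using Cmp_assoc[OF Y(1,3,1)] Y(1,5) by simp
    then have "j \<cdot> (Ident T Y \<ominus>\<^bsub>Hom T Y Y\<^esub> q \<cdot> j) = zero_mor T A Y"
      using Cmp_minus[OF Y(1) Ident_closed qj] Y(1) by simp
    then have "j = zero_mor T A Y"
      using Cmp_assoc[OF Y(1) c(1,2)] c(2,3) Y(1) by simp
    then have "Ident T A = zero_mor T A A"
      using Y(3,5) by simp
    then show False using assms(3) zero_obj_if_Ident_zero by blast
  qed
  ultimately show thesis using that qj by blast
qed

text \<open>The remaining idempotents \<open>p s \<cdot> i s\<close> add up to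
  \<open>q \<cdot> j\<close>, and every remaining \<open>i s\<close> is fixed by
  \<open>q \<cdot> j\<close>; hence the other summands decompose the complement B.\<close>

lemma local_sum_remove:
  assumes ls: "local_sum I A X i p" and r: "r \<in> I"
    and bp: "is_biproduct T (A r) B X (i r) j (p r) q"
  shows "local_sum (I - {r}) A B (\<lambda>s. i s \<cdot> q) (\<lambda>s. j \<cdot> p s)"
proof -
  note D = local_sumD[OF ls] and b = is_biproductD[OF bp]
  have fin: "finite I" and orth: "\<And>r s. r \<in> I \<Longrightarrow> s \<in> I \<Longrightarrow> r \<noteq> s \<Longrightarrow> i r \<cdot> p s = zero_mor T (A r) (A s)"
    and sum: "(\<Oplus>\<^bsub>Hom T X X\<^esub>s\<in>I. p s \<cdot> i s) = Ident T X"
    using ls unfolding local_sum_def by auto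
  have pi: "p s \<cdot> i s \<in> mor T X X" if "s \<in> I" for s using D[OF that] by auto
  have qj: "q \<cdot> j \<in> mor T X X" using b by auto
  let ?S = "\<Oplus>\<^bsub>Hom T X X\<^esub>s\<in>I - {r}. p s \<cdot> i s"
  have S: "?S \<in> mor T X X" using pi by (intro Hom.finsum_closed) auto
  have "p r \<cdot> i r \<oplus>\<^bsub>Hom T X X\<^esub> ?S = Ident T X"
    using sum fin r pi Hom.finsum_insert[of "I - {r}" r "\<lambda>s. p s \<cdot> i s" X X]
    by (auto simp: insert_absorb Pi_def)
  then have Sqj: "?S = q \<cdot> j"
    using b(9) add_minus_cancel[OF S pi[OF r]] add_minus_cancel[OF qj pi[OF r]]
      Hom.a_comm[OF pi[OF r] S] Hom.a_comm[OF pi[OF r] qj] by simp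
  have "(\<Oplus>\<^bsub>Hom T B B\<^esub>s\<in>I - {r}. j \<cdot> p s \<cdot> (i s \<cdot> q)) = (\<Oplus>\<^bsub>Hom T B B\<^esub>s\<in>I - {r}. j \<cdot> (p s \<cdot> i s) \<cdot> q)"
  proof (rule Hom.finsum_cong')
    fix s assume "s \<in> I - {r}"
    then have s: "s \<in> I" by simp
    show "j \<cdot> p s \<cdot> (i s \<cdot> q) = j \<cdot> (p s \<cdot> i s) \<cdot> q"
      using Cmp_assoc[OF b(2) D(2,1)[OF s]] Cmp_assoc[OF Cmp_closed[OF b(2) D(2)[OF s]] D(1)[OF s] b(4)]
      by simp
  qed (use pi b in auto)
  also have "\<dots> = (\<Oplus>\<^bsub>Hom T B X\<^esub>s\<in>I - {r}. j \<cdot> (p s \<cdot> i s)) \<cdot> q"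
    using fin pi b(2,4) by (subst finsum_Cmp[of _ q X B _ B]) auto
  also have "\<dots> = j \<cdot> ?S \<cdot> q"
    using fin pi b(2) by (subst Cmp_finsum[of _ j B X _ X]) auto
  also have "\<dots> = Ident T B"
    using Sqj b Cmp_assoc[OF b(2,4,2)] by simp
  finally have "(\<Oplus>\<^bsub>Hom T B B\<^esub>s\<in>I - {r}. j \<cdot> p s \<cdot> (i s \<cdot> q)) = Ident T B" .
  moreover have "i s \<cdot> q \<cdot> (j \<cdot> p t) = i s \<cdot> p t" if "s \<in> I - {r}" "t \<in> I" for s t
  proof -
    have s: "s \<in> I" "s \<noteq> r" and t: "t \<in> I" using that by auto
    have ip: "i r \<cdot> p t \<in> mor T (A r) (A t)" using D(1)[OF r] D(2)[OF t] by auto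
    have "i s \<cdot> (p r \<cdot> i r) = zero_mor T (A s) X"
      using Cmp_assoc[OF D(1)[OF s(1)] D(2,1)[OF r]] orth[OF s(1) r s(2)] D(1)[OF r] by simp
    then have "i s \<cdot> (p r \<cdot> i r) \<oplus>\<^bsub>Hom T (A s) X\<^esub> i s \<cdot> (q \<cdot> j) = i s \<cdot> (q \<cdot> j)"
      using Cmp_closed[OF D(1)[OF s(1)] qj] by simp
    then have "i s \<cdot> (q \<cdot> j) = i s"
      using Cmp_add_right[OF D(1)[OF s(1)] pi[OF r] qj] b(9) D(1)[OF s(1)] by simp
    then show ?thesis
      using Cmp_assoc[OF D(1)[OF s(1)] b(4) Cmp_closed[OF b(2) D(2)[OF t]]]
        Cmp_assoc[OF b(4,2) D(2)[OF t]] Cmp_assoc[OF D(1)[OF s(1)] qj D(2)[OF t]] by simp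
  qed
  ultimately show ?thesis
    unfolding local_sum_def using fin D(3) orth D(4) Cmp_closed[OF D(1) b(4)] Cmp_closed[OF b(2) D(2)]
    by auto
qed

end

section \<open>Minimality read off from triangles\<close>

context triangulated_category
begin

text \<open>Any e with ef = 0 factors through b, so 1 - e is invertible if b is radical; no
  projection to a non-zero summand has this property.\<close>

lemma right_minimal_if_rad:
  assumes t: "tri T K X Y b f w" and b: "b \<in> rad K X"
  shows "right_minimal T X Y f"
  unfolding right_minimal_def
proof (intro conjI notI)
  show f: "f \<in> mor T X Y" using tri_typed[OF t] by simp
  assume "\<exists>A Z g. \<not> is_zero_obj T A \<and> is_zero_obj T Z \<and> mor_summand T A Z g X Y f"
  then obtain e where e: "e \<in> mor T X X" "e \<cdot> f = zero_mor T X Y"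
    "\<not> is_iso T X X (Ident T X \<ominus>\<^bsub>Hom T X X\<^esub> e)"
    using mor_summand_right_zero by blast
  obtain u where "u \<in> mor T X K" "e = u \<cdot> b"
    using tri_weak_kernel_v[OF t e(1,2)] by blast
  then show False using rad_iso_swap[OF b] e(3) by simp
qed

lemma left_minimal_if_rad:
  assumes t: "tri T X Y Z f a w" and a: "a \<in> rad Y Z"
  shows "left_minimal T X Y f"
  unfolding left_minimal_def
proof (intro conjI notI)
  show f: "f \<in> mor T X Y" using tri_typed[OF t] by simp
  assume "\<exists>A Z g. \<not> is_zero_obj T A \<and> is_zero_obj T Z \<and> mor_summand T Z A g X Y f"
  then obtain e where e: "e \<in> mor T Y Y" "f \<cdot> e = zero_mor T X Y"
    "\<not> is_iso T Y Y (Ident T Y \<ominus>\<^bsub>Hom T Y Y\<^esub> e)"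
    using mor_summand_left_zero by blast
  obtain u where "u \<in> mor T Z Y" "e = a \<cdot> u"
    using tri_weak_cokernel_u[OF t e(1,2)] by blast
  then show False using rad_iso[OF a] e(3) by simp
qed

text \<open>If the kernel morphism b is not radical, one of its components splits off a summand of X on
  which f vanishes.\<close>

lemma right_minimal_part_aux:
  assumes C: "subcategory T C"
  shows "local_sum I A X i p \<Longrightarrow> f \<in> mor T X Y \<Longrightarrow> \<exists>X' \<iota> \<pi> K b w.
    \<iota> \<in> mor T X' X \<and> \<pi> \<in> mor T X X' \<and> \<pi> \<cdot> (\<iota> \<cdot> f) = f \<and>
    tri T K X' Y b (\<iota> \<cdot> f) w \<and> b \<in> rad K X' \<and> (X \<in> C \<longrightarrow> X' \<in> C)"
proof (induction "card I" arbitrary: I X i p f rule: less_induct)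
  case less
  note ls = less.prems(1) and f = less.prems(2) and D = local_sumD[OF less.prems(1)]
  obtain K b w where t: "tri T K X Y b f w"
    using cocone_exists[OF f] by blast
  have b: "b \<in> mor T K X" using tri_typed[OF t] by simp
  show ?case
  proof (cases "b \<in> rad K X")
    case True
    then show ?thesis
      using t f by (intro exI[of _ X] exI[of _ "Ident T X"] exI[of _ K] exI[of _ b] exI[of _ w]) simp
  next
    case False
    then obtain r where r: "r \<in> I" "b \<cdot> p r \<notin> rad K (A r)"
      using local_sum_not_rad_right[OF ls b] by blast
    note i = D(1)[OF r(1)] and p = D(2)[OF r(1)]
    have bp: "b \<cdot> p r \<in> mor T K (A r)" using b p by auto
    obtain g where g: "g \<in> mor T (A r) K" "g \<cdot> (b \<cdot> p r) = Ident T (A r)"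
      using local_split_epi[OF D(3)[OF r(1)] bp r(2)] by blast
    obtain B j q where bi: "is_biproduct T (A r) B X (i r) j (p r) q"
      using retract_complement[OF i p D(4)[OF r(1)]] by blast
    note B = is_biproductD[OF bi]
    have jf: "j \<cdot> f \<in> mor T B Y" using B f by auto
    have "card (I - {r}) < card I"
      using ls r(1) unfolding local_sum_def by (meson card_Diff1_less)
    then obtain X' \<iota> \<pi> K' b' w' where IH: "\<iota> \<in> mor T X' B" "\<pi> \<in> mor T B X'"
      "\<pi> \<cdot> (\<iota> \<cdot> (j \<cdot> f)) = j \<cdot> f" "tri T K' X' Y b' (\<iota> \<cdot> (j \<cdot> f)) w'" "b' \<in> rad K' X'" "B \<in> C \<longrightarrow> X' \<in> C"
      using less.hyps[OF _ local_sum_remove[OF ls r(1) bi] jf] by blast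
    have gb: "g \<cdot> b \<in> mor T (A r) X" using g b by auto
    have gbf: "g \<cdot> b \<cdot> f = zero_mor T (A r) Y"
      using Cmp_assoc[OF g(1) b f] tri_comp_uv[OF t] g(1) by simp
    have gbp: "g \<cdot> b \<cdot> p r = Ident T (A r)"
      using Cmp_assoc[OF g(1) b p] g(2) by simp
    \<comment> \<open>The summand killed by f is embedded by \<open>g \<cdot> b\<close> and not by
      \<open>i r\<close>, so \<open>q \<cdot> j \<cdot> f\<close> may differ from f. The correction
      e fixes f and kills \<open>p r\<close>; thus it factors through B, and f is recovered from
      \<open>j \<cdot> f\<close>.\<close>
    define e where "e = Ident T X \<ominus>\<^bsub>Hom T X X\<^esub> p r \<cdot> (g \<cdot> b)"
    have pgb: "p r \<cdot> (g \<cdot> b) \<in> mor T X X" using p gb by auto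
    have e: "e \<in> mor T X X" unfolding e_def using pgb by auto
    have ef: "e \<cdot> f = f"
      unfolding e_def using minus_Cmp[OF Ident_closed pgb f] Cmp_assoc[OF p gb f] gbf p f by simp
    have ep: "e \<cdot> p r = zero_mor T X (A r)"
      unfolding e_def using minus_Cmp[OF Ident_closed pgb p] Cmp_assoc[OF p gb p] gbp p by simp
    have pi: "p r \<cdot> i r \<in> mor T X X" and qj: "q \<cdot> j \<in> mor T X X" using B by auto
    have "e \<cdot> (p r \<cdot> i r) = zero_mor T X X"
      using Cmp_assoc[OF e p i] ep i by simp
    then have "e \<cdot> (q \<cdot> j) = e"
      using Cmp_add_right[OF e pi qj] B(9) Cmp_closed[OF e qj] Ident_right[OF e] by simp
    then have eqj: "e \<cdot> q \<cdot> j = e" using Cmp_assoc[OF e B(4,2)] by simp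
    have eq: "e \<cdot> q \<in> mor T X B" using e B by auto
    have IH3: "\<pi> \<cdot> (\<iota> \<cdot> j \<cdot> f) = j \<cdot> f" using IH(3) Cmp_assoc[OF IH(1) B(2) f] by simp
    have \<iota>jf: "\<iota> \<cdot> j \<cdot> f \<in> mor T X' Y" using IH(1) B(2) f by auto
    have "e \<cdot> q \<cdot> \<pi> \<cdot> (\<iota> \<cdot> j \<cdot> f) = f"
      using Cmp_assoc[OF eq IH(2) \<iota>jf] IH3 Cmp_assoc[OF eq B(2) f] eqj ef by simp
    moreover have "X \<in> C \<longrightarrow> X' \<in> C"
      using C bi IH(6) unfolding subcategory_def is_direct_sum2_def by blast
    moreover have "\<iota> \<cdot> j \<in> mor T X' X" "e \<cdot> q \<cdot> \<pi> \<in> mor T X X'" using IH B eq by auto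
    moreover have "tri T K' X' Y b' (\<iota> \<cdot> j \<cdot> f) w'"
      using IH(4) Cmp_assoc[OF IH(1) B(2) f] by simp
    ultimately show ?thesis using IH(5) by blast
  qed
qed

text \<open>The new morphism has the same image on all Hom-sets (W, -), so right approximations and
  the defining image of a sink map survive the passage.\<close>

lemma right_minimal_part:
  assumes C: "subcategory T C" and "krull_schmidt T" and f: "f \<in> mor T X Y" and X: "X \<in> C"
  obtains X' f' K b w where "X' \<in> C" "tri T K X' Y b f' w" "b \<in> rad K X'" "f' \<in> mor T X' Y"
    "\<And>W. (\<lambda>h. h \<cdot> f') ` mor T W X' = (\<lambda>h. h \<cdot> f) ` mor T W X"
proof -
  obtain I A i p where "local_sum I A X i p"
    using local_sum_exists[OF assms(2)] by blast
  from right_minimal_part_aux[OF C this f]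
  obtain X' \<iota> \<pi> K b w where *: "\<iota> \<in> mor T X' X" "\<pi> \<in> mor T X X'" "\<pi> \<cdot> (\<iota> \<cdot> f) = f"
    "tri T K X' Y b (\<iota> \<cdot> f) w" "b \<in> rad K X'" "X' \<in> C"
    using X by (elim exE conjE) simp
  have f': "\<iota> \<cdot> f \<in> mor T X' Y" using * f by auto
  have "(\<lambda>h. h \<cdot> (\<iota> \<cdot> f)) ` mor T W X' = (\<lambda>h. h \<cdot> f) ` mor T W X" for W
  proof (intro equalityI subsetI)
    fix h assume "h \<in> (\<lambda>h. h \<cdot> (\<iota> \<cdot> f)) ` mor T W X'"
    then obtain h' where h': "h' \<in> mor T W X'" "h = h' \<cdot> (\<iota> \<cdot> f)" by blast
    then show "h \<in> (\<lambda>h. h \<cdot> f) ` mor T W X"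
      using Cmp_assoc[OF h'(1) *(1) f] by (intro image_eqI[of _ _ "h' \<cdot> \<iota>"] Cmp_closed[OF _ *(1)]) simp_all
  next
    fix h assume "h \<in> (\<lambda>h. h \<cdot> f) ` mor T W X"
    then obtain h' where h': "h' \<in> mor T W X" "h = h' \<cdot> f" by blast
    then show "h \<in> (\<lambda>h. h \<cdot> (\<iota> \<cdot> f)) ` mor T W X'"
      using Cmp_assoc[OF h'(1) *(2) f'] *(3)
      by (intro image_eqI[of _ _ "h' \<cdot> \<pi>"] Cmp_closed[OF _ *(2)]) simp_all
  qed
  then show thesis using that * f' by blast
qed

end

section \<open>Serre duality as a trace form\<close>

context linear_category
begin

lemma dual_module_zero:
  assumes "\<phi> \<in> carrier (dual_module k (Hom T X Y))"
  shows "\<phi> (zero_mor T X Y) = \<zero>\<^bsub>k\<^esub>"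
proof -
  have c: "\<phi> (zero_mor T X Y) \<in> carrier k"
    using assms unfolding dual_module_def by (auto simp: PiE_def Pi_def)
  have "\<phi> (zero_mor T X Y \<oplus>\<^bsub>Hom T X Y\<^esub> zero_mor T X Y) =
      \<phi> (zero_mor T X Y) \<oplus>\<^bsub>k\<^esub> \<phi> (zero_mor T X Y)"
  proof -
    have "\<forall>x \<in> mor T X Y. \<forall>y \<in> mor T X Y. \<phi> (x \<oplus>\<^bsub>Hom T X Y\<^esub> y) = \<phi> x \<oplus>\<^bsub>k\<^esub> \<phi> y"
      using assms unfolding dual_module_def by simp
    then show ?thesis by blast
  qed
  then show ?thesis
    using c add.l_cancel_one' by (metis Hom.l_zero Hom.zero_closed)
qed

text \<open>The Serre pairing of f and h is a trace form evaluated at the composite of f and h.\<close>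

lemma serre_trace:
  assumes "serre_functor k T S"
  obtains tr where "\<And>X. tr X (zero_mor T X (obj_map S X)) = \<zero>\<^bsub>k\<^esub>"
    "\<And>X Y f. f \<in> mor T X Y \<Longrightarrow> \<forall>g \<in> mor T Y (obj_map S X). tr X (f \<cdot> g) = \<zero>\<^bsub>k\<^esub> \<Longrightarrow> f = zero_mor T X Y"
    "\<And>X Y \<psi>. linear_form k (Hom T Y (obj_map S X)) \<psi> \<Longrightarrow>
      \<exists>f \<in> mor T X Y. \<forall>h \<in> mor T Y (obj_map S X). \<psi> h = tr X (f \<cdot> h)"
    "\<And>X Y f h. f \<in> mor T X Y \<Longrightarrow> h \<in> mor T Y (obj_map S X) \<Longrightarrow> tr X (f \<cdot> h) = tr Y (h \<cdot> mor_map S f)"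
proof -
  obtain \<phi> where \<phi>: "\<forall>X Y. module_isomorphism k (Hom T X Y) (dual_module k (Hom T Y (obj_map S X))) (\<phi> X Y)"
    "\<forall>X Y Y'. \<forall>f \<in> mor T X Y. \<forall>g \<in> mor T Y Y'. \<forall>h \<in> mor T Y' (obj_map S X).
      \<phi> X Y' (f \<cdot> g) h = \<phi> X Y f (g \<cdot> h)"
    "\<forall>X X' Y. \<forall>e \<in> mor T X' X. \<forall>f \<in> mor T X Y. \<forall>h \<in> mor T Y (obj_map S X').
      \<phi> X' Y (e \<cdot> f) h = \<phi> X Y f (h \<cdot> mor_map S e)"
    using assms unfolding serre_functor_def by (elim exE conjE)
  note iso = \<phi>(1)[rule_format] and nat1 = \<phi>(2)[rule_format] and nat2 = \<phi>(3)[rule_format]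
  \<comment> \<open>Naturality in the second argument reduces the whole duality to its value on
    identities.\<close>
  define tr where "tr X = \<phi> X X (Ident T X)" for X
  have bij: "bij_betw (\<phi> X Y) (mor T X Y) (carrier (dual_module k (Hom T Y (obj_map S X))))" for X Y
    using iso unfolding module_isomorphism_def by blast
  have dual: "\<phi> X Y f \<in> carrier (dual_module k (Hom T Y (obj_map S X)))" if "f \<in> mor T X Y" for X Y f
    using bij_betwE[OF bij] that by blast
  have tr: "\<phi> X Y f h = tr X (f \<cdot> h)" if "f \<in> mor T X Y" "h \<in> mor T Y (obj_map S X)" for X Y f h
    using nat1[OF Ident_closed that] that unfolding tr_def by simp
  have tr0: "tr X (zero_mor T X (obj_map S X)) = \<zero>\<^bsub>k\<^esub>" for X
    unfolding tr_def by (rule dual_module_zero[OF dual[OF Ident_closed]])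
  show thesis
  proof (rule that[of tr])
    fix X Y f assume f: "f \<in> mor T X Y" and z: "\<forall>g \<in> mor T Y (obj_map S X). tr X (f \<cdot> g) = \<zero>\<^bsub>k\<^esub>"
    have "\<phi> X Y f = \<phi> X Y (zero_mor T X Y)"
    proof (rule PiE_ext)
      show "\<phi> X Y f \<in> mor T Y (obj_map S X) \<rightarrow>\<^sub>E carrier k"
        "\<phi> X Y (zero_mor T X Y) \<in> mor T Y (obj_map S X) \<rightarrow>\<^sub>E carrier k"
        using dual[OF f] dual[of "zero_mor T X Y" X Y] unfolding dual_module_def by auto
      fix h assume h: "h \<in> mor T Y (obj_map S X)"
      then show "\<phi> X Y f h = \<phi> X Y (zero_mor T X Y) h"
        using tr[OF f h] tr[of "zero_mor T X Y" X Y h] tr0 z by simp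
    qed
    then show "f = zero_mor T X Y"
      using bij_betw_imp_inj_on[OF bij] f by (meson Hom.zero_closed inj_onD)
  next
    fix X Y \<psi> assume "linear_form k (Hom T Y (obj_map S X)) \<psi>"
    then have "restrict \<psi> (mor T Y (obj_map S X)) \<in> carrier (dual_module k (Hom T Y (obj_map S X)))"
      by (rule linear_form_dual[OF _ Hom_module])
    then have "restrict \<psi> (mor T Y (obj_map S X)) \<in> \<phi> X Y ` mor T X Y"
      using bij_betw_imp_surj_on[OF bij] by simp
    then obtain f where f: "f \<in> mor T X Y" "restrict \<psi> (mor T Y (obj_map S X)) = \<phi> X Y f"
      by auto
    have "\<psi> h = tr X (f \<cdot> h)" if "h \<in> mor T Y (obj_map S X)" for h
      using fun_cong[OF f(2), of h] tr[OF f(1) that] that by simp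
    then show "\<exists>f \<in> mor T X Y. \<forall>h \<in> mor T Y (obj_map S X). \<psi> h = tr X (f \<cdot> h)"
      using f(1) by blast
  next
    fix X Y f h assume f: "f \<in> mor T X Y" and h: "h \<in> mor T Y (obj_map S X)"
    show "tr X (f \<cdot> h) = tr Y (h \<cdot> mor_map S f)"
      using nat2[OF f Ident_closed h] tr[OF f h] f unfolding tr_def by simp
  qed (rule tr0)
qed

text \<open>Injectivity of the duality gives non-degeneracy in the first factor only. The cyclic
  rule tr(fh) = tr(h S(f)) and fullness of S carry it over to the second factor.\<close>

lemma serre_nondegenerate:
  assumes S: "serre_functor k T S" and qi: "quasi_inverse k T S S'"
    and h: "h \<in> mor T Y (obj_map S X)" and z: "\<And>f. f \<in> mor T X Y \<Longrightarrow> f \<cdot> h = zero_mor T X (obj_map S X)"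
  shows "h = zero_mor T Y (obj_map S X)"
proof -
  interpret S: fully_faithful_functor k T S using qi by (rule quasi_inverse_fully_faithful)
  obtain tr where tr: "\<And>X. tr X (zero_mor T X (obj_map S X)) = \<zero>\<^bsub>k\<^esub>"
    "\<And>X Y f. f \<in> mor T X Y \<Longrightarrow> \<forall>g \<in> mor T Y (obj_map S X). tr X (f \<cdot> g) = \<zero>\<^bsub>k\<^esub> \<Longrightarrow> f = zero_mor T X Y"
    "\<And>X Y f h. f \<in> mor T X Y \<Longrightarrow> h \<in> mor T Y (obj_map S X) \<Longrightarrow> tr X (f \<cdot> h) = tr Y (h \<cdot> mor_map S f)"
    using serre_trace[OF S] by metis
  show ?thesis
  proof (rule tr(2)[OF h], rule ballI)
    fix g assume "g \<in> mor T (obj_map S X) (obj_map S Y)"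
    then obtain f where f: "f \<in> mor T X Y" "mor_map S f = g" by (rule S.map_surjE)
    then show "tr Y (h \<cdot> g) = \<zero>\<^bsub>k\<^esub>"
      using tr(3)[OF f(1) h] z[OF f(1)] tr(1) by simp
  qed
qed

text \<open>For X with local endomorphism ring, w is the connecting morphism of the Auslander-Reiten
  triangle ending in X.\<close>

lemma serre_radical_morphism:
  assumes ks: "krull_schmidt T" and S: "serre_functor k T S" and qi: "quasi_inverse k T S S'"
  obtains w where "w \<in> mor T X (obj_map S X)"
    "\<And>Y f. f \<in> mor T Y X \<Longrightarrow> f \<cdot> w = zero_mor T Y (obj_map S X) \<longleftrightarrow> f \<in> rad Y X"
    "\<And>Y h. h \<in> mor T (obj_map S X) Y \<Longrightarrow> w \<cdot> h = zero_mor T X Y \<longleftrightarrow> h \<in> rad (obj_map S X) Y"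
proof -
  let ?S = "obj_map S"
  interpret S: fully_faithful_functor k T S using qi by (rule quasi_inverse_fully_faithful)
  obtain tr where tr: "\<And>X. tr X (zero_mor T X (?S X)) = \<zero>\<^bsub>k\<^esub>"
    "\<And>X Y f. f \<in> mor T X Y \<Longrightarrow> \<forall>g \<in> mor T Y (?S X). tr X (f \<cdot> g) = \<zero>\<^bsub>k\<^esub> \<Longrightarrow> f = zero_mor T X Y"
    "\<And>X Y \<psi>. linear_form k (Hom T Y (?S X)) \<psi> \<Longrightarrow>
      \<exists>f \<in> mor T X Y. \<forall>h \<in> mor T Y (?S X). \<psi> h = tr X (f \<cdot> h)"
    "\<And>X Y f h. f \<in> mor T X Y \<Longrightarrow> h \<in> mor T Y (?S X) \<Longrightarrow> tr X (f \<cdot> h) = tr Y (h \<cdot> mor_map S f)"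
    by (rule serre_trace[OF S]) blast
  \<comment> \<open>The form is taken on the endomorphisms of S X rather than of X, because forms on
    (S X, S X) are what morphisms from X to S X represent.\<close>
  obtain \<psi> where \<psi>: "linear_form k (Hom T (?S X) (?S X)) \<psi>"
    "\<And>Y f. f \<in> mor T (?S X) Y \<Longrightarrow> f \<in> rad (?S X) Y \<longleftrightarrow> (\<forall>g \<in> mor T Y (?S X). \<psi> (f \<cdot> g) = \<zero>\<^bsub>k\<^esub>)"
    "\<And>Y f. f \<in> mor T Y (?S X) \<Longrightarrow> f \<in> rad Y (?S X) \<longleftrightarrow> (\<forall>g \<in> mor T (?S X) Y. \<psi> (g \<cdot> f) = \<zero>\<^bsub>k\<^esub>)"
    using radical_form_exists[OF ks, of "?S X"] by metis
  obtain w where w: "w \<in> mor T X (?S X)" "\<And>h. h \<in> mor T (?S X) (?S X) \<Longrightarrow> \<psi> h = tr X (w \<cdot> h)"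
    using tr(3)[OF \<psi>(1)] by blast
  show thesis
  proof (rule that[OF w(1)])
    fix Y f assume f: "f \<in> mor T Y X"
    have fw: "f \<cdot> w \<in> mor T Y (?S X)" using f w by auto
    \<comment> \<open>Cyclicity moves f behind w as S f, so the annihilator condition at X becomes
      radicality of S f, which S reflects.\<close>
    have eq: "tr Y (f \<cdot> w \<cdot> u) = \<psi> (u \<cdot> mor_map S f)" if u: "u \<in> mor T (?S X) (?S Y)" for u
      using Cmp_assoc[OF f w(1) u] tr(4)[OF f, of "w \<cdot> u"] Cmp_assoc[OF w(1) u S.map_mor[OF f]]
        w(2)[OF Cmp_closed[OF u S.map_mor[OF f]]] Cmp_closed[OF w(1) u] by simp
    have "f \<cdot> w = zero_mor T Y (?S X) \<longleftrightarrow> (\<forall>u \<in> mor T (?S X) (?S Y). tr Y (f \<cdot> w \<cdot> u) = \<zero>\<^bsub>k\<^esub>)"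
      using tr(1)[of Y] tr(2)[OF fw] by auto
    also have "\<dots> \<longleftrightarrow> mor_map S f \<in> rad (?S Y) (?S X)"
      using \<psi>(3)[OF S.map_mor[OF f]] eq by simp
    finally show "f \<cdot> w = zero_mor T Y (?S X) \<longleftrightarrow> f \<in> rad Y X"
      using S.map_rad_iff[OF f] by simp
  next
    fix Y h assume h: "h \<in> mor T (?S X) Y"
    have wh: "w \<cdot> h \<in> mor T X Y" using h w by auto
    have eq: "tr X (w \<cdot> h \<cdot> g) = \<psi> (h \<cdot> g)" if g: "g \<in> mor T Y (?S X)" for g
      using Cmp_assoc[OF w(1) h g] w(2)[OF Cmp_closed[OF h g]] by simp
    have "w \<cdot> h = zero_mor T X Y \<longleftrightarrow> (\<forall>g \<in> mor T Y (?S X). tr X (w \<cdot> h \<cdot> g) = \<zero>\<^bsub>k\<^esub>)"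
      using tr(1)[of X] tr(2)[OF wh] by auto
    then show "w \<cdot> h = zero_mor T X Y \<longleftrightarrow> h \<in> rad (?S X) Y"
      using \<psi>(2)[OF h] eq by simp
  qed
qed

end

section \<open>Cluster tilting subcategories\<close>

context linear_category
begin

abbreviation "orthogonal X Y \<equiv> mor T X Y = {zero_mor T X Y}"

lemma orthogonalI: "(\<And>f. f \<in> mor T X Y \<Longrightarrow> f = zero_mor T X Y) \<Longrightarrow> orthogonal X Y"
  by auto

lemma orthogonalD: "orthogonal X Y \<Longrightarrow> f \<in> mor T X Y \<Longrightarrow> f = zero_mor T X Y"
  by simp

lemma serre_orthogonal_iff:
  assumes S: "serre_functor k T S" and qi: "quasi_inverse k T S S'"
  shows "orthogonal Y (obj_map S X) \<longleftrightarrow> orthogonal X Y"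
proof
  assume o: "orthogonal X Y"
  show "orthogonal Y (obj_map S X)"
  proof (rule orthogonalI, rule serre_nondegenerate[OF S qi])
    fix h f assume "h \<in> mor T Y (obj_map S X)" and f: "f \<in> mor T X Y"
    then show "f \<cdot> h = zero_mor T X (obj_map S X)"
      using orthogonalD[OF o f] by simp
  qed
next
  assume o: "orthogonal Y (obj_map S X)"
  obtain tr where tr: "\<And>X. tr X (zero_mor T X (obj_map S X)) = \<zero>\<^bsub>k\<^esub>"
    "\<And>X Y f. f \<in> mor T X Y \<Longrightarrow> \<forall>g \<in> mor T Y (obj_map S X). tr X (f \<cdot> g) = \<zero>\<^bsub>k\<^esub> \<Longrightarrow> f = zero_mor T X Y"
    by (rule serre_trace[OF S]) blast
  show "orthogonal X Y"
  proof (rule orthogonalI, rule tr(2))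
    fix f assume "f \<in> mor T X Y"
    then show "\<forall>g \<in> mor T Y (obj_map S X). tr X (f \<cdot> g) = \<zero>\<^bsub>k\<^esub>"
      using o tr(1) by simp
  qed
qed

lemma orthogonal_iso:
  assumes "is_iso T Y Z e" "orthogonal X Y"
  shows "orthogonal X Z"
proof (rule orthogonalI)
  fix f assume f: "f \<in> mor T X Z"
  obtain e' where e: "e \<in> mor T Y Z" "e' \<in> mor T Z Y" "e' \<cdot> e = Ident T Z"
    using assms(1) by (rule is_isoE)
  have "f \<cdot> e' = zero_mor T X Y"
    using orthogonalD[OF assms(2)] f e by blast
  then show "f = zero_mor T X Z"
    using Cmp_assoc[OF f e(2,1)] e f by simp
qed

lemma is_iso_if_composites_iso:
  assumes v: "v \<in> mor T X Y" and u: "u \<in> mor T Y X"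
    and "is_iso T X X (v \<cdot> u)" "is_iso T Y Y (u \<cdot> v)"
  shows "is_iso T X Y v"
proof -
  obtain c where c: "c \<in> mor T X X" "v \<cdot> u \<cdot> c = Ident T X"
    using assms(3) by (rule is_isoE)
  obtain c' where c': "c' \<in> mor T Y Y" "c' \<cdot> (u \<cdot> v) = Ident T Y"
    using assms(4) by (rule is_isoE)
  have uc: "u \<cdot> c \<in> mor T Y X" "c' \<cdot> u \<in> mor T Y X" using u c(1) c'(1) by auto
  have r: "v \<cdot> (u \<cdot> c) = Ident T X" using c Cmp_assoc[OF v u c(1)] by simp
  have l: "c' \<cdot> u \<cdot> v = Ident T Y" using c' Cmp_assoc[OF c'(1) u v] by simp
  have "c' \<cdot> u = u \<cdot> c"
    using Cmp_assoc[OF uc(2) v uc(1)] r l uc by simp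
  then show ?thesis using v uc(1) r l by (intro is_isoI[of _ _ _ "u \<cdot> c"]) auto
qed

end

section \<open>Iterated shifts and orthogonality\<close>

context triangulated_category
begin

abbreviation sho where "sho j X \<equiv> (sh_obj T ^^ j) X"
abbreviation shm where "shm j f \<equiv> (sh_mor T ^^ j) f"

lemma shift_obj_nonneg [simp]: "shift_obj T (int i) X = sho i X"
  by (simp add: shift_obj_def)

lemma shift_obj_neg [simp]: "sho i (shift_obj T (- int i) X) = X"
proof -
  have "sho i ((inv_into UNIV (sh_obj T) ^^ i) X) = X"
    using fn_o_inv_fn_is_id[OF bij_sh_obj, of i] by (metis comp_apply)
  then show ?thesis by (auto simp: shift_obj_def)
qed

lemma shift_obj_neg_sho [simp]: "shift_obj T (- int i) (sho i X) = X"
proof -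
  have "(inv_into UNIV (sh_obj T) ^^ i) (sho i X) = X"
    using inv_fn_o_fn_is_id[OF bij_sh_obj, of i] by (metis comp_apply)
  then show ?thesis by (auto simp: shift_obj_def)
qed

lemma sho_surjE: obtains Y where "X = sho i Y"
  using shift_obj_neg[of i X] by metis

lemma orthogonal_sho: "orthogonal (sho i X) (sho i Y) \<longleftrightarrow> orthogonal X Y"
proof
  assume o: "orthogonal (sho i X) (sho i Y)"
  show "orthogonal X Y"
    using orthogonalD[OF o] shp.map_eq_zero_iff by (blast intro: orthogonalI)
next
  assume o: "orthogonal X Y"
  show "orthogonal (sho i X) (sho i Y)"
  proof (rule orthogonalI)
    fix f assume "f \<in> mor T (sho i X) (sho i Y)"
    then obtain g where g: "g \<in> mor T X Y" "shm i g = f" by (rule shp.map_surjE)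
    then show "f = zero_mor T (sho i X) (sho i Y)" using orthogonalD[OF o g(1)] by auto
  qed
qed

lemma orthogonal_sh: "orthogonal (sh_obj T X) (sh_obj T Y) \<longleftrightarrow> orthogonal X Y"
  using orthogonal_sho[of 1] by simp

end

section \<open>The cluster tilting subcategory under Serre duality\<close>

locale serre_cluster_tilting = triangulated_category k T
  for k :: "('k, 'r) ring_scheme" and T :: "('o, 'm, 'k, 'z) tri_cat_scheme" +
  fixes S S_inv :: "('o, 'm) endofunctor" and n :: nat and C :: "'o set"
  assumes krull_schmidt: "krull_schmidt T"
    and serre: "serre_functor k T S"
    and S_inv: "quasi_inverse k T S S_inv"
    and n: "n \<ge> 1"
    and cluster_tilting: "n_cluster_tilting T n C"
begin

lemma subcategory_C: "subcategory T C"
  using cluster_tilting unfolding n_cluster_tilting_def by blast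

text \<open>Applying [i] moves the negative shift of the definition to the second argument, so that
  only non-negative shifts remain.\<close>

lemma in_C_iff_right: "X \<in> C \<longleftrightarrow> (\<forall>i. 1 \<le> i \<and> i < n \<longrightarrow> (\<forall>A \<in> C. orthogonal A (sho i X)))"
proof -
  have "C = (\<Inter>i\<in>{1..<n}. right_perp T (shift_obj T (- int i) ` C))"
    using cluster_tilting unfolding n_cluster_tilting_def by blast
  then have "X \<in> C \<longleftrightarrow> X \<in> (\<Inter>i\<in>{1..<n}. right_perp T (shift_obj T (- int i) ` C))"
    by simp
  also have "\<dots> \<longleftrightarrow> (\<forall>i\<in>{1..<n}. \<forall>A \<in> C. orthogonal (shift_obj T (- int i) A) X)"
    unfolding right_perp_def by simp
  also have "\<dots> \<longleftrightarrow> (\<forall>i\<in>{1..<n}. \<forall>A \<in> C. orthogonal A (sho i X))"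
    using orthogonal_sho[of _ "shift_obj T (- int _) _" X] by (metis shift_obj_neg)
  finally show ?thesis by auto
qed

lemma in_C_iff_left: "X \<in> C \<longleftrightarrow> (\<forall>i. 1 \<le> i \<and> i < n \<longrightarrow> (\<forall>A \<in> C. orthogonal X (sho i A)))"
proof -
  have "C = (\<Inter>i\<in>{1..<n}. left_perp T (shift_obj T (int i) ` C))"
    using cluster_tilting unfolding n_cluster_tilting_def by blast
  then have "X \<in> C \<longleftrightarrow> X \<in> (\<Inter>i\<in>{1..<n}. left_perp T (shift_obj T (int i) ` C))"
    by simp
  also have "\<dots> \<longleftrightarrow> (\<forall>i\<in>{1..<n}. \<forall>A \<in> C. orthogonal X (sho i A))"
    unfolding left_perp_def by simp
  finally show ?thesis by auto
qed

lemma C_orthogonal: "A \<in> C \<Longrightarrow> B \<in> C \<Longrightarrow> 1 \<le> i \<Longrightarrow> i < n \<Longrightarrow> orthogonal A (sho i B)"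
  using in_C_iff_left by blast

text \<open>Vanishing of (A, (S_n X)[i]) is equivalent by Serre duality to that of (X, A[n-i]), and
  i -> n-i permutes the range 1, ..., n-1.\<close>

lemma serre_n_in_C:
  assumes X: "X \<in> C"
  shows "serre_n T S n X \<in> C"
  unfolding in_C_iff_right
proof (intro allI impI ballI)
  fix i A assume i: "1 \<le> i \<and> i < n" and A: "A \<in> C"
  obtain A' where A': "A = sho i A'" by (rule sho_surjE)
  let ?X = "shift_obj T (- int n) X"
  have "sho n A' = sho (n - i) A"
    unfolding A' using i funpow_add[of "n - i" i "sh_obj T"] by simp
  then have "orthogonal (sho n ?X) (sho n A')"
    using C_orthogonal[OF X A, of "n - i"] i by force
  then have "orthogonal A' (serre_n T S n X)"
    unfolding serre_n_def serre_orthogonal_iff[OF serre S_inv] by (rule orthogonal_sho[THEN iffD1])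
  then show "orthogonal A (sho i (serre_n T S n X))"
    unfolding A' by (rule orthogonal_sho[THEN iffD2])
qed

text \<open>As for \<open>S_n\<close>: vanishing of (S_n^-1 Y, A[i]) is equivalent to that of (A,
  Y[n-i]).\<close>

lemma serre_n_inv_in_C:
  assumes Y: "Y \<in> C"
  shows "serre_n_inv T S_inv n Y \<in> C"
  unfolding in_C_iff_left serre_n_inv_def shift_obj_nonneg
proof (intro allI impI ballI)
  fix i A assume i: "1 \<le> i \<and> i < n" and A: "A \<in> C"
  obtain A' where A': "A = sho (n - i) A'" by (rule sho_surjE)
  have "sho i A = sho n A'"
    unfolding A' using i funpow_add[of i "n - i" "sh_obj T"] by simp
  moreover have "orthogonal (sho (n - i) A') (sho (n - i) Y)"
    using C_orthogonal[OF A Y, of "n - i"] i A' by force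
  then have "orthogonal A' Y"
    by (rule orthogonal_sho[THEN iffD1])
  then have "orthogonal A' (obj_map S (obj_map S_inv Y))"
    using quasi_inverse_iso[OF quasi_inverse_sym[OF S_inv], of Y] is_isoE orthogonal_iso by metis
  then have "orthogonal (obj_map S_inv Y) A'"
    by (rule serre_orthogonal_iff[OF serre S_inv, THEN iffD1])
  ultimately show "orthogonal (sho n (obj_map S_inv Y)) (sho i A)"
    using orthogonal_sho by simp
qed

text \<open>A single test object suffices, namely S_n^-1 Z. Shifted back by n, the target is Z,
  isomorphic to the Serre dual of \<open>obj_map S_inv Z\<close>, and morphisms from that object
  detect zero. E is arbitrary, so this reaches beyond C.\<close>

lemma zero_if_C_annihilated:
  assumes Z: "Z \<in> C" and h: "h \<in> mor T E (sho n Z)"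
    and ann: "\<And>A f. A \<in> C \<Longrightarrow> f \<in> mor T A E \<Longrightarrow> f \<cdot> h = zero_mor T A (sho n Z)"
  shows "h = zero_mor T E (sho n Z)"
proof -
  obtain E' where E': "E = sho n E'" by (rule sho_surjE)
  obtain h' where h': "h' \<in> mor T E' Z" "shm n h' = h"
    using h unfolding E' by (rule shp.map_surjE)
  obtain \<eta> where \<eta>: "is_iso T (obj_map S (obj_map S_inv Z)) Z \<eta>"
    using quasi_inverse_iso[OF quasi_inverse_sym[OF S_inv]] by blast
  obtain \<epsilon> where \<epsilon>: "\<eta> \<in> mor T (obj_map S (obj_map S_inv Z)) Z"
    "\<epsilon> \<in> mor T Z (obj_map S (obj_map S_inv Z))" "\<epsilon> \<cdot> \<eta> = Ident T Z"
    using \<eta> by (rule is_isoE)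
  have he: "h' \<cdot> \<epsilon> \<in> mor T E' (obj_map S (obj_map S_inv Z))" using h' \<epsilon> by auto
  have "h' \<cdot> \<epsilon> = zero_mor T E' (obj_map S (obj_map S_inv Z))"
  proof (rule serre_nondegenerate[OF serre S_inv he])
    fix f assume f: "f \<in> mor T (obj_map S_inv Z) E'"
    have "shm n (f \<cdot> h') = zero_mor T (sho n (obj_map S_inv Z)) (sho n Z)"
      using ann[of "sho n (obj_map S_inv Z)" "shm n f"] serre_n_inv_in_C[OF Z] shp.map_mor[OF f]
        shp.map_Cmp[OF f h'(1)] E' h'(2) unfolding serre_n_inv_def by simp
    then have "f \<cdot> h' = zero_mor T (obj_map S_inv Z) Z"
      using shp.map_eq_zero_iff[OF Cmp_closed[OF f h'(1)]] by simp
    then show "f \<cdot> (h' \<cdot> \<epsilon>) = zero_mor T (obj_map S_inv Z) (obj_map S (obj_map S_inv Z))"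
      using Cmp_assoc[OF f h'(1) \<epsilon>(2)] \<epsilon>(2) by simp
  qed
  then have "h' = zero_mor T E' Z"
    using Cmp_assoc[OF h'(1) \<epsilon>(2,1)] \<epsilon> h'(1) by simp
  then show ?thesis using h'(2) E' by auto
qed

text \<open>The radical morphism of X[-n], shifted by n; both annihilators transfer because the
  shift preserves and reflects zero and the radical.\<close>

lemma radical_morphism:
  obtains w where "w \<in> mor T X (sho n (serre_n T S n X))"
    "\<And>E f. f \<in> mor T E X \<Longrightarrow> f \<cdot> w = zero_mor T E (sho n (serre_n T S n X)) \<longleftrightarrow> f \<in> rad E X"
    "\<And>B h. h \<in> mor T (serre_n T S n X) B \<Longrightarrow>
      w \<cdot> shm n h = zero_mor T X (sho n B) \<longleftrightarrow> h \<in> rad (serre_n T S n X) B"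
proof -
  let ?X = "shift_obj T (- int n) X" and ?Q = "serre_n T S n X"
  obtain w where w: "w \<in> mor T ?X ?Q"
    "\<And>Y f. f \<in> mor T Y ?X \<Longrightarrow> f \<cdot> w = zero_mor T Y ?Q \<longleftrightarrow> f \<in> rad Y ?X"
    "\<And>Y h. h \<in> mor T ?Q Y \<Longrightarrow> w \<cdot> h = zero_mor T ?X Y \<longleftrightarrow> h \<in> rad ?Q Y"
    unfolding serre_n_def by (rule serre_radical_morphism[OF krull_schmidt serre S_inv]) blast
  show thesis
  proof (rule that[of "shm n w"])
    show "shm n w \<in> mor T X (sho n ?Q)"
      using shp.map_mor[OF w(1), of n] by simp
  next
    fix E f assume f: "f \<in> mor T E X"
    obtain E' where E': "E = sho n E'" by (rule sho_surjE)
    have "f \<in> mor T (sho n E') (sho n ?X)" using f E' by simp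
    then obtain f' where f': "f' \<in> mor T E' ?X" "shm n f' = f" by (rule shp.map_surjE)
    have "f \<cdot> shm n w = zero_mor T E (sho n ?Q) \<longleftrightarrow> f' \<cdot> w = zero_mor T E' ?Q"
      using shp.map_Cmp[OF f'(1) w(1), of n] shp.map_eq_zero_iff[OF Cmp_closed[OF f'(1) w(1)], of n]
        f'(2) E' by simp
    then show "f \<cdot> shm n w = zero_mor T E (sho n ?Q) \<longleftrightarrow> f \<in> rad E X"
      using w(2)[OF f'(1)] shp.map_rad_iff[OF f'(1), of n] f'(2) E' by simp
  next
    fix B h assume h: "h \<in> mor T ?Q B"
    show "shm n w \<cdot> shm n h = zero_mor T X (sho n B) \<longleftrightarrow> h \<in> rad ?Q B"
      using shp.map_Cmp[OF w(1) h, of n] shp.map_eq_zero_iff[OF Cmp_closed[OF w(1) h], of n]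
        w(3)[OF h] by simp
  qed
qed

lemma minimal_right_approximation_exists:
  "\<exists>C' a K b d. tri T K C' Z b a d \<and> C' \<in> C \<and> b \<in> rad K C' \<and> right_approximation T C C' Z a"
proof -
  obtain C0 f where f: "right_approximation T C C0 Z f"
    using cluster_tilting unfolding n_cluster_tilting_def functorially_finite_def by blast
  then have f': "f \<in> mor T C0 Z" "C0 \<in> C" unfolding right_approximation_def by auto
  obtain C' a K b d where *: "C' \<in> C" "tri T K C' Z b a d" "b \<in> rad K C'" "a \<in> mor T C' Z"
    "\<And>W. (\<lambda>h. h \<cdot> a) ` mor T W C' = (\<lambda>h. h \<cdot> f) ` mor T W C0"
    by (rule right_minimal_part[OF subcategory_C krull_schmidt f']) (rule that)
  then have "right_approximation T C C' Z a"
    using f unfolding right_approximation_def by simp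
  with * show ?thesis by blast
qed

text \<open>A morphism into X is radical iff w kills it, that is, iff it factors through the cocone
  of w; from an object of C it then factors through the approximation of the cocone.\<close>

lemma sink_exists:
  "\<exists>C' a K b d. tri T K C' X b a d \<and> C' \<in> C \<and> b \<in> rad K C' \<and>
    (\<forall>W \<in> C. (\<lambda>h. h \<cdot> a) ` mor T W C' = rad W X)"
proof -
  let ?Q = "sho n (serre_n T S n X)"
  obtain w where w: "w \<in> mor T X ?Q"
    "\<And>E f. f \<in> mor T E X \<Longrightarrow> f \<cdot> w = zero_mor T E ?Q \<longleftrightarrow> f \<in> rad E X"
    by (rule radical_morphism) blast
  obtain E \<theta> z where t: "tri T E X ?Q \<theta> w z"
    using cocone_exists[OF w(1)] by blast
  have \<theta>: "\<theta> \<in> mor T E X" using tri_typed[OF t] by simp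
  obtain C0 \<alpha> where \<alpha>: "right_approximation T C C0 E \<alpha>"
    using cluster_tilting unfolding n_cluster_tilting_def functorially_finite_def by blast
  then have \<alpha>': "\<alpha> \<in> mor T C0 E" "C0 \<in> C" unfolding right_approximation_def by auto
  have \<alpha>\<theta>: "\<alpha> \<cdot> \<theta> \<in> mor T C0 X" using \<alpha>' \<theta> by auto
  obtain C' a K b d where *: "C' \<in> C" "tri T K C' X b a d" "b \<in> rad K C'" "a \<in> mor T C' X"
    "\<And>W. (\<lambda>h. h \<cdot> a) ` mor T W C' = (\<lambda>h. h \<cdot> (\<alpha> \<cdot> \<theta>)) ` mor T W C0"
    by (rule right_minimal_part[OF subcategory_C krull_schmidt \<alpha>\<theta> \<alpha>'(2)]) (rule that)
  have "\<theta> \<in> rad E X"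
    using w(2)[OF \<theta>] tri_comp_uv[OF t] by simp
  then have "\<alpha> \<cdot> \<theta> \<in> rad C0 X"
    by (rule Cmp_rad[OF \<alpha>'(1)])
  then have sub: "(\<lambda>h. h \<cdot> (\<alpha> \<cdot> \<theta>)) ` mor T W C0 \<subseteq> rad W X" for W
    using Cmp_rad by blast
  have sup: "rad W X \<subseteq> (\<lambda>h. h \<cdot> (\<alpha> \<cdot> \<theta>)) ` mor T W C0" if W: "W \<in> C" for W
  proof
    fix f assume f: "f \<in> rad W X"
    have fm: "f \<in> mor T W X" "f \<cdot> w = zero_mor T W ?Q"
      using rad_mor[OF f] w(2) f by auto
    obtain g where g: "g \<in> mor T W E" "f = g \<cdot> \<theta>"
      using tri_weak_kernel_v[OF t fm] by blast
    have "g \<in> (\<lambda>h. h \<cdot> \<alpha>) ` mor T W C0"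
      using \<alpha> W g(1) unfolding right_approximation_def by simp
    then obtain h where h: "h \<in> mor T W C0" "g = h \<cdot> \<alpha>" by blast
    then show "f \<in> (\<lambda>h. h \<cdot> (\<alpha> \<cdot> \<theta>)) ` mor T W C0"
      using g Cmp_assoc[OF h(1) \<alpha>'(1) \<theta>] by (intro image_eqI[of _ _ h]) simp_all
  qed
  have "\<forall>W \<in> C. (\<lambda>h. h \<cdot> a) ` mor T W C' = rad W X"
    unfolding *(5) using subset_antisym[OF sub sup] by simp
  with * show ?thesis by blast
qed

end

section \<open>Resolving the sink map\<close>

text \<open>The resolution is continued indefinitely to avoid a case distinction at its end; only its first
  n triangles matter.\<close>

locale sink_resolution = serre_cluster_tilting k T S S_inv n C
  for k :: "('k, 'r) ring_scheme" and T :: "('o, 'm, 'k, 'z) tri_cat_scheme"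
    and S S_inv :: "('o, 'm) endofunctor" and n :: nat and C :: "'o set" +
  fixes Xs Cs :: "nat \<Rightarrow> 'o" and a b d :: "nat \<Rightarrow> 'm"
  assumes X_in_C: "Xs 0 \<in> C"
    and triangle: "tri T (Xs (Suc j)) (Cs j) (Xs j) (b (Suc j)) (a j) (d j)"
    and Cs_in_C: "Cs j \<in> C"
    and b_rad: "b (Suc j) \<in> rad (Xs (Suc j)) (Cs j)"
    and approximation: "j \<ge> 1 \<Longrightarrow> right_approximation T C (Cs j) (Xs j) (a j)"
    and sink: "W \<in> C \<Longrightarrow> (\<lambda>h. h \<cdot> a 0) ` mor T W (Cs 0) = rad W (Xs 0)"
begin

section \<open>Vanishing and approximation properties along the resolution\<close>

lemma a_mor: "a j \<in> mor T (Cs j) (Xs j)"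
  and b_mor: "b (Suc j) \<in> mor T (Xs (Suc j)) (Cs j)"
  and d_mor: "d j \<in> mor T (Xs j) (sh_obj T (Xs (Suc j)))"
  using tri_typed[OF triangle] by auto

lemma a0_rad: "a 0 \<in> rad (Cs 0) (Xs 0)"
proof -
  have "Ident T (Cs 0) \<cdot> a 0 \<in> rad (Cs 0) (Xs 0)"
    unfolding sink[OF Cs_in_C, symmetric] by blast
  then show ?thesis using Ident_left[OF a_mor] by simp
qed

text \<open>Dimension shifting: (A, X_(j+1)[i]) lies between (A, X_j[i-1]) and (A, C_j[i]). For i =
  1 the first group contributes nothing because \<open>a j\<close> is a right approximation. This
  fails for the sink map \<open>a 0\<close>, whence the bound i < j.\<close>

lemma right_orthogonal:
  "A \<in> C \<Longrightarrow> 1 \<le> i \<Longrightarrow> i < j \<Longrightarrow> i < n \<Longrightarrow> orthogonal A (sho i (Xs j))"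
proof (induction j arbitrary: i)
  case (Suc j)
  then obtain i' where i': "i = Suc i'" by (cases i) auto
  \<comment> \<open>Undoing i - 1 shifts on A lets the triangle itself be used instead of a shifted
    one.\<close>
  obtain A0 where A0: "A = sho i' A0" by (rule sho_surjE)
  have "orthogonal (sho i' A0) (sho i' (sh_obj T (Cs j)))"
    using C_orthogonal[OF \<open>A \<in> C\<close> Cs_in_C Suc.prems(2,4), of j] A0 i' by (simp add: funpow_swap1)
  then have oC: "orthogonal A0 (sh_obj T (Cs j))"
    by (rule orthogonal_sho[THEN iffD1])
  have "orthogonal A0 (sh_obj T (Xs (Suc j)))"
  proof (rule orthogonalI)
    fix f assume f: "f \<in> mor T A0 (sh_obj T (Xs (Suc j)))"
    have "f \<cdot> sh_mor T (b (Suc j)) = zero_mor T A0 (sh_obj T (Cs j))"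
      by (rule orthogonalD[OF oC Cmp_closed[OF f sh.map_mor[OF b_mor]]])
    then obtain g where g: "g \<in> mor T A0 (Xs j)" "f = g \<cdot> d j"
      using tri_weak_kernel_u[OF triangle f] by blast
    show "f = zero_mor T A0 (sh_obj T (Xs (Suc j)))"
    proof (cases "i' = 0")
      case True
      then have "A0 \<in> C" using A0 \<open>A \<in> C\<close> by simp
      moreover have "j \<ge> 1" using Suc.prems i' True by simp
      ultimately have "g \<in> (\<lambda>h. h \<cdot> a j) ` mor T A0 (Cs j)"
        using approximation[of j] g(1) unfolding right_approximation_def by simp
      then obtain h where h: "h \<in> mor T A0 (Cs j)" "g = h \<cdot> a j" by blast
      then show ?thesis
        using g(2) Cmp_assoc[OF h(1) a_mor d_mor] tri_comp_vw[OF triangle, of j] by simp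
    next
      case False
      then have "orthogonal (sho i' A0) (sho i' (Xs j))"
        using Suc.IH[of i'] Suc.prems A0 i' by simp
      then have "orthogonal A0 (Xs j)"
        by (rule orthogonal_sho[THEN iffD1])
      then show ?thesis
        using orthogonalD[of A0 "Xs j" g] g d_mor by simp
    qed
  qed
  then have "orthogonal (sho i' A0) (sho i' (sh_obj T (Xs (Suc j))))"
    by (rule orthogonal_sho[THEN iffD2])
  then show ?case using A0 i' by (simp add: funpow_swap1)
qed simp

text \<open>(X_(j+1), A[i]) lies between (C_j, A[i]) and (X_j, A[i+1]): each step down to X_0 raises
  i by one, so i + j has to stay below n.\<close>

lemma left_orthogonal:
  "A \<in> C \<Longrightarrow> 1 \<le> i \<Longrightarrow> i + j < n \<Longrightarrow> orthogonal (Xs j) (sho i A)"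
proof (induction j arbitrary: i)
  case 0
  then show ?case using C_orthogonal[OF X_in_C] by simp
next
  case (Suc j)
  show ?case
  proof (rule orthogonalI)
    fix f assume f: "f \<in> mor T (Xs (Suc j)) (sho i A)"
    have sf: "sh_mor T f \<in> mor T (sh_obj T (Xs (Suc j))) (sho (Suc i) A)"
      using sh.map_mor[OF f] by simp
    have "orthogonal (Xs j) (sho (Suc i) A)"
      using Suc.IH[of "Suc i"] Suc.prems by simp
    then have "d j \<cdot> sh_mor T f = zero_mor T (Xs j) (sho (Suc i) A)"
      by (rule orthogonalD[OF _ Cmp_closed[OF d_mor sf]])
    then obtain g where g: "g \<in> mor T (sh_obj T (Cs j)) (sho (Suc i) A)"
      "sh_mor T f = sh_mor T (b (Suc j)) \<cdot> g"
      using tri_weak_cokernel_w[OF triangle sf] by blast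
    have "orthogonal (sh_obj T (Cs j)) (sh_obj T (sho i A))"
      unfolding orthogonal_sh using C_orthogonal[OF Cs_in_C Suc.prems(1,2)] Suc.prems(3) by simp
    then have "g = zero_mor T (sh_obj T (Cs j)) (sho (Suc i) A)"
      using orthogonalD[of _ _ g] g(1) by simp
    then have "sh_mor T f = zero_mor T (sh_obj T (Xs (Suc j))) (sh_obj T (sho i A))"
      using g(2) sh.map_mor[OF b_mor] by simp
    then show "f = zero_mor T (Xs (Suc j)) (sho i A)"
      using sh.map_eq_zero_iff[OF f] by simp
  qed
qed

text \<open>The obstruction to extending f over \<open>b (Suc j)\<close> lies in (X_j, W[1]), which
  vanishes as long as 1 + j < n. The last morphism \<open>b n\<close> is out of reach of this
  argument.\<close>

lemma left_approximation_b:
  assumes "Suc j < n"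
  shows "left_approximation T C (Xs (Suc j)) (Cs j) (b (Suc j))"
  unfolding left_approximation_def
proof (intro conjI ballI Cs_in_C b_mor equalityI subsetI)
  fix W f assume W: "W \<in> C" and f: "f \<in> mor T (Xs (Suc j)) W"
  have sf: "sh_mor T f \<in> mor T (sh_obj T (Xs (Suc j))) (sh_obj T W)"
    using sh.map_mor[OF f] by simp
  have "orthogonal (Xs j) (sh_obj T W)"
    using left_orthogonal[OF W, of 1 j] assms by simp
  then have "d j \<cdot> sh_mor T f = zero_mor T (Xs j) (sh_obj T W)"
    by (rule orthogonalD[OF _ Cmp_closed[OF d_mor sf]])
  then obtain g where g: "g \<in> mor T (sh_obj T (Cs j)) (sh_obj T W)"
    "sh_mor T f = sh_mor T (b (Suc j)) \<cdot> g"
    using tri_weak_cokernel_w[OF triangle sf] by blast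
  obtain g' where g': "g' \<in> mor T (Cs j) W" "sh_mor T g' = g"
    using g(1) by (rule sh.map_surjE)
  have "f = b (Suc j) \<cdot> g'"
    using sh.map_eq_iff[OF f Cmp_closed[OF b_mor g'(1)]] sh.map_Cmp[OF b_mor g'(1)] g g' by simp
  then show "f \<in> (\<lambda>h. b (Suc j) \<cdot> h) ` mor T (Cs j) W"
    using g'(1) by simp
qed (use b_mor in blast)

text \<open>For j > 0 every morphism from X_j back to C_j factors through the left approximation
  \<open>b j\<close>, which is radical.\<close>

lemma a_rad:
  assumes "j < n"
  shows "a j \<in> rad (Cs j) (Xs j)"
proof (cases j)
  case 0
  then show ?thesis using a0_rad by simp
next
  case (Suc i)
  have "is_iso T (Cs j) (Cs j) (Ident T (Cs j) \<ominus>\<^bsub>Hom T (Cs j) (Cs j)\<^esub> a j \<cdot> g)"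
    if g: "g \<in> mor T (Xs j) (Cs j)" for g
  proof -
    have "g \<in> (\<lambda>h. b (Suc i) \<cdot> h) ` mor T (Cs i) (Cs j)"
      using left_approximation_b[of i] assms Suc Cs_in_C[of j] g unfolding left_approximation_def by simp
    then obtain h where h: "h \<in> mor T (Cs i) (Cs j)" "g = b (Suc i) \<cdot> h" by blast
    have "b (Suc i) \<cdot> h \<in> rad (Xs j) (Cs j)"
      using rad_Cmp[OF b_rad h(1)] Suc by simp
    then have "a j \<cdot> g \<in> rad (Cs j) (Cs j)"
      using Cmp_rad[OF a_mor] h(2) by simp
    from rad_iso[OF this Ident_closed] show ?thesis
      using Ident_right[OF Cmp_closed[OF a_mor g]] by simp
  qed
  then show ?thesis
    unfolding jacobson_radical_def using a_mor by blast
qed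

lemma Xn_in_C: "Xs n \<in> C"
  unfolding in_C_iff_right using right_orthogonal by simp

text \<open>\<open>connecting m\<close> is the composite \<open>X_(n-m) \<rightarrow> X_(n-m+1)[1] \<rightarrow> \<dots> \<rightarrow> X_n[m]\<close>.\<close>

primrec connecting :: "nat \<Rightarrow> 'm" where
  "connecting 0 = Ident T (Xs n)"
| "connecting (Suc m) = d (n - Suc m) \<cdot> sh_mor T (connecting m)"

lemma connecting_mor: "m \<le> n \<Longrightarrow> connecting m \<in> mor T (Xs (n - m)) (sho m (Xs n))"
proof (induction m)
  case (Suc m)
  then have "connecting m \<in> mor T (Xs (Suc (n - Suc m))) (sho m (Xs n))"
    by (simp add: Suc_diff_Suc)
  from Cmp_closed[OF d_mor sh.map_mor[OF this]] show ?case by simp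
qed simp

lemma connecting_Suc_Cmp:
  assumes "Suc m \<le> n" and v: "v \<in> mor T (Xs n) W"
  shows "connecting (Suc m) \<cdot> shm (Suc m) v = d (n - Suc m) \<cdot> sh_mor T (connecting m \<cdot> shm m v)"
    and "connecting m \<cdot> shm m v \<in> mor T (Xs (Suc (n - Suc m))) (sho m W)"
proof -
  have eq: "n - m = Suc (n - Suc m)" using assms(1) by simp
  have c: "connecting m \<in> mor T (Xs (Suc (n - Suc m))) (sho m (Xs n))"
    using connecting_mor[of m] assms(1) eq by simp
  have v': "shm m v \<in> mor T (sho m (Xs n)) (sho m W)" by (rule shp.map_mor[OF v])
  show "connecting (Suc m) \<cdot> shm (Suc m) v = d (n - Suc m) \<cdot> sh_mor T (connecting m \<cdot> shm m v)"
    using Cmp_assoc[OF d_mor sh.map_mor[OF c] sh.map_mor[OF v']] sh.map_Cmp[OF c v'] by simp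
  show "connecting m \<cdot> shm m v \<in> mor T (Xs (Suc (n - Suc m))) (sho m W)"
    using c v' by (rule Cmp_closed)
qed

text \<open>At each stage p has to kill \<open>a j\<close> to factor through \<open>d j\<close>. For
  m < n this is automatic because (C_j, W[m]) = 0; only for m = n is it a hypothesis.\<close>

lemma factor_connecting:
  assumes W: "W \<in> C"
  shows "m \<le> n \<Longrightarrow> p \<in> mor T (Xs (n - m)) (sho m W) \<Longrightarrow>
    (m = n \<Longrightarrow> a 0 \<cdot> p = zero_mor T (Cs 0) (sho n W)) \<Longrightarrow>
    \<exists>v \<in> mor T (Xs n) W. p = connecting m \<cdot> shm m v"
proof (induction m arbitrary: p)
  case 0
  then show ?case by (intro bexI[of _ p]) simp_all
next
  case (Suc m)
  let ?j = "n - Suc m"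
  have j: "n - m = Suc ?j" using Suc.prems(1) by simp
  note p = Suc.prems(2)
  have "a ?j \<cdot> p = zero_mor T (Cs ?j) (sho (Suc m) W)"
  proof (cases "Suc m = n")
    case True
    then show ?thesis using Suc.prems(3) by simp
  next
    case False
    then have "orthogonal (Cs ?j) (sho (Suc m) W)"
      using C_orthogonal[OF Cs_in_C W, of "Suc m"] Suc.prems(1) by simp
    then show ?thesis
      by (rule orthogonalD[OF _ Cmp_closed[OF a_mor p]])
  qed
  then obtain p' where p': "p' \<in> mor T (sh_obj T (Xs (Suc ?j))) (sho (Suc m) W)" "p = d ?j \<cdot> p'"
    using tri_weak_cokernel_v[OF triangle p] by blast
  then have "p' \<in> mor T (sh_obj T (Xs (Suc ?j))) (sh_obj T (sho m W))" by simp
  then obtain p'' where p'': "p'' \<in> mor T (Xs (Suc ?j)) (sho m W)" "sh_mor T p'' = p'"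
    by (rule sh.map_surjE)
  then obtain v where v: "v \<in> mor T (Xs n) W" "p'' = connecting m \<cdot> shm m v"
    using Suc.IH[of p''] Suc.prems(1) j by auto
  then have "p = connecting (Suc m) \<cdot> shm (Suc m) v"
    unfolding connecting_Suc_Cmp(1)[OF Suc.prems(1) v(1)] using p'(2) p''(2) by simp
  then show ?case using v(1) by blast
qed

text \<open>If the composite vanishes, the part after its first factor \<open>d j\<close> comes, up
  to a shift, from a morphism C_j -> W[m] along \<open>b (Suc j)\<close>. That morphism is zero for
  m > 0, so the vanishing descends to m = 0, where the factorization is the one claimed.\<close>

lemma connecting_annihilator:
  assumes W: "W \<in> C" and v: "v \<in> mor T (Xs n) W"
  shows "1 \<le> m \<Longrightarrow> m \<le> n \<Longrightarrow>
    connecting m \<cdot> shm m v = zero_mor T (Xs (n - m)) (sho m W) \<Longrightarrow>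
    \<exists>g \<in> mor T (Cs (n - 1)) W. v = b n \<cdot> g"
proof (induction m)
  case (Suc m)
  let ?j = "n - Suc m"
  let ?y = "connecting m \<cdot> shm m v"
  have j: "n - m = Suc ?j" using Suc.prems(2) by simp
  note y = connecting_Suc_Cmp[OF Suc.prems(2) v]
  have sy: "sh_mor T ?y \<in> mor T (sh_obj T (Xs (Suc ?j))) (sh_obj T (sho m W))"
    by (rule sh.map_mor[OF y(2)])
  have "d ?j \<cdot> sh_mor T ?y = zero_mor T (Xs ?j) (sh_obj T (sho m W))"
    using Suc.prems(3) y(1) by simp
  then obtain g1 where g1: "g1 \<in> mor T (sh_obj T (Cs ?j)) (sh_obj T (sho m W))"
    "sh_mor T ?y = sh_mor T (b (Suc ?j)) \<cdot> g1"
    using tri_weak_cokernel_w[OF triangle sy] by blast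
  obtain g where g: "g \<in> mor T (Cs ?j) (sho m W)" "sh_mor T g = g1"
    using g1(1) by (rule sh.map_surjE)
  have yg: "?y = b (Suc ?j) \<cdot> g"
    using sh.map_eq_iff[OF y(2) Cmp_closed[OF b_mor g(1)]] sh.map_Cmp[OF b_mor g(1)] g1(2) g(2) by simp
  show ?case
  proof (cases "m = 0")
    case True
    then show ?thesis using yg g(1) v n by (intro bexI[of _ g]) simp_all
  next
    case False
    then have "orthogonal (Cs ?j) (sho m W)"
      using C_orthogonal[OF Cs_in_C W, of m] Suc.prems(2) by simp
    then have "g = zero_mor T (Cs ?j) (sho m W)"
      using g(1) by (rule orthogonalD)
    then have "?y = zero_mor T (Xs (n - m)) (sho m W)"
      using yg b_mor[of ?j] j by simp
    then show ?thesis using Suc.IH Suc.prems(2) False by simp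
  qed
qed simp

section \<open>Identification of the last term of the resolution\<close>

lemma connecting_n: "connecting n \<in> mor T (Xs 0) (sho n (Xs n))"
  using connecting_mor[of n] by simp

lemma b_n_rad: "b n \<in> rad (Xs n) (Cs (n - 1))"
  using b_rad[of "n - 1"] n by simp

text \<open>Since \<open>X_n[n]\<close> is in the image of C under the Serre functor, a morphism into it vanishes as soon
  as all its composites with morphisms from objects of C do.\<close>

lemma rad_connecting:
  assumes \<theta>: "\<theta> \<in> rad E (Xs 0)"
  shows "\<theta> \<cdot> connecting n = zero_mor T E (sho n (Xs n))"
proof (rule zero_if_C_annihilated[OF Xn_in_C])
  note \<theta>' = rad_mor[OF \<theta>]
  show "\<theta> \<cdot> connecting n \<in> mor T E (sho n (Xs n))"
    using \<theta>' connecting_n by auto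
  fix A f assume A: "A \<in> C" and f: "f \<in> mor T A E"
  have "f \<cdot> \<theta> \<in> (\<lambda>h. h \<cdot> a 0) ` mor T A (Cs 0)"
    unfolding sink[OF A] using f \<theta> by (rule Cmp_rad)
  then obtain h where h: "h \<in> mor T A (Cs 0)" "f \<cdot> \<theta> = h \<cdot> a 0" by blast
  obtain m where m: "n = Suc m" using n by (cases n) auto
  have c: "sh_mor T (connecting m) \<in> mor T (sh_obj T (Xs (Suc 0))) (sho n (Xs n))"
    using sh.map_mor[OF connecting_mor[of m]] m by simp
  have cn: "connecting n = d 0 \<cdot> sh_mor T (connecting m)"
    using connecting.simps(2)[of m] unfolding m[symmetric] by simp
  have "a 0 \<cdot> connecting n = zero_mor T (Cs 0) (sho n (Xs n))"
    unfolding cn using Cmp_assoc[OF a_mor d_mor c] tri_comp_vw[OF triangle, of 0] c by simp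
  then have "f \<cdot> \<theta> \<cdot> connecting n = zero_mor T A (sho n (Xs n))"
    unfolding h(2) using Cmp_assoc[OF h(1) a_mor connecting_n] h(1) by simp
  then show "f \<cdot> (\<theta> \<cdot> connecting n) = zero_mor T A (sho n (Xs n))"
    using Cmp_assoc[OF f \<theta>' connecting_n] by simp
qed

text \<open>The second conclusion serves the source map: once radical morphisms out of X_n
  annihilate \<open>connecting n\<close>, \<open>connecting_annihilator\<close> factors them through
  \<open>b n\<close>.\<close>

lemma end_term:
  obtains v where "is_iso T (Xs n) (serre_n T S n (Xs 0)) v"
    "\<And>W h. W \<in> C \<Longrightarrow> h \<in> rad (Xs n) W \<Longrightarrow> connecting n \<cdot> shm n h = zero_mor T (Xs 0) (sho n W)"
proof -
  let ?Q = "serre_n T S n (Xs 0)"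
  have Q: "?Q \<in> C" using serre_n_in_C[OF X_in_C] .
  obtain w where w: "w \<in> mor T (Xs 0) (sho n ?Q)"
    "\<And>E f. f \<in> mor T E (Xs 0) \<Longrightarrow> f \<cdot> w = zero_mor T E (sho n ?Q) \<longleftrightarrow> f \<in> rad E (Xs 0)"
    "\<And>B h. h \<in> mor T ?Q B \<Longrightarrow> w \<cdot> shm n h = zero_mor T (Xs 0) (sho n B) \<longleftrightarrow> h \<in> rad ?Q B"
    by (rule radical_morphism[of "Xs 0"]) (rule that)
  have "a 0 \<cdot> w = zero_mor T (Cs 0) (sho n ?Q)"
    using w(2)[OF a_mor] a0_rad by simp
  then obtain v where v: "v \<in> mor T (Xs n) ?Q" "w = connecting n \<cdot> shm n v"
    using factor_connecting[OF Q, of n w] w(1) by auto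
  \<comment> \<open>This E need not belong to C; therefore \<open>rad_connecting\<close> allows an
    arbitrary source.\<close>
  obtain E \<theta> z where t: "tri T E (Xs 0) (sho n ?Q) \<theta> w z"
    using cocone_exists[OF w(1)] by blast
  have \<theta>: "\<theta> \<in> mor T E (Xs 0)" using tri_typed[OF t] by simp
  then have "\<theta> \<in> rad E (Xs 0)"
    using w(2)[OF \<theta>] tri_comp_uv[OF t] by simp
  then have "\<theta> \<cdot> connecting n = zero_mor T E (sho n (Xs n))"
    by (rule rad_connecting)
  then obtain u0 where u0: "u0 \<in> mor T (sho n ?Q) (sho n (Xs n))" "connecting n = w \<cdot> u0"
    using tri_weak_cokernel_u[OF t connecting_n] by blast
  obtain u where u: "u \<in> mor T ?Q (Xs n)" "shm n u = u0"
    using u0(1) by (rule shp.map_surjE)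
  have vu: "v \<cdot> u \<in> mor T (Xs n) (Xs n)" and uv: "u \<cdot> v \<in> mor T ?Q ?Q" using u v by auto
  note sv = shp.map_mor[OF v(1), of n] and su = shp.map_mor[OF u(1), of n]
  \<comment> \<open>Hence 1 - vu, shifted, annihilates \<open>connecting n\<close>; it factors
    through the radical \<open>b n\<close>, so vu is invertible.\<close>
  have "connecting n \<cdot> shm n (v \<cdot> u) = connecting n"
    using shp.map_Cmp[OF v(1) u(1)] Cmp_assoc[OF connecting_n sv su] v(2)[symmetric] u0(2)[symmetric] u(2) by simp
  then have "connecting n \<cdot> shm n (Ident T (Xs n) \<ominus>\<^bsub>Hom T (Xs n) (Xs n)\<^esub> v \<cdot> u) =
      zero_mor T (Xs 0) (sho n (Xs n))"
    using shp.map_minus[OF Ident_closed vu, of n] connecting_n shp.map_mor[OF vu, of n]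
      Cmp_minus[OF connecting_n, of "Ident T (sho n (Xs n))" "sho n (Xs n)" "shm n (v \<cdot> u)"] by simp
  then obtain g where g: "g \<in> mor T (Cs (n - 1)) (Xs n)"
    "Ident T (Xs n) \<ominus>\<^bsub>Hom T (Xs n) (Xs n)\<^esub> v \<cdot> u = b n \<cdot> g"
    using connecting_annihilator[OF Xn_in_C Hom.minus_closed[OF Ident_closed vu] n order_refl] by auto
  have vu_iso: "is_iso T (Xs n) (Xs n) (v \<cdot> u)"
    using iso_if_minus_rad[OF vu] rad_Cmp[OF b_n_rad g(1)] g(2) by simp
  \<comment> \<open>On the other side the annihilator of w is the radical itself, so 1 - uv is
    radical at once.\<close>
  have "w \<cdot> shm n (u \<cdot> v) = w"
    using shp.map_Cmp[OF u(1) v(1)] Cmp_assoc[OF w(1) su sv] v(2)[symmetric] u0(2)[symmetric] u(2) by simp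
  then have "w \<cdot> shm n (Ident T ?Q \<ominus>\<^bsub>Hom T ?Q ?Q\<^esub> u \<cdot> v) = zero_mor T (Xs 0) (sho n ?Q)"
    using shp.map_minus[OF Ident_closed uv, of n] w(1) shp.map_mor[OF uv, of n]
      Cmp_minus[OF w(1), of "Ident T (sho n ?Q)" "sho n ?Q" "shm n (u \<cdot> v)"] by simp
  then have "Ident T ?Q \<ominus>\<^bsub>Hom T ?Q ?Q\<^esub> u \<cdot> v \<in> rad ?Q ?Q"
    using w(3)[of "Ident T ?Q \<ominus>\<^bsub>Hom T ?Q ?Q\<^esub> u \<cdot> v" ?Q] uv by simp
  then have uv_iso: "is_iso T ?Q ?Q (u \<cdot> v)"
    by (rule iso_if_minus_rad[OF uv])
  show thesis
  proof (rule that[of v])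
    show "is_iso T (Xs n) ?Q v"
      using is_iso_if_composites_iso[OF v(1) u(1) vu_iso uv_iso] .
    fix W h assume W: "W \<in> C" and h: "h \<in> rad (Xs n) W"
    note h' = rad_mor[OF h]
    \<comment> \<open>As \<open>connecting n\<close> is w followed by u[n], the known annihilator of
      w decides the question.\<close>
    have "u \<cdot> h \<in> rad ?Q W" using Cmp_rad[OF u(1) h] .
    then have "w \<cdot> shm n (u \<cdot> h) = zero_mor T (Xs 0) (sho n W)"
      using w(3)[OF Cmp_closed[OF u(1) h']] by simp
    moreover have "w \<cdot> shm n (u \<cdot> h) = connecting n \<cdot> shm n h"
      using shp.map_Cmp[OF u(1) h', of n] Cmp_assoc[OF w(1) su shp.map_mor[OF h']] u0(2)[symmetric] u(2) by simp
    ultimately show "connecting n \<cdot> shm n h = zero_mor T (Xs 0) (sho n W)" by simp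
  qed
qed

text \<open>Only the last triangle is changed: X_n is replaced by Y along an isomorphism e, and
  \<open>b n\<close> by \<open>e \<cdot> b n\<close>. The morphism \<open>a (n - 1)\<close> stays
  the same, and its radicality still gives left minimality.\<close>

lemma AR_angle_exists:
  assumes Y: "isomorphic T Y (serre_n T S n (Xs 0))"
  shows "\<exists>f. AR_angle T n C Y Cs (Xs 0) f"
proof -
  obtain v where v: "is_iso T (Xs n) (serre_n T S n (Xs 0)) v"
    "\<And>W h. W \<in> C \<Longrightarrow> h \<in> rad (Xs n) W \<Longrightarrow> connecting n \<cdot> shm n h = zero_mor T (Xs 0) (sho n W)"
    by (rule end_term) (rule that)
  obtain v' where v': "is_iso T (serre_n T S n (Xs 0)) (Xs n) v'"
    using v(1) by (rule is_isoE)
  obtain e0 where "is_iso T Y (serre_n T S n (Xs 0)) e0"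
    using Y unfolding isomorphic_def by blast
  then have "is_iso T Y (Xs n) (e0 \<cdot> v')"
    using v' by (rule is_iso_Cmp)
  then obtain e e' where e: "e \<in> mor T Y (Xs n)" "e' \<in> mor T (Xs n) Y" "e \<cdot> e' = Ident T Y"
    "e' \<cdot> e = Ident T (Xs n)" and e'_iso: "is_iso T (Xs n) Y e'"
    by (rule is_isoE)
  obtain m where m: "n = Suc m" using n by (cases n) auto
  have bn: "b n \<in> mor T (Xs n) (Cs m)" using b_mor[of m] m by simp
  have eb: "e \<cdot> b n \<in> mor T Y (Cs m)" using e(1) bn by auto
  have t: "tri T Y (Cs m) (Xs m) (e \<cdot> b n) (a m) (d m \<cdot> sh_mor T e')"
  proof (rule tri_iso[OF triangle[of m] eb a_mor _ _ is_iso_Ident is_iso_Ident])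
    have d: "d m \<in> mor T (Xs m) (sh_obj T (Xs n))" using d_mor[of m] m by simp
    show "is_iso T (Xs (Suc m)) Y e'" using e'_iso m by simp
    show "d m \<cdot> sh_mor T e' \<in> mor T (Xs m) (sh_obj T Y)"
      using d sh.map_mor[OF e(2)] by auto
    then show "d m \<cdot> sh_mor T e' = Ident T (Xs m) \<cdot> (d m \<cdot> sh_mor T e')" by simp
    show "b (Suc m) \<cdot> Ident T (Cs m) = e' \<cdot> (e \<cdot> b n)"
      using Cmp_assoc[OF e(2,1) bn] e(4) bn m by simp
    show "a m \<cdot> Ident T (Xs m) = Ident T (Cs m) \<cdot> a m"
      using a_mor[of m] by simp
  qed
  define Xs' where "Xs' = Xs(n := Y)"
  define b' where "b' = b(n := e \<cdot> b n)"
  define f where "f i = (if i = 0 then a 0 else if i < n then a i \<cdot> b i else b' n)" for i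
  have "glued_angle T n Xs' Cs a b' f"
    unfolding glued_angle_def
  proof (intro conjI allI impI)
    fix i assume i: "i < n"
    show "\<exists>w. tri T (Xs' (Suc i)) (Cs i) (Xs' i) (b' (Suc i)) (a i) w"
    proof (cases "i = m")
      case True
      then show ?thesis using t m unfolding Xs'_def b'_def by auto
    next
      case False
      then show ?thesis using triangle[of i] i m unfolding Xs'_def b'_def by auto
    qed
  qed (use n in \<open>auto simp: f_def b'_def\<close>)
  moreover have "sink_map T C (Cs 0) (Xs 0) (a 0)"
    unfolding sink_map_def using Cs_in_C X_in_C a0_rad sink right_minimal_if_rad[OF triangle b_rad]
    by simp
  moreover have Y_in_C: "Y \<in> C"
    using subcategory_C Xn_in_C e'_iso unfolding subcategory_def isomorphic_def by blast
  moreover have "source_map T C Y (Cs (n - 1)) (b' n)"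
  proof -
    have "e \<cdot> b n \<in> rad Y (Cs m)"
      using Cmp_rad[OF e(1) b_n_rad] m by simp
    moreover have "left_minimal T Y (Cs m) (e \<cdot> b n)"
      using left_minimal_if_rad[OF t] a_rad m by simp
    moreover have "(\<lambda>h. e \<cdot> b n \<cdot> h) ` mor T (Cs m) W = rad Y W" if W: "W \<in> C" for W
    proof (intro equalityI subsetI)
      fix h assume h: "h \<in> rad Y W"
      have "e' \<cdot> h \<in> rad (Xs n) W" using Cmp_rad[OF e(2) h] .
      \<comment> \<open>Radical morphisms out of X_n kill \<open>connecting n\<close>, so they
        factor through \<open>b n\<close>; e' and e transport the factorization to Y.\<close>
      then have "\<exists>g \<in> mor T (Cs (n - 1)) W. e' \<cdot> h = b n \<cdot> g"
        using connecting_annihilator[OF W, of "e' \<cdot> h" n] v(2)[OF W] n rad_mor by simp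
      then obtain g where g: "g \<in> mor T (Cs m) W" "e' \<cdot> h = b n \<cdot> g"
        using m by auto
      have "h = e \<cdot> b n \<cdot> g"
        using Cmp_assoc[OF e(1) bn g(1)] g(2)[symmetric] Cmp_assoc[OF e(1,2) rad_mor[OF h]] e(3)
          rad_mor[OF h] by simp
      then show "h \<in> (\<lambda>h. e \<cdot> b n \<cdot> h) ` mor T (Cs m) W" using g(1) by blast
    qed (use rad_Cmp[OF \<open>e \<cdot> b n \<in> rad Y (Cs m)\<close>] in blast)
    ultimately show ?thesis
      unfolding source_map_def b'_def using Y_in_C Cs_in_C m by simp
  qed
  moreover have "right_approximation T C (Cs i) (Xs' i) (a i) \<and> right_minimal T (Cs i) (Xs' i) (a i) \<and>
      left_approximation T C (Xs' i) (Cs (i - 1)) (b' i) \<and> left_minimal T (Xs' i) (Cs (i - 1)) (b' i)"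
    if i: "0 < i" "i < n" for i
  proof -
    obtain j where j: "i = Suc j" using i(1) by (cases i) auto
    have "left_minimal T (Xs (Suc j)) (Cs j) (b (Suc j))"
      using left_minimal_if_rad[OF triangle a_rad] i j by simp
    moreover have "right_minimal T (Cs i) (Xs i) (a i)"
      using right_minimal_if_rad[OF triangle b_rad] .
    ultimately show ?thesis
      using approximation[of i] left_approximation_b[of j] i j unfolding Xs'_def b'_def by simp
  qed
  ultimately have "AR_angle T n C Y Cs (Xs 0) f"
    unfolding AR_angle_def using X_in_C Cs_in_C n
    by (intro exI[of _ Xs'] exI[of _ a] exI[of _ b']) (auto simp: Xs'_def)
  then show ?thesis by blast
qed

end

lemma (in serre_cluster_tilting) AR_angle_exists:
  assumes X: "X \<in> C" and Y: "isomorphic T Y (serre_n T S n X)"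
  shows "\<exists>Cs f. AR_angle T n C Y Cs X f"
proof -
  obtain C0 a0 K0 b0 d0 where 0: "tri T K0 C0 X b0 a0 d0" "C0 \<in> C" "b0 \<in> rad K0 C0"
    "\<forall>W \<in> C. (\<lambda>h. h \<cdot> a0) ` mor T W C0 = rad W X"
    using sink_exists[of X] by blast
  \<comment> \<open>Approximation triangles are chosen for all objects at once, so the resolution
    beyond the sink map is the iteration of the single function \<open>K1\<close>.\<close>
  obtain C1 a1 K1 b1 d1 where 1: "\<And>Z. tri T (K1 Z) (C1 Z) Z (b1 Z) (a1 Z) (d1 Z)" "\<And>Z. C1 Z \<in> C"
    "\<And>Z. b1 Z \<in> rad (K1 Z) (C1 Z)" "\<And>Z. right_approximation T C (C1 Z) Z (a1 Z)"
    using minimal_right_approximation_exists by metis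
  define Xs where "Xs j = (case j of 0 \<Rightarrow> X | Suc i \<Rightarrow> (K1 ^^ i) K0)" for j
  have Xs: "Xs 0 = X" "Xs (Suc 0) = K0" "Xs (Suc (Suc j)) = K1 (Xs (Suc j))" for j
    unfolding Xs_def by simp_all
  define Cs where "Cs j = (if j = 0 then C0 else C1 (Xs j))" for j
  define a where "a j = (if j = 0 then a0 else a1 (Xs j))" for j
  define d where "d j = (if j = 0 then d0 else d1 (Xs j))" for j
  \<comment> \<open>The index is one higher than that of \<open>a\<close>: \<open>b (Suc j)\<close>
    belongs to the triangle ending in \<open>Xs j\<close>, and the sink map owns
    \<open>b 1\<close>.\<close>
  define b where "b j = (if j = Suc 0 then b0 else b1 (Xs (j - 1)))" for j
  interpret sink_resolution k T S S_inv n C Xs Cs a b d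
  proof
    fix j
    show "Xs 0 \<in> C" using X Xs by simp
    show "tri T (Xs (Suc j)) (Cs j) (Xs j) (b (Suc j)) (a j) (d j)"
      "Cs j \<in> C" "b (Suc j) \<in> rad (Xs (Suc j)) (Cs j)"
      using 0 1 Xs unfolding Cs_def a_def b_def d_def by (cases j; simp)+
    show "right_approximation T C (Cs j) (Xs j) (a j)" if "1 \<le> j"
      using 1 that unfolding Cs_def a_def by simp
    show "(\<lambda>h. h \<cdot> a 0) ` mor T W (Cs 0) = rad W (Xs 0)" if "W \<in> C" for W
      using 0 Xs that unfolding Cs_def a_def by simp
  qed
  show ?thesis
    using AR_angle_exists[of Y] Y unfolding Xs(1) by blast
qed

theorem theorem3p10:
  fixes k :: "('k, 'r) ring_scheme"
    and T :: "('o, 'm, 'k, 'z) tri_cat_scheme"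
    and S S_inv :: "('o, 'm) endofunctor"
    and n :: nat
    and C :: "'o set"
  assumes "triangulated_category k T"
    and "krull_schmidt T"
    and "hom_finite k T"
    and "serre_functor k T S"
    and "quasi_inverse k T S S_inv"
    and "n \<ge> 1"
    and "n_cluster_tilting T n C"
  shows "(\<forall>X \<in> C. \<exists>Cs f. AR_angle T n C (serre_n T S n X) Cs X f) \<and>
         (\<forall>Y \<in> C. \<exists>Cs f. AR_angle T n C Y Cs (serre_n_inv T S_inv n Y) f)"
proof -
  interpret serre_cluster_tilting k T S S_inv n C
    using assms unfolding serre_cluster_tilting_def serre_cluster_tilting_axioms_def by blast
  show ?thesis
  proof (intro conjI ballI)
    fix X assume "X \<in> C"
    then show "\<exists>Cs f. AR_angle T n C (serre_n T S n X) Cs X f"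
      by (rule AR_angle_exists) (auto simp: isomorphic_def intro: is_iso_Ident)
  next
    fix Y assume Y: "Y \<in> C"
    \<comment> \<open>The n-fold shifts cancel on the nose, but S after its quasi-inverse returns Y
      only up to isomorphism; hence the angle is requested with Y itself as first term.\<close>
    have "serre_n T S n (serre_n_inv T S_inv n Y) = obj_map S (obj_map S_inv Y)"
      unfolding serre_n_def serre_n_inv_def by simp
    moreover have "isomorphic T Y (obj_map S (obj_map S_inv Y))"
      using quasi_inverse_iso[OF quasi_inverse_sym[OF assms(5)], of Y] is_isoE
      unfolding isomorphic_def by metis
    ultimately show "\<exists>Cs f. AR_angle T n C Y Cs (serre_n_inv T S_inv n Y) f"
      using AR_angle_exists[OF serre_n_inv_in_C[OF Y]] by simp
  qed
qed

end
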